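(* Let $s,p\in\mathbb{R}$ and $\alpha>1/2$ satisfy $\alpha+s>0$ and $\alpha+(p-1/2)>0$. Suppose that $l^\dagger=\{l_j^\dagger\}\in\mathcal{H}^s$; that the prior variances satisfy $\sigma_j^2=\Theta(j^{-2p})$ as $j\to\infty$; that the training covariance satisfies $\vartheta_j^2=\langle\varphi_j,\Lambda\varphi_j\rangle=\Theta(j^{-2\alpha})$ as $j\to\infty$; and that the training distribution $\nu$ satisfies the moment assumption (M) in the context. Let $\mathcal{G}_N=\mathcal{R}_\infty(\bar L^{(N)})-\mathcal{R}_N(\bar L^{(N)})$ be the generalization gap of the posterior mean. Then $$\mathbb{E}^{D_N}|\mathcal{G}_N|=O\Bigl(N^{-\min\left\{\frac12,\ \frac{\alpha+p-1/2}{\alpha+p}\right\}}\Bigr)\quad\text{as }N\to\infty.$$ Additionally, if $(\alpha+s)/(\alpha+p)\ge2$, then for any positive sequence $\{\tau_n\}$ such that $\tau_n\to0$ and $n^{1/2}\tau_n\to\infty$ as $n\to\infty$, $$\mathbb{E}^{D_N}|\mathcal{G}_N|=\Omega\Bigl(\tau_NN^{-\frac{\alpha+p-1/2}{\alpha+p}}\Bigr)\quad\text{as }N\to\infty.$$ If instead $(\alpha+s)/(\alpha+p)<2$, then this last lower bound remains valid provided that $p<1+\alpha+2s$ and the positive sequence $\tau_n\to0$ satisfies $\max\bigl\{n^{-1/2},\,n^{-(1+\alpha+2s-p)/(2\alpha+2p)}\bigr\}=o(\tau_n)$ as $n\to\infty$.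
   Context: $H$ is a real, separable, infinite-dimensional Hilbert space with inner product $\langle\cdot,\cdot\rangle$ and norm $\|\cdot\|$; $\{\varphi_j\}_{j\in\mathbb{N}}$ is a fixed known orthonormal basis of $H$. For $s\in\mathbb{R}$, $\mathcal{H}^s=\{v:\mathbb{N}\to\mathbb{R}:\|v\|_{\mathcal{H}^s}^2=\sum_jj^{2s}|v_j|^2<\infty\}$. For nonnegative sequences, $a_n=O(b_n)$ means $\limsup a_n/b_n<\infty$, $a_n=\Omega(b_n)$ means $b_n=O(a_n)$, $a_n=\Theta(b_n)$ means both, $a_n=o(b_n)$ means $a_n/b_n\to0$. Truth: $L^\dagger=\sum_jl_j^\dagger\varphi_j\otimes\varphi_j$ is a fixed, possibly unbounded, self-adjoint operator on $H$ with real eigenvalues $l_j^\dagger$ and domain $\{h\in H:\sum_j|l_j^\dagger|^2\langle\varphi_j,h\rangle^2<\infty\}$. Data: $\gamma>0$ is fixed; $\nu$ is a centered Borel probability measure on $H$ with finite second moment and strictly positive-definite trace-class covariance operator $\Lambda$; $x_1,\dots,x_N$ are i.i.d. from $\nu$; $g_{jn}=\langle\varphi_j,x_n\rangle$; $y_{jn}=g_{jn}l_j^\dagger+\gamma\xi_{jn}$ for $j\in\mathbb{N}$, $1\le n\le N$, with $\xi_{jn}$ i.i.d. $\mathcal{N}(0,1)$ independent of $X=(x_1,\dots,x_N)$. Formally $y_n=L^\dagger x_n+\gamma\xi_n$ with $\xi_n$ Gaussian white noise $\mathcal{N}(0,\mathrm{Id})$ on $H$ and $y_{jn}=\langle\varphi_j,y_n\rangle$.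 $Y=\{y_{jn}\}$, $D_N=(X,Y)$, and $\mathbb{E}^{D_N}$ is expectation over the joint law of $D_N$. Prior and posterior mean: the prior on the eigenvalues is $\bigotimes_j\mathcal{N}(0,\sigma_j^2)$ with $\sigma_j^2>0$ for all $j$. The posterior mean is $\bar L^{(N)}=\sum_j\bar l_j^{(N)}\varphi_j\otimes\varphi_j$ with $$\bar l_j^{(N)}=\frac{N\gamma^{-2}\sigma_j^2\,\frac1N\sum_{n}y_{jn}g_{jn}}{1+N\gamma^{-2}\sigma_j^2\,\frac1N\sum_ng_{jn}^2}.$$ Risks: for an operator $L=\sum_jl_j\varphi_j\otimes\varphi_j$, the expected risk is $$\mathcal{R}_\infty(L)=\mathbb{E}_{(x,y)}\bigl[\tfrac12\|Lx\|^2-\langle y,Lx\rangle\bigr]=\tfrac12\sum_j\vartheta_j^2l_j^2-\sum_j\vartheta_j^2l_j^\dagger l_j,$$ where $x\sim\nu$, $y=L^\dagger x+\gamma\xi$ with $\xi\sim\mathcal{N}(0,\mathrm{Id})$ white noise independent of $x$ (and $(x,y)$ is independent of $D_N$ when $L$ depends on $D_N$), and the empirical risk is $$\mathcal{R}_N(L)=\frac1N\sum_{n=1}^N\Bigl[\tfrac12\|Lx_n\|^2-\langle y_n,Lx_n\rangle\Bigr],\qquad\|Lx_n\|^2=\sum_jl_j^2g_{jn}^2,\quad\langle y_n,Lx_n\rangle=\sum_jl_jy_{jn}g_{jn}.$$ Assumption (M): $x\sim\nu$ has Karhunen–Loève expansion $x=\sum_k\lambda_k\zeta_k\phi_k$,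 where $\{\phi_k\}$ is an orthonormal eigenbasis of $\Lambda$ with nonincreasing eigenvalues $\lambda_k^2$, and the zero mean, unit variance random variables $\{\zeta_k\}$ are independent, have finite fourth moments, and satisfy $\mathbb{E}[\zeta_k^4]=O(1)$ as $k\to\infty$. Moreover, there is a constant $C$ such that $\limsup_{N\to\infty}\mathbb{E}\bigl[(\frac1N\sum_{n=1}^Ng_{jn}^2)^{-4}\bigr]\le C\langle\varphi_j,\Lambda\varphi_j\rangle^{-4}$ for all $j\in\mathbb{N}$. *)

theory Defs
  imports "HOL-Probability.Probability" "HOL-Library.Landau_Symbols"
begin

text \<open>
  The Hilbert space \<open>H\<close> is a type \<open>'a\<close> of class
  \<open>{real_inner, banach, second_countable_topology}\<close> carrying an orthonormal basis indexed by
  \<open>nat\<close> (which forces infinite dimension).  Coordinates are indexed from 0 here, so the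
  \<open>j\<close>-th coordinate, \<open>j \<ge> 1\<close>, of the usual convention has index \<open>j - 1\<close>, and the weight
  \<open>j\<close> becomes \<open>real (Suc j)\<close>.  Likewise the samples \<open>1, \<dots>, N\<close> are indexed by \<open>{..<N}\<close>.
\<close>

definition orthonormal_basis :: "(nat \<Rightarrow> 'a::real_inner) \<Rightarrow> bool" where
  "orthonormal_basis b \<longleftrightarrow>
     (\<forall>i j. b i \<bullet> b j = (if i = j then 1 else 0)) \<and> closure (span (range b)) = UNIV"

definition sobolev_seq :: "real \<Rightarrow> (nat \<Rightarrow> real) set" where
  "sobolev_seq s = {v. summable (\<lambda>j. real (Suc j) powr (2 * s) * \<bar>v j\<bar>\<^sup>2)}"

text \<open>
  The operator \<open>\<Sum>\<^sub>j l\<^sub>j \<phi>\<^sub>j \<otimes> \<phi>\<^sub>j\<close>.  The series converges exactly on the natural domain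
  \<open>{h. summable (\<lambda>j. (l j)\<^sup>2 * (\<phi> j \<bullet> h)\<^sup>2)}\<close>; the value elsewhere is immaterial.
\<close>

definition diag_op :: "(nat \<Rightarrow> 'a::{real_inner, banach}) \<Rightarrow> (nat \<Rightarrow> real) \<Rightarrow> 'a \<Rightarrow> 'a" where
  "diag_op \<phi> l h = (\<Sum>j. (l j * (\<phi> j \<bullet> h)) *\<^sub>R \<phi> j)"


subsection \<open>The training distribution\<close>

definition covariance ::
    "'a::{real_inner, banach, second_countable_topology} measure \<Rightarrow> 'a \<Rightarrow> 'a" where
  "covariance \<nu> h = (\<integral>x. (x \<bullet> h) *\<^sub>R x \<partial>\<nu>)"

text \<open>
  Summability of the diagonal in the basis \<open>\<phi>\<close> is trace-class for the nonnegative operator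
  \<open>covariance \<nu>\<close>.
\<close>

definition training_distribution ::
    "(nat \<Rightarrow> 'a::{real_inner, banach, second_countable_topology}) \<Rightarrow> 'a measure \<Rightarrow> bool" where
  "training_distribution \<phi> \<nu> \<longleftrightarrow>
     prob_space \<nu> \<and> sets \<nu> = sets borel \<and>
     integrable \<nu> (\<lambda>x. (norm x)\<^sup>2) \<and> (\<integral>x. x \<partial>\<nu>) = 0 \<and>
     (\<forall>h. h \<noteq> 0 \<longrightarrow> 0 < h \<bullet> covariance \<nu> h) \<and>
     summable (\<lambda>j. \<phi> j \<bullet> covariance \<nu> (\<phi> j))"

text \<open>
  The variables \<open>\<zeta>\<^sub>k\<close> live on the probability space \<open>\<nu>\<close> itself, with \<open>x\<close> the identity.
  The sign of \<open>lam k\<close> can be absorbed into \<open>\<zeta> k\<close> and is left free.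
\<close>

definition karhunen_loeve_moments ::
    "'a::{real_inner, banach, second_countable_topology} measure \<Rightarrow> bool" where
  "karhunen_loeve_moments \<nu> \<longleftrightarrow>
     (\<exists>(e :: nat \<Rightarrow> 'a) (lam :: nat \<Rightarrow> real) (\<zeta> :: nat \<Rightarrow> 'a \<Rightarrow> real).
        orthonormal_basis e \<and>
        (\<forall>k. covariance \<nu> (e k) = (lam k)\<^sup>2 *\<^sub>R e k) \<and>
        decseq (\<lambda>k. (lam k)\<^sup>2) \<and>
        (AE x in \<nu>. (\<lambda>k. (lam k * \<zeta> k x) *\<^sub>R e k) sums x) \<and>
        prob_space.indep_vars \<nu> (\<lambda>_. borel) \<zeta> UNIV \<and>
        (\<forall>k. integrable \<nu> (\<lambda>x. \<zeta> k x ^ 4)) \<and>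
        (\<forall>k. (\<integral>x. \<zeta> k x \<partial>\<nu>) = 0) \<and>
        (\<forall>k. (\<integral>x. (\<zeta> k x)\<^sup>2 \<partial>\<nu>) = 1) \<and>
        (\<lambda>k. \<integral>x. \<zeta> k x ^ 4 \<partial>\<nu>) \<in> O(\<lambda>_. 1))"

text \<open>
  Negative moments are taken in \<open>ennreal\<close>, where \<open>inverse 0 = \<infinity>\<close>, so that the event on which
  the empirical second moment vanishes is not silently discarded.
\<close>

definition negative_moments ::
    "(nat \<Rightarrow> 'a::{real_inner, banach, second_countable_topology}) \<Rightarrow> 'a measure \<Rightarrow> bool" where
  "negative_moments \<phi> \<nu> \<longleftrightarrow>
     (\<exists>C::real. \<forall>j.
        limsup (\<lambda>N. \<integral>\<^sup>+X. inverse (ennreal (1 / real N * (\<Sum>n<N. (\<phi> j \<bullet> X n)\<^sup>2))) ^ 4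
                   \<partial>(\<Pi>\<^sub>M n\<in>{..<N}. \<nu>))
          \<le> ennreal (C / (\<phi> j \<bullet> covariance \<nu> (\<phi> j)) ^ 4))"

definition moment_assumption ::
    "(nat \<Rightarrow> 'a::{real_inner, banach, second_countable_topology}) \<Rightarrow> 'a measure \<Rightarrow> bool" where
  "moment_assumption \<phi> \<nu> \<longleftrightarrow> karhunen_loeve_moments \<nu> \<and> negative_moments \<phi> \<nu>"


subsection \<open>Data\<close>

definition std_gaussian :: "real measure" where
  "std_gaussian = density lborel (\<lambda>t. ennreal (std_normal_density t))"

text \<open>
  A data set is a pair \<open>(X, Y)\<close> with \<open>X n = x\<^sub>n\<close> and \<open>Y (j, n) = y\<^sub>j\<^sub>n\<close>; its law is the image of
  \<open>\<nu>\<^bsup>\<otimes>N\<^esup> \<otimes> N(0,1)\<^bsup>\<otimes>(\<nat>\<times>N)\<^esup>\<close> under the observation map.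
\<close>

type_synonym 'a dataset = "(nat \<Rightarrow> 'a) \<times> (nat \<times> nat \<Rightarrow> real)"

definition data_law ::
    "(nat \<Rightarrow> 'a::{real_inner, banach, second_countable_topology}) \<Rightarrow> 'a measure \<Rightarrow> real
      \<Rightarrow> (nat \<Rightarrow> real) \<Rightarrow> nat \<Rightarrow> 'a dataset measure" where
  "data_law \<phi> \<nu> \<gamma> ldag N =
     distr ((\<Pi>\<^sub>M n\<in>{..<N}. \<nu>) \<Otimes>\<^sub>M (\<Pi>\<^sub>M i\<in>UNIV \<times> {..<N}. std_gaussian))
           ((\<Pi>\<^sub>M n\<in>{..<N}. borel) \<Otimes>\<^sub>M (\<Pi>\<^sub>M i\<in>UNIV \<times> {..<N}. borel))
           (\<lambda>(X, \<Xi>). (X, \<lambda>(j, n)\<in>UNIV \<times> {..<N}. (\<phi> j \<bullet> X n) * ldag j + \<gamma> * \<Xi> (j, n)))"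

text \<open>
  The law of a single pair \<open>(x, y)\<close>, \<open>y = L\<^sup>\<dagger> x + \<gamma> \<xi>\<close>, where the distribution-valued \<open>y\<close> is
  represented by its coordinate sequence.
\<close>

definition pair_law ::
    "(nat \<Rightarrow> 'a::{real_inner, banach, second_countable_topology}) \<Rightarrow> 'a measure \<Rightarrow> real
      \<Rightarrow> (nat \<Rightarrow> real) \<Rightarrow> ('a \<times> (nat \<Rightarrow> real)) measure" where
  "pair_law \<phi> \<nu> \<gamma> ldag =
     distr (\<nu> \<Otimes>\<^sub>M (\<Pi>\<^sub>M j\<in>UNIV. std_gaussian)) (borel \<Otimes>\<^sub>M (\<Pi>\<^sub>M j\<in>UNIV. borel))
           (\<lambda>(x, \<xi>). (x, \<lambda>j. (\<phi> j \<bullet> x) * ldag j + \<gamma> * \<xi> j))"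


subsection \<open>Posterior mean, risks and generalization gap\<close>

definition posterior_mean ::
    "(nat \<Rightarrow> 'a::real_inner) \<Rightarrow> real \<Rightarrow> (nat \<Rightarrow> real) \<Rightarrow> nat \<Rightarrow> 'a dataset \<Rightarrow> nat \<Rightarrow> real" where
  "posterior_mean \<phi> \<gamma> \<sigma> N D j = (case D of (X, Y) \<Rightarrow>
     (real N * inverse (\<gamma>\<^sup>2) * (\<sigma> j)\<^sup>2 * (1 / real N * (\<Sum>n<N. Y (j, n) * (\<phi> j \<bullet> X n)))) /
     (1 + real N * inverse (\<gamma>\<^sup>2) * (\<sigma> j)\<^sup>2 * (1 / real N * (\<Sum>n<N. (\<phi> j \<bullet> X n)\<^sup>2))))"

text \<open>
  The loss \<open>\<onehalf>\<parallel>L x\<parallel>\<^sup>2 - \<langle>y, L x\<rangle>\<close> of \<open>L = diag_op \<phi> l\<close>; as \<open>y\<close> is not in \<open>H\<close>, the pairing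
  \<open>\<langle>y, L x\<rangle>\<close> is by definition the coordinate series.
\<close>

definition loss ::
    "(nat \<Rightarrow> 'a::{real_inner, banach}) \<Rightarrow> (nat \<Rightarrow> real) \<Rightarrow> 'a \<Rightarrow> (nat \<Rightarrow> real) \<Rightarrow> real" where
  "loss \<phi> l x y = 1 / 2 * (norm (diag_op \<phi> l x))\<^sup>2 - (\<Sum>j. l j * y j * (\<phi> j \<bullet> x))"

definition expected_risk ::
    "(nat \<Rightarrow> 'a::{real_inner, banach, second_countable_topology}) \<Rightarrow> 'a measure \<Rightarrow> real
      \<Rightarrow> (nat \<Rightarrow> real) \<Rightarrow> (nat \<Rightarrow> real) \<Rightarrow> real" where
  "expected_risk \<phi> \<nu> \<gamma> ldag l = (\<integral>(x, y). loss \<phi> l x y \<partial>pair_law \<phi> \<nu> \<gamma> ldag)"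

definition empirical_risk ::
    "(nat \<Rightarrow> 'a::{real_inner, banach}) \<Rightarrow> nat \<Rightarrow> 'a dataset \<Rightarrow> (nat \<Rightarrow> real) \<Rightarrow> real" where
  "empirical_risk \<phi> N D l = (case D of (X, Y) \<Rightarrow>
     1 / real N * (\<Sum>n<N. loss \<phi> l (X n) (\<lambda>j. Y (j, n))))"

definition generalization_gap ::
    "(nat \<Rightarrow> 'a::{real_inner, banach, second_countable_topology}) \<Rightarrow> 'a measure \<Rightarrow> real
      \<Rightarrow> (nat \<Rightarrow> real) \<Rightarrow> (nat \<Rightarrow> real) \<Rightarrow> nat \<Rightarrow> 'a dataset \<Rightarrow> real" where
  "generalization_gap \<phi> \<nu> \<gamma> ldag \<sigma> N D =
     expected_risk \<phi> \<nu> \<gamma> ldag (posterior_mean \<phi> \<gamma> \<sigma> N D) -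
     empirical_risk \<phi> N D (posterior_mean \<phi> \<gamma> \<sigma> N D)"

definition expected_abs_gap ::
    "(nat \<Rightarrow> 'a::{real_inner, banach, second_countable_topology}) \<Rightarrow> 'a measure \<Rightarrow> real
      \<Rightarrow> (nat \<Rightarrow> real) \<Rightarrow> (nat \<Rightarrow> real) \<Rightarrow> nat \<Rightarrow> real" where
  "expected_abs_gap \<phi> \<nu> \<gamma> ldag \<sigma> N =
     (\<integral>D. \<bar>generalization_gap \<phi> \<nu> \<gamma> ldag \<sigma> N D\<bar> \<partial>data_law \<phi> \<nu> \<gamma> ldag N)"

end

theory Submission
  imports Defs
begin

text \<open>
  Fix the sample size \<open>N\<close>. In the \<open>j\<close>-th coordinate let \<open>t\<close> be the variance of the design, \<open>S\<close> its
  empirical second moment, \<open>W\<close> the empirical average of design times noise, \<open>l\<close> the true eigenvalue,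
  \<open>a = N \<sigma>\<^sup>2 / \<gamma>\<^sup>2\<close> and \<open>v = a S\<close>. The posterior mean is
  \<open>L = v / (1 + v) l + \<gamma> a / (1 + v) W\<close>, and expanding both risks shows that the generalization gap is
  the sum over \<open>j\<close> of
  \<open>1/2 (t - S) ((L - l)\<^sup>2 - l\<^sup>2) + \<gamma> L W\<close>.
  The series \<open>\<Sum> l\<^sup>2 t\<close> and \<open>\<Sum> \<sigma>\<^sup>2 t\<close> converge under the assumptions on the exponents, and this makes
  every series that occurs absolutely convergent almost surely, and the gap summable in mean.

  The rate comes from the part of \<open>\<gamma> L W\<close> that is quadratic in the noise. Conditionally on the design
  it has mean \<open>\<gamma>\<^sup>2/N \<Sum> v / (1 + v)\<close>, which is of the order of \<open>1/N \<Sum> min 1 (a t)\<close>, the effective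
  dimension divided by the sample size. As \<open>a t\<close> is comparable to \<open>N\<close> times \<open>j\<close> to the power \<open>- 2 (\<alpha> + p)\<close>,
  the effective dimension is comparable to \<open>N\<close> to the power \<open>1 / (2 (\<alpha> + p))\<close>
  (\<open>sum_min_powr_le\<close>, \<open>sum_min_powr_ge\<close>), and dividing by \<open>N\<close> gives the exponent
  \<open>(\<alpha> + p - 1/2) / (\<alpha> + p)\<close>.

  For the upper bound, the part of \<open>\<gamma> L W\<close> that is linear in the noise is a sum of orthogonal random
  variables, hence of order \<open>N\<close> to the power \<open>- 1 / 2\<close> in absolute mean (\<open>noise_cross_partial_sum\<close>).
  In the remaining part, the truth contributes \<open>\<Sum> l\<^sup>2 |S - t|\<close>, which is of the same order because the fourth moment of each linear
  functional of \<open>x\<close> is bounded by a multiple of its squared variance (\<open>karhunen_loeve_fourth_moment\<close>),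
  and the noise contributes at most a multiple of the effective dimension over \<open>N\<close> plus \<open>O(1/N)\<close>
  (\<open>gap_rest_expectation\<close>). The event that \<open>S\<close> is much smaller than \<open>t\<close> is handled by Chebyshev's
  inequality: its probability \<open>O(1/N)\<close> compensates the factor \<open>a t\<close>, whose sum over \<open>j\<close> is of order \<open>N\<close>.

  For the lower bound it suffices to bound the mean of the gap from below
  (\<open>gap_term_expectation\<close>). The terms linear in the noise have mean zero. The part that comes from the
  truth has nonnegative mean, since \<open>t - S\<close> is centered and both \<open>t - S\<close> and \<open>1 / (1 + v)\<^sup>2\<close> decrease in
  \<open>S\<close>. In the part quadratic in the noise, the factor \<open>t - S\<close> can destroy at most half of the
  contribution of \<open>\<gamma> L W\<close>. So the mean absolute gap is bounded below by a multiple of \<open>N\<close> to the power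
  \<open>- (\<alpha> + p - 1/2) / (\<alpha> + p)\<close>, and both lower bounds of the theorem follow as \<open>\<tau> N \<le> 1\<close> eventually.
\<close>

section \<open>Power sums and the effective dimension\<close>

lemma abs_mult_le_squares: "\<bar>u * w\<bar> \<le> 1 / 2 * (u\<^sup>2 + w\<^sup>2)" for u w :: real
  using sum_squares_bound[of u w] sum_squares_bound[of u "-w"] by (auto simp: abs_if)

text \<open>
  For positive sequences, the finitely many indices that the asymptotic comparison does not cover are
  absorbed by larger constants, so that the comparison holds at every index.
\<close>

lemma bigtheta_pointwise_bounds:
  fixes f g :: "nat \<Rightarrow> real"
  assumes "f \<in> \<Theta>(g)" and f: "\<And>j. 0 < f j" and g: "\<And>j. 0 < g j"
  obtains c C where "0 < c" "0 < C" "\<And>j. c * g j \<le> f j" "\<And>j. f j \<le> C * g j"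
proof -
  have bound: "\<exists>C>0. \<forall>j. u j \<le> C * w j" 
    if uw: "u \<in> O(w)" and u: "\<And>j. 0 < u j" and w: "\<And>j. 0 < w j" for u w :: "nat \<Rightarrow> real"
  proof -
    obtain C where C: "C > 0" "eventually (\<lambda>j. norm (u j) \<le> C * norm (w j)) sequentially"
      using landau_o.bigE[OF uw] by metis
    then obtain n where n: "\<And>j. j \<ge> n \<Longrightarrow> u j \<le> C * w j"
      using u w unfolding eventually_sequentially by (auto simp: abs_of_pos)
    define D where "D = C + (\<Sum>j<n. u j / w j)"
    have "u j \<le> D * w j" for j
    proof (cases "j < n")
      case True
      have "u j / w j \<le> (\<Sum>j<n. u j / w j)"
        using True u w by (intro member_le_sum) (auto simp: less_imp_le)
      then have "u j / w j \<le> D" using C(1) by (simp add: D_def)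
      then show ?thesis using w[of j] by (simp add: divide_le_eq)
    next
      case False
      have "0 \<le> (\<Sum>j<n. u j / w j)" using u w by (intro sum_nonneg) (auto simp: less_imp_le)
      then have "C * w j \<le> D * w j" using w[of j] by (intro mult_right_mono) (auto simp: D_def)
      with n[of j] False show ?thesis by simp
    qed
    moreover have "D > 0" unfolding D_def
      using C(1) u w by (intro add_pos_nonneg sum_nonneg) (auto simp: less_imp_le)
    ultimately show ?thesis by blast
  qed
  have "f \<in> O(g)" "g \<in> O(f)" using assms(1) by (auto simp: bigtheta_def bigomega_iff_bigo)
  from bound[OF this(1) f g] bound[OF this(2) g f]
  obtain C D where "C > 0" "\<And>j. f j \<le> C * g j" "D > 0" "\<And>j. g j \<le> D * f j" by blast
  then show thesis
    by (intro that[of "inverse D" C]) (auto simp: field_simps)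
qed

text \<open>
  By the mean value theorem each term is at most a difference of consecutive values of
  \<open>n powr (1 - b) / (b - 1)\<close>, and these differences telescope.
\<close>

lemma powr_tail_le:
  fixes b :: real
  assumes "b > 1" and "m \<ge> 1"
  shows "(\<Sum>j=m..<n. real (Suc j) powr (- b)) \<le> real m powr (1 - b) / (b - 1)"
proof -
  have step: "real (Suc j) powr (- b) \<le> (real j powr (1 - b) - real (Suc j) powr (1 - b)) / (b - 1)"
    if "j \<ge> 1" for j
  proof -
    have "\<exists>z. real j < z \<and> z < real (Suc j) \<and>
       real (Suc j) powr (1 - b) - real j powr (1 - b) = (real (Suc j) - real j) * ((1 - b) * z powr (1 - b - 1))"
      using that by (intro MVT2 has_real_derivative_powr) auto
    then obtain z where z: "real j < z" "z < real (Suc j)"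
      "real (Suc j) powr (1 - b) - real j powr (1 - b) = (1 - b) * z powr (- b)" by auto
    have "real (Suc j) powr (- b) \<le> z powr (- b)"
      using z that assms by (intro powr_mono2') auto
    moreover have "z powr (-b) = (real j powr (1 - b) - real (Suc j) powr (1 - b)) / (b - 1)"
      using z(3) assms(1) by (simp add: field_simps)
    ultimately show ?thesis by simp
  qed
  have "(\<Sum>j=m..<n. real (Suc j) powr (- b)) \<le>
      (real m powr (1 - b) - real (max m n) powr (1 - b)) / (b - 1)"
  proof (induction n)
    case (Suc n)
    show ?case
    proof (cases "m \<le> n")
      case True
      then show ?thesis using Suc step[of n] assms
        by (simp add: max_def diff_divide_distrib split: if_splits)
    next
      case False
      then have "max m (Suc n) = m" by simp
      with False show ?thesis by simp
    qed
  qed (use assms in auto)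
  also have "\<dots> \<le> real m powr (1 - b) / (b - 1)"
    using assms by (intro divide_right_mono) auto
  finally show ?thesis .
qed

text \<open>
  The effective dimension at sample size \<open>N\<close>: the minimum is \<open>1\<close> roughly up to the index at which
  \<open>N j powr (- 2 \<beta>)\<close> falls below \<open>1\<close>, which is \<open>N powr (1 / (2 \<beta>))\<close>, and the tail beyond that index is
  of the same order.
\<close>

lemma sum_min_powr_le:
  fixes \<beta> C :: real
  assumes \<beta>: "\<beta> > 1 / 2" and C: "C > 0" and N: "N \<ge> (1::nat)"
  shows "(\<Sum>j<n. min 1 (C * real N * real (Suc j) powr (- 2 * \<beta>)))
    \<le> (2 + C / (2 * \<beta> - 1)) * real N powr (1 / (2 * \<beta>))"
proof -
  define R where "R = real N powr (1 / (2 * \<beta>))"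
  have R1: "R \<ge> 1" unfolding R_def using N \<beta> by (intro ge_one_powr_ge_zero) auto
  define m where "m = nat \<lceil>R\<rceil>"
  have m: "R \<le> real m" "real m \<le> R + 1" "m \<ge> 1" using R1 by (auto simp: m_def) linarith+
  have "(\<Sum>j<n. min 1 (C * real N * real (Suc j) powr (- 2 * \<beta>)))
     \<le> (\<Sum>j<m+n. min 1 (C * real N * real (Suc j) powr (- 2 * \<beta>)))"
    using C by (intro sum_mono2) auto
  also have "\<dots> = (\<Sum>j<m. min 1 (C * real N * real (Suc j) powr (- 2 * \<beta>)))
      + (\<Sum>j=m..<m+n. min 1 (C * real N * real (Suc j) powr (- 2 * \<beta>)))"
    unfolding lessThan_atLeast0 by (intro sum.atLeastLessThan_concat[symmetric]) auto
  also have "\<dots> \<le> (\<Sum>j<m. 1) + (\<Sum>j=m..<m+n. C * real N * real (Suc j) powr (- (2 * \<beta>)))"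
    by (intro add_mono sum_mono) auto
  also have "\<dots> = real m + C * real N * (\<Sum>j=m..<m+n. real (Suc j) powr (- (2 * \<beta>)))"
    by (simp add: sum_distrib_left)
  also have "\<dots> \<le> (R + 1) + C * real N * (real m powr (1 - 2 * \<beta>) / (2 * \<beta> - 1))"
    using m C \<beta> by (intro add_mono mult_left_mono powr_tail_le) auto
  also have "\<dots> \<le> 2 * R + C * real N * (R powr (1 - 2 * \<beta>) / (2 * \<beta> - 1))"
    using m C \<beta> R1 by (intro add_mono mult_left_mono divide_right_mono powr_mono2') auto
  also have "R powr (1 - 2 * \<beta>) = R / real N"
  proof -
    have "R powr (1 - 2 * \<beta>) = real N powr (1 / (2 * \<beta>) - 1)"
      using \<beta> by (simp add: R_def powr_powr field_simps)
    then show ?thesis using N by (simp add: R_def powr_diff)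
  qed
  also have "2 * R + C * real N * (R / real N / (2 * \<beta> - 1)) = (2 + C / (2 * \<beta> - 1)) * R"
    using N by (simp add: distrib_right)
  finally show ?thesis unfolding R_def .
qed

text \<open>
  Up to the index \<open>N powr (1 / (2 \<beta>))\<close> every summand is at least \<open>min 1 c\<close>.
\<close>

lemma sum_min_powr_ge:
  fixes \<beta> c :: real
  assumes \<beta>: "\<beta> > 1 / 2" and c: "c > 0" and N: "N \<ge> (1::nat)"
  obtains n where "min 1 c / 2 * real N powr (1 / (2 * \<beta>))
     \<le> (\<Sum>j<n. min 1 (c * real N * real (Suc j) powr (- 2 * \<beta>)))"
proof -
  define R where "R = real N powr (1 / (2 * \<beta>))"
  have R1: "R \<ge> 1" unfolding R_def using N \<beta> by (intro ge_one_powr_ge_zero) auto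
  define m where "m = nat \<lfloor>R\<rfloor>"
  have m: "R / 2 \<le> real m" "real m \<le> R"
  proof -
    have "real m = of_int \<lfloor>R\<rfloor>" "\<lfloor>R\<rfloor> \<ge> 1" using R1 by (auto simp: m_def)
    then show "R / 2 \<le> real m" "real m \<le> R" by linarith+
  qed
  have "min 1 c \<le> min 1 (c * real N * real (Suc j) powr (- 2 * \<beta>))" if "j < m" for j
  proof -
    have "real (Suc j) \<le> R" using m that by linarith
    then have "real (Suc j) powr (- 2 * \<beta>) \<ge> R powr (- 2 * \<beta>)" using \<beta> by (intro powr_mono2') auto
    also have "R powr (- 2 * \<beta>) = inverse (real N)"
      using \<beta> N by (simp add: R_def powr_powr powr_minus)
    finally have "1 \<le> real N * real (Suc j) powr (- 2 * \<beta>)" using N by (simp add: field_simps)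
    then have "c * 1 \<le> c * (real N * real (Suc j) powr (- 2 * \<beta>))" using c by (intro mult_left_mono) auto
    then show ?thesis by (simp add: mult.assoc min_def)
  qed
  then have "(\<Sum>j<m. min 1 c) \<le> (\<Sum>j<m. min 1 (c * real N * real (Suc j) powr (- 2 * \<beta>)))"
    by (intro sum_mono) auto
  moreover have "min 1 c * (R / 2) \<le> (\<Sum>j<m. min 1 c)"
    using m c by (simp add: mult.commute mult_left_mono)
  ultimately show thesis by (intro that[of m]) (simp add: R_def)
qed

section \<open>Fourth moments of linear functionals\<close>

lemma (in prob_space) integrable_lower_power:
  fixes X :: "'a \<Rightarrow> real"
  assumes X: "X \<in> borel_measurable M" and int: "integrable M (\<lambda>x. X x ^ n)" and n: "even n" "i \<le> n"
  shows "integrable M (\<lambda>x. X x ^ i)"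
proof (rule Bochner_Integration.integrable_bound[where f = "\<lambda>x. 1 + X x ^ n"])
  have "\<bar>y\<bar> ^ i \<le> 1 + y ^ n" for y :: real
  proof (cases "\<bar>y\<bar> \<le> 1")
    case True
    then have "\<bar>y\<bar> ^ i \<le> 1" by (simp add: power_le_one)
    moreover have "0 \<le> y ^ n" using n by (simp add: zero_le_even_power)
    ultimately show ?thesis by linarith
  next
    case False
    then have "\<bar>y\<bar> ^ i \<le> \<bar>y\<bar> ^ n" using n by (intro power_increasing) auto
    then show ?thesis using n by (simp add: power_even_abs)
  qed
  moreover have "0 \<le> y ^ n" for y :: real using n by (simp add: zero_le_even_power)
  ultimately show "AE x in M. norm (X x ^ i) \<le> norm (1 + X x ^ n)"
    by (auto simp: power_abs[symmetric] abs_of_nonneg)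
qed (use X int in auto)

text \<open>
  In the binomial expansion of the fourth power the mixed terms of odd order vanish, because they
  contain a factor of mean zero.
\<close>

lemma (in prob_space) fourth_moment_add_indep:
  fixes Y Z :: "'a \<Rightarrow> real"
  assumes indep: "indep_var borel Y borel Z"
    and int: "integrable M (\<lambda>x. Y x ^ 4)" "integrable M (\<lambda>x. Z x ^ 4)"
    and mean: "expectation Y = 0" "expectation Z = 0"
  shows "integrable M (\<lambda>x. (Y x + Z x) ^ 4)"
    and "expectation (\<lambda>x. Y x + Z x) = 0"
    and "expectation (\<lambda>x. (Y x + Z x)\<^sup>2) = expectation (\<lambda>x. (Y x)\<^sup>2) + expectation (\<lambda>x. (Z x)\<^sup>2)"
    and "expectation (\<lambda>x. (Y x + Z x) ^ 4) = expectation (\<lambda>x. Y x ^ 4)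
      + 6 * expectation (\<lambda>x. (Y x)\<^sup>2) * expectation (\<lambda>x. (Z x)\<^sup>2) + expectation (\<lambda>x. Z x ^ 4)"
proof -
  have [measurable]: "Y \<in> borel_measurable M" "Z \<in> borel_measurable M"
    using indep by (auto dest: indep_var_rv1 indep_var_rv2)
  have powY: "integrable M (\<lambda>x. Y x ^ i)" if "i \<le> 4" for i
    using that by (intro integrable_lower_power[OF _ int(1)]) simp_all
  have powZ: "integrable M (\<lambda>x. Z x ^ i)" if "i \<le> 4" for i
    using that by (intro integrable_lower_power[OF _ int(2)]) simp_all
  have pow: "indep_var borel (\<lambda>x. Y x ^ i) borel (\<lambda>x. Z x ^ k)" for i k
    using indep_var_compose[OF indep, of "\<lambda>y. y ^ i" borel "\<lambda>y. y ^ k" borel] by (simp add: comp_def)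
  have YZ: "integrable M (\<lambda>x. Y x ^ i * Z x ^ k)"
    "expectation (\<lambda>x. Y x ^ i * Z x ^ k) = expectation (\<lambda>x. Y x ^ i) * expectation (\<lambda>x. Z x ^ k)"
    if "i \<le> 4" "k \<le> 4" for i k
    using indep_var_integrable[OF pow powY powZ] indep_var_lebesgue_integral[OF pow powY powZ] that by auto
  have eq4: "(Y x + Z x) ^ 4 = Y x ^ 4 + 4 * (Y x ^ 3 * Z x ^ 1) + 6 * (Y x ^ 2 * Z x ^ 2)
     + 4 * (Y x ^ 1 * Z x ^ 3) + Z x ^ 4" for x
    by (simp add: eval_nat_numeral algebra_simps)
  have eq2: "(Y x + Z x)\<^sup>2 = Y x ^ 2 + 2 * (Y x ^ 1 * Z x ^ 1) + Z x ^ 2" for x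
    by (simp add: eval_nat_numeral algebra_simps)
  note simps = powY powZ YZ mean
  show "integrable M (\<lambda>x. (Y x + Z x) ^ 4)"
    unfolding eq4 by (intro Bochner_Integration.integrable_add integrable_mult_right simps) auto
  show "expectation (\<lambda>x. Y x + Z x) = 0"
    using powY[of 1] powZ[of 1] by (simp add: mean)
  show "expectation (\<lambda>x. (Y x + Z x)\<^sup>2) = expectation (\<lambda>x. (Y x)\<^sup>2) + expectation (\<lambda>x. (Z x)\<^sup>2)"
    unfolding eq2 using powY[of 2] powZ[of 2] YZ[of 1 1] by (simp add: mean)
  show "expectation (\<lambda>x. (Y x + Z x) ^ 4) = expectation (\<lambda>x. Y x ^ 4)
      + 6 * expectation (\<lambda>x. (Y x)\<^sup>2) * expectation (\<lambda>x. (Z x)\<^sup>2) + expectation (\<lambda>x. Z x ^ 4)"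
    unfolding eq4 using int YZ[of 3 1] YZ[of 2 2] YZ[of 1 3] by (simp add: mean)
qed

text \<open>
  The bound is uniform in the number of summands: adding a summand of variance \<open>c\<^sup>2\<close> to a sum of
  variance \<open>s\<close> increases the fourth moment by at most \<open>6 c\<^sup>2 s + K c^4\<close>, while \<open>K s\<^sup>2\<close> grows by
  \<open>2 K c\<^sup>2 s + K c^4\<close>. This is why \<open>K\<close> has to be at least \<open>3\<close>, the value of a Gaussian variable.
\<close>

lemma (in prob_space) fourth_moment_indep_sum:
  fixes \<zeta> :: "nat \<Rightarrow> 'a \<Rightarrow> real" and c :: "nat \<Rightarrow> real"
  assumes indep: "indep_vars (\<lambda>_. borel) \<zeta> UNIV"
    and int: "\<And>k. integrable M (\<lambda>x. \<zeta> k x ^ 4)"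
    and mean: "\<And>k. expectation (\<zeta> k) = 0" and var: "\<And>k. expectation (\<lambda>x. (\<zeta> k x)\<^sup>2) = 1"
    and K: "\<And>k. expectation (\<lambda>x. \<zeta> k x ^ 4) \<le> K" "3 \<le> K"
  shows "integrable M (\<lambda>x. (\<Sum>k<n. c k * \<zeta> k x) ^ 4) \<and>
    expectation (\<lambda>x. \<Sum>k<n. c k * \<zeta> k x) = 0 \<and>
    expectation (\<lambda>x. (\<Sum>k<n. c k * \<zeta> k x)\<^sup>2) = (\<Sum>k<n. (c k)\<^sup>2) \<and>
    expectation (\<lambda>x. (\<Sum>k<n. c k * \<zeta> k x) ^ 4) \<le> K * (\<Sum>k<n. (c k)\<^sup>2)\<^sup>2"
proof (induction n)
  case 0
  then show ?case by simp
next
  case (Suc n)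
  let ?Z = "\<lambda>x. \<Sum>k<n. c k * \<zeta> k x" and ?Y = "\<lambda>x. c n * \<zeta> n x" and ?s = "\<Sum>k<n. (c k)\<^sup>2"
  have "indep_vars (\<lambda>_. borel) (\<lambda>k x. c k * \<zeta> k x) (insert n {..<n})"
    using indep_vars_compose2[OF indep_vars_subset[OF indep], of "insert n {..<n}" "\<lambda>k y. c k * y" "\<lambda>_. borel"]
    by simp
  then have YZ: "indep_var borel ?Y borel ?Z" by (intro indep_vars_sum) auto
  have intY: "integrable M (\<lambda>x. ?Y x ^ 4)" using int[of n] by (simp add: power_mult_distrib)
  have momY: "expectation ?Y = 0" "expectation (\<lambda>x. (?Y x)\<^sup>2) = (c n)\<^sup>2"
    "expectation (\<lambda>x. ?Y x ^ 4) = c n ^ 4 * expectation (\<lambda>x. \<zeta> n x ^ 4)"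
    by (simp_all add: power_mult_distrib mean var)
  have IH: "integrable M (\<lambda>x. ?Z x ^ 4)" "expectation ?Z = 0"
    "expectation (\<lambda>x. (?Z x)\<^sup>2) = ?s" "expectation (\<lambda>x. ?Z x ^ 4) \<le> K * ?s\<^sup>2"
    using Suc.IH by blast+
  note add = fourth_moment_add_indep[OF YZ intY IH(1) momY(1) IH(2)]
  have s: "0 \<le> ?s" by (intro sum_nonneg) auto
  have "c n ^ 4 * expectation (\<lambda>x. \<zeta> n x ^ 4) + 6 * (c n)\<^sup>2 * ?s + expectation (\<lambda>x. ?Z x ^ 4)
      \<le> c n ^ 4 * K + 2 * K * (c n)\<^sup>2 * ?s + K * ?s\<^sup>2"
    using K IH(4) s by (intro add_mono mult_left_mono mult_right_mono) auto
  also have "\<dots> = K * (?s + (c n)\<^sup>2)\<^sup>2" by (simp add: power2_eq_square eval_nat_numeral algebra_simps)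
  finally have 4: "c n ^ 4 * expectation (\<lambda>x. \<zeta> n x ^ 4) + 6 * (c n)\<^sup>2 * ?s + expectation (\<lambda>x. ?Z x ^ 4)
    \<le> K * (?s + (c n)\<^sup>2)\<^sup>2" .
  have *: "(\<Sum>k<Suc n. c k * \<zeta> k x) = ?Y x + ?Z x" for x by simp
  have "expectation (\<lambda>x. (?Y x + ?Z x)\<^sup>2) = (\<Sum>k<Suc n. (c k)\<^sup>2)"
    unfolding add(3) momY(2) IH(3) by simp
  moreover have "expectation (\<lambda>x. (?Y x + ?Z x) ^ 4) \<le> K * (\<Sum>k<Suc n. (c k)\<^sup>2)\<^sup>2"
    unfolding add(4) momY(2,3) IH(3) using 4 by simp
  ultimately show ?case unfolding * using add(1,2) by blast
qed

lemma Fatou_integral_bound: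
  fixes X :: "nat \<Rightarrow> 'a \<Rightarrow> real" 
  assumes [measurable]: "\<And>n. X n \<in> borel_measurable M" "Y \<in> borel_measurable M"
    and nn: "\<And>n x. 0 \<le> X n x" "\<And>x. 0 \<le> Y x"
    and lim: "AE x in M. (\<lambda>n. X n x) \<longlonglongrightarrow> Y x"
    and int: "\<And>n. integrable M (X n)" and le: "\<And>n. (\<integral>x. X n x \<partial>M) \<le> B"
  shows "integrable M Y" "(\<integral>x. Y x \<partial>M) \<le> B"
proof -
  have "0 \<le> (\<integral>x. X 0 x \<partial>M)" using nn by (intro integral_nonneg_AE) auto
  then have B: "0 \<le> B" using le[of 0] by linarith
  have "(\<integral>\<^sup>+x. ennreal (Y x) \<partial>M) = (\<integral>\<^sup>+x. liminf (\<lambda>n. ennreal (X n x)) \<partial>M)"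
    using lim by (intro nn_integral_cong_AE) (auto elim!: eventually_mono
      intro!: lim_imp_Liminf[symmetric] tendsto_ennrealI)
  also have "\<dots> \<le> liminf (\<lambda>n. \<integral>\<^sup>+x. ennreal (X n x) \<partial>M)"
    by (intro nn_integral_liminf) auto
  also have "\<dots> \<le> liminf (\<lambda>n. ennreal B)"
    using int le nn by (intro Liminf_mono) (auto simp: nn_integral_eq_integral ennreal_leI)
  finally have *: "(\<integral>\<^sup>+x. ennreal (Y x) \<partial>M) \<le> ennreal B" by (simp add: Liminf_const)
  then show Y: "integrable M Y"
    using nn by (intro integrableI_nonneg) (auto intro: le_less_trans)
  show "(\<integral>x. Y x \<partial>M) \<le> B"
    using * nn B by (subst (asm) nn_integral_eq_integral[OF Y]) (auto simp: ennreal_le_iff)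
qed

context
  fixes \<phi> :: "nat \<Rightarrow> 'a::{real_inner, banach, second_countable_topology}" and \<nu> :: "'a measure"
  assumes train: "training_distribution \<phi> \<nu>"
begin

lemma covariance_inner:
  "integrable \<nu> (\<lambda>x. (a \<bullet> x) * (b \<bullet> x))" "(\<integral>x. (a \<bullet> x) * (b \<bullet> x) \<partial>\<nu>) = a \<bullet> covariance \<nu> b"
proof -
  have [measurable_cong]: "sets \<nu> = sets borel" using train by (simp add: training_distribution_def)
  have "integrable \<nu> (\<lambda>x. (x \<bullet> b) *\<^sub>R x)"
  proof (rule Bochner_Integration.integrable_bound)
    show "integrable \<nu> (\<lambda>x. (norm x)\<^sup>2 * norm b)" using train by (simp add: training_distribution_def)
    show "AE x in \<nu>. norm ((x \<bullet> b) *\<^sub>R x) \<le> norm ((norm x)\<^sup>2 * norm b)"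
    proof (intro AE_I2)
      fix x
      have "\<bar>x \<bullet> b\<bar> * norm x \<le> (norm x * norm b) * norm x"
        by (intro mult_right_mono Cauchy_Schwarz_ineq2) auto
      then show "norm ((x \<bullet> b) *\<^sub>R x) \<le> norm ((norm x)\<^sup>2 * norm b)"
        by (simp add: power2_eq_square mult_ac)
    qed
  qed measurable
  then have "integrable \<nu> (\<lambda>x. a \<bullet> ((x \<bullet> b) *\<^sub>R x))"
    "(\<integral>x. a \<bullet> ((x \<bullet> b) *\<^sub>R x) \<partial>\<nu>) = a \<bullet> covariance \<nu> b"
    by (auto simp: covariance_def simp del: inner_scaleR_right)
  then show "integrable \<nu> (\<lambda>x. (a \<bullet> x) * (b \<bullet> x))" "(\<integral>x. (a \<bullet> x) * (b \<bullet> x) \<partial>\<nu>) = a \<bullet> covariance \<nu> b"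
    by (simp_all add: inner_commute mult.commute)
qed

text \<open>
  A Bessel inequality: the variance of \<open>h \<bullet> x\<close> is at least that of its part in finitely many
  eigendirections, since the remainder is uncorrelated with that part and has nonnegative variance.
\<close>

lemma variance_eigen_coordinates_le:
  fixes e :: "nat \<Rightarrow> 'a" and lam :: "nat \<Rightarrow> real"
  assumes on: "\<And>i j. e i \<bullet> e j = (if i = j then 1 else 0)"
    and eig: "\<And>k. covariance \<nu> (e k) = (lam k)\<^sup>2 *\<^sub>R e k"
  shows "(\<Sum>k<n. (lam k * (h \<bullet> e k))\<^sup>2) \<le> h \<bullet> covariance \<nu> h"
proof -
  let ?b = "\<lambda>k. h \<bullet> e k"
  have eq: "(h \<bullet> x - (\<Sum>k<n. ?b k * (e k \<bullet> x)))\<^sup>2 = (h \<bullet> x) * (h \<bullet> x)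
     - 2 * (\<Sum>k<n. ?b k * ((h \<bullet> x) * (e k \<bullet> x)))
     + (\<Sum>k<n. \<Sum>l<n. ?b k * ?b l * ((e k \<bullet> x) * (e l \<bullet> x)))" for x
    by (simp add: power2_eq_square algebra_simps sum_distrib_left sum_distrib_right)
  have "0 \<le> (\<integral>x. (h \<bullet> x - (\<Sum>k<n. ?b k * (e k \<bullet> x)))\<^sup>2 \<partial>\<nu>)" by simp
  also have "\<dots> = h \<bullet> covariance \<nu> h - 2 * (\<Sum>k<n. ?b k * (h \<bullet> covariance \<nu> (e k)))
     + (\<Sum>k<n. \<Sum>l<n. ?b k * ?b l * (e k \<bullet> covariance \<nu> (e l)))"
    unfolding eq by (simp add: covariance_inner Bochner_Integration.integral_sum)
  also have "\<dots> = h \<bullet> covariance \<nu> h - (\<Sum>k<n. (lam k * ?b k)\<^sup>2)"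
    by (simp add: eig on power2_eq_square mult_ac if_distrib[of "\<lambda>z. _ * z"] sum.delta cong: if_cong)
  finally show ?thesis by simp
qed

text \<open>
  The partial sums of the expansion are sums of independent variables, so their fourth moments are
  controlled by \<open>fourth_moment_indep_sum\<close>; Fatou's lemma transfers the bound to the limit. The constant
  does not depend on the direction \<open>h\<close>, so it serves all coordinates \<open>\<phi> j\<close> simultaneously, although
  these need not be eigendirections.
\<close>

lemma karhunen_loeve_fourth_moment:
  assumes "karhunen_loeve_moments \<nu>"
  obtains K where "0 < K" "\<And>h. integrable \<nu> (\<lambda>x. (h \<bullet> x) ^ 4)"
    "\<And>h. (\<integral>x. (h \<bullet> x) ^ 4 \<partial>\<nu>) \<le> K * (h \<bullet> covariance \<nu> h)\<^sup>2"
proof -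
  interpret prob_space \<nu> using train by (simp add: training_distribution_def)
  have [measurable_cong]: "sets \<nu> = sets borel" using train by (simp add: training_distribution_def)
  obtain e :: "nat \<Rightarrow> 'a" and lam \<zeta> where e: "orthonormal_basis e"
    and eig: "\<And>k. covariance \<nu> (e k) = (lam k)\<^sup>2 *\<^sub>R e k"
    and KL: "AE x in \<nu>. (\<lambda>k. (lam k * \<zeta> k x) *\<^sub>R e k) sums x"
    and \<zeta>: "indep_vars (\<lambda>_. borel) \<zeta> UNIV" "\<And>k. integrable \<nu> (\<lambda>x. \<zeta> k x ^ 4)"
      "\<And>k. (\<integral>x. \<zeta> k x \<partial>\<nu>) = 0" "\<And>k. (\<integral>x. (\<zeta> k x)\<^sup>2 \<partial>\<nu>) = 1"
    and O: "(\<lambda>k. \<integral>x. \<zeta> k x ^ 4 \<partial>\<nu>) \<in> O(\<lambda>_. 1)"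
    using assms unfolding karhunen_loeve_moments_def by blast
  have [measurable]: "\<zeta> k \<in> borel_measurable \<nu>" for k using \<zeta>(1) by (auto simp: indep_vars_def)
  have on: "e i \<bullet> e j = (if i = j then 1 else 0)" for i j
    using e by (simp add: orthonormal_basis_def)
  obtain c where c: "c > 0" "eventually (\<lambda>k. norm (\<integral>x. \<zeta> k x ^ 4 \<partial>\<nu>) \<le> c * norm (1::real)) sequentially"
    using landau_o.bigE[OF O] by metis
  then obtain n where n: "\<And>k. k \<ge> n \<Longrightarrow> (\<integral>x. \<zeta> k x ^ 4 \<partial>\<nu>) \<le> c"
    unfolding eventually_sequentially by fastforce
  \<comment> \<open>The sum covers the finitely many \<open>k\<close> before the asymptotic bound \<open>c\<close> sets in.\<close>
  define K where "K = 3 + c + (\<Sum>k<n. \<integral>x. \<zeta> k x ^ 4 \<partial>\<nu>)"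
  have nn: "0 \<le> (\<integral>x. \<zeta> k x ^ 4 \<partial>\<nu>)" for k by (simp add: zero_le_even_power)
  have s: "0 \<le> (\<Sum>k<n. \<integral>x. \<zeta> k x ^ 4 \<partial>\<nu>)" by (intro sum_nonneg nn)
  have K: "(\<integral>x. \<zeta> k x ^ 4 \<partial>\<nu>) \<le> K" for k
  proof (cases "k < n")
    case True
    then have "(\<integral>x. \<zeta> k x ^ 4 \<partial>\<nu>) \<le> (\<Sum>k<n. \<integral>x. \<zeta> k x ^ 4 \<partial>\<nu>)"
      by (intro member_le_sum nn) auto
    then show ?thesis using c by (simp add: K_def)
  qed (use n[of k] s in \<open>simp add: K_def\<close>)
  have K3: "3 \<le> K" using c s by (simp add: K_def)
  have main: "integrable \<nu> (\<lambda>x. (h \<bullet> x) ^ 4)" 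
    "(\<integral>x. (h \<bullet> x) ^ 4 \<partial>\<nu>) \<le> K * (h \<bullet> covariance \<nu> h)\<^sup>2" for h
  proof -
    let ?Z = "\<lambda>n x. \<Sum>k<n. (lam k * (h \<bullet> e k)) * \<zeta> k x"
    have mom: "integrable \<nu> (\<lambda>x. ?Z n x ^ 4)"
      "(\<integral>x. ?Z n x ^ 4 \<partial>\<nu>) \<le> K * (h \<bullet> covariance \<nu> h)\<^sup>2" for n
    proof -
      note * = fourth_moment_indep_sum[OF \<zeta> K K3, where n = n and c = "\<lambda>k. lam k * (h \<bullet> e k)"]
      from * show "integrable \<nu> (\<lambda>x. ?Z n x ^ 4)" by blast
      have "(\<integral>x. ?Z n x ^ 4 \<partial>\<nu>) \<le> K * (\<Sum>k<n. (lam k * (h \<bullet> e k))\<^sup>2)\<^sup>2" using * by blast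
      also have "\<dots> \<le> K * (h \<bullet> covariance \<nu> h)\<^sup>2"
        using K3 by (intro mult_left_mono power_mono variance_eigen_coordinates_le on eig sum_nonneg) auto
      finally show "(\<integral>x. ?Z n x ^ 4 \<partial>\<nu>) \<le> K * (h \<bullet> covariance \<nu> h)\<^sup>2" .
    qed
    have lim: "AE x in \<nu>. (\<lambda>n. ?Z n x ^ 4) \<longlonglongrightarrow> (h \<bullet> x) ^ 4"
      using KL
    proof eventually_elim
      case (elim x)
      have "(\<lambda>k. h \<bullet> ((lam k * \<zeta> k x) *\<^sub>R e k)) sums (h \<bullet> x)"
        by (rule bounded_linear.sums[OF bounded_linear_inner_right elim])
      moreover have "h \<bullet> ((lam k * \<zeta> k x) *\<^sub>R e k) = (lam k * (h \<bullet> e k)) * \<zeta> k x" for k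
        by simp
      ultimately have "(\<lambda>n. ?Z n x) \<longlonglongrightarrow> h \<bullet> x" by (simp only: sums_def)
      then show ?case by (intro tendsto_power)
    qed
    have meas: "(\<lambda>x. ?Z n x ^ 4) \<in> borel_measurable \<nu>" "(\<lambda>x. (h \<bullet> x) ^ 4) \<in> borel_measurable \<nu>" for n
      by measurable
    have nn: "0 \<le> ?Z n x ^ 4" "0 \<le> (h \<bullet> x) ^ 4" for n x by (rule zero_le_even_power; simp)+
    show "integrable \<nu> (\<lambda>x. (h \<bullet> x) ^ 4)" "(\<integral>x. (h \<bullet> x) ^ 4 \<partial>\<nu>) \<le> K * (h \<bullet> covariance \<nu> h)\<^sup>2"
      using Fatou_integral_bound[of "\<lambda>n x. ?Z n x ^ 4" \<nu> "\<lambda>x. (h \<bullet> x) ^ 4", OF meas nn lim mom] by blast+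
  qed
  show thesis using K3 main by (intro that[of K]) auto
qed

end

section \<open>Integration of absolutely convergent series\<close>

lemma AE_summable_of_summable_integrals:
  fixes f h :: "nat \<Rightarrow> 'a \<Rightarrow> real"
  assumes int: "\<And>j. integrable M (h j)" and sum: "summable (\<lambda>j. \<integral>x. h j x \<partial>M)"
    and le: "\<And>j x. x \<in> space M \<Longrightarrow> \<bar>f j x\<bar> \<le> h j x"
  shows "AE x in M. summable (\<lambda>j. \<bar>f j x\<bar>)"
proof -
  have nn: "0 \<le> h j x" if "x \<in> space M" for j x using le[of x j] that by linarith
  have [measurable]: "h j \<in> borel_measurable M" for j using int by auto
  have nnint: "0 \<le> (\<integral>x. h j x \<partial>M)" for j using nn by (intro integral_nonneg_AE) auto
  have "(\<integral>\<^sup>+x. (\<Sum>j. ennreal (h j x)) \<partial>M) = (\<Sum>j. \<integral>\<^sup>+x. ennreal (h j x) \<partial>M)"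
    by (intro nn_integral_suminf) measurable
  also have "\<dots> = (\<Sum>j. ennreal (\<integral>x. h j x \<partial>M))"
    using int nn by (intro suminf_cong nn_integral_eq_integral) auto
  also have "\<dots> = ennreal (\<Sum>j. \<integral>x. h j x \<partial>M)"
    using sum nnint by (intro suminf_ennreal2) auto
  finally have "(\<integral>\<^sup>+x. (\<Sum>j. ennreal (h j x)) \<partial>M) \<noteq> \<infinity>" by simp
  then have "AE x in M. (\<Sum>j. ennreal (h j x)) \<noteq> \<infinity>"
    by (intro nn_integral_PInf_AE) measurable
  moreover have "AE x in M. x \<in> space M" by simp
  ultimately show ?thesis
  proof eventually_elim
    case (elim x)
    have "summable (\<lambda>j. h j x)" using elim nn by (intro summable_suminf_not_top) auto
    then show ?case using elim le by (intro summable_comparison_test'[of _ 0 "\<lambda>j. \<bar>f j x\<bar>"]) auto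
  qed
qed

lemma integral_suminf_of_summable_abs:
  fixes f :: "nat \<Rightarrow> 'a \<Rightarrow> real"
  assumes f: "\<And>j. integrable M (f j)" and sum: "summable (\<lambda>j. \<integral>x. \<bar>f j x\<bar> \<partial>M)"
  shows "integrable M (\<lambda>x. \<Sum>j. f j x)" "(\<integral>x. (\<Sum>j. f j x) \<partial>M) = (\<Sum>j. \<integral>x. f j x \<partial>M)"
    "summable (\<lambda>j. \<integral>x. f j x \<partial>M)"
proof -
  have ae: "AE x in M. summable (\<lambda>j. norm (f j x))"
    using AE_summable_of_summable_integrals[of M "\<lambda>j x. \<bar>f j x\<bar>" f] f sum by auto
  show "integrable M (\<lambda>x. \<Sum>j. f j x)" "(\<integral>x. (\<Sum>j. f j x) \<partial>M) = (\<Sum>j. \<integral>x. f j x \<partial>M)"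
    using integrable_suminf[OF f ae] integral_suminf[OF f ae] sum by auto
  show "summable (\<lambda>j. \<integral>x. f j x \<partial>M)"
    by (rule summable_comparison_test'[OF sum, of 0]) (auto intro: integral_abs_bound)
qed

lemma (in prob_space) expectation_abs_le_sqrt:
  fixes X :: "'a \<Rightarrow> real"
  assumes [measurable]: "X \<in> borel_measurable M" and int: "integrable M (\<lambda>x. (X x)\<^sup>2)"
  shows "integrable M X" "expectation (\<lambda>x. \<bar>X x\<bar>) \<le> sqrt (expectation (\<lambda>x. (X x)\<^sup>2))"
proof -
  show X: "integrable M X" by (rule square_integrable_imp_integrable) (use int in auto)
  have "0 \<le> variance (\<lambda>x. \<bar>X x\<bar>)" by (rule variance_positive)
  also have "\<dots> = expectation (\<lambda>x. (X x)\<^sup>2) - (expectation (\<lambda>x. \<bar>X x\<bar>))\<^sup>2"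
    using X int by (subst variance_eq) auto
  finally show "expectation (\<lambda>x. \<bar>X x\<bar>) \<le> sqrt (expectation (\<lambda>x. (X x)\<^sup>2))"
    by (intro real_le_rsqrt) simp
qed

lemma integrable_mult_of_squares:
  fixes f h :: "'a \<Rightarrow> real"
  assumes [measurable]: "f \<in> borel_measurable M" "h \<in> borel_measurable M"
    and "integrable M (\<lambda>x. (f x)\<^sup>2)" "integrable M (\<lambda>x. (h x)\<^sup>2)"
  shows "integrable M (\<lambda>x. f x * h x)"
proof (rule Bochner_Integration.integrable_bound)
  show "integrable M (\<lambda>x. 1 / 2 * ((f x)\<^sup>2 + (h x)\<^sup>2))" using assms by auto
  show "AE x in M. norm (f x * h x) \<le> norm (1 / 2 * ((f x)\<^sup>2 + (h x)\<^sup>2))"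
  proof (rule AE_I2)
    fix x
    have "0 \<le> 1 / 2 * ((f x)\<^sup>2 + (h x)\<^sup>2)" by simp
    then show "norm (f x * h x) \<le> norm (1 / 2 * ((f x)\<^sup>2 + (h x)\<^sup>2))"
      using abs_mult_le_squares[of "f x" "h x"] unfolding real_norm_def by linarith
  qed
qed measurable

text \<open>
  A single coordinate: \<open>S\<close> is an empirical second moment with mean \<open>t\<close> and relative variance at most
  \<open>D\<close>, which is \<open>K / N\<close> for a sample of size \<open>N\<close>. The posterior mean shrinks the least squares estimate
  by the factor \<open>v / (1 + v)\<close> with \<open>v = a S\<close>.
\<close>

locale concentrated_second_moment = prob_space M for M :: "'x measure" +
  fixes S :: "'x \<Rightarrow> real" and t D a :: real
  assumes S_meas[measurable]: "S \<in> borel_measurable M" and S_nonneg: "\<And>x. 0 \<le> S x"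
    and t_pos: "0 < t" and S_int: "integrable M S" and S_mean: "expectation S = t"
    and S_var_int: "integrable M (\<lambda>x. (S x - t)\<^sup>2)"
    and S_var: "expectation (\<lambda>x. (S x - t)\<^sup>2) \<le> D * t\<^sup>2"
    and a_pos: "0 < a"
begin

abbreviation v where "v x \<equiv> a * S x"

lemma v_nonneg: "0 \<le> v x" using S_nonneg[of x] a_pos by simp

lemma expectation_deviation: "expectation (\<lambda>x. \<bar>S x - t\<bar>) \<le> t * sqrt D"
proof -
  have "expectation (\<lambda>x. \<bar>S x - t\<bar>) \<le> sqrt (expectation (\<lambda>x. (S x - t)\<^sup>2))"
    by (rule expectation_abs_le_sqrt(2)) (use S_var_int in auto)
  also have "\<dots> \<le> sqrt (D * t\<^sup>2)" using S_var by simp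
  finally show ?thesis using t_pos by (simp add: real_sqrt_mult mult.commute)
qed

text \<open>
  Chebyshev's inequality controls the event on which shrinkage may be far below its typical value.
\<close>

lemma prob_small: "prob {x \<in> space M. S x < t / 2} \<le> 4 * D"
proof -
  have "expectation (indicator {x \<in> space M. S x < t / 2}) \<le> expectation (\<lambda>x. (4 / t\<^sup>2) * (S x - t)\<^sup>2)"
  proof (intro integral_mono)
    fix x
    show "indicator {x \<in> space M. S x < t / 2} x \<le> (4 / t\<^sup>2) * (S x - t)\<^sup>2"
    proof (cases "S x < t / 2")
      case True
      then have "(t / 2)\<^sup>2 \<le> (t - S x)\<^sup>2" using t_pos by (intro power_mono) auto
      then have "1 \<le> (4 / t\<^sup>2) * (S x - t)\<^sup>2"
        using t_pos by (simp add: field_simps power2_commute power_divide)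
      then show ?thesis by (auto split: split_indicator)
    qed (auto split: split_indicator)
  qed (use S_var_int in \<open>auto simp: less_top[symmetric]\<close>)
  also have "\<dots> \<le> (4 / t\<^sup>2) * (D * t\<^sup>2)" unfolding integral_mult_right_zero
    using S_var by (intro mult_left_mono) auto
  finally show ?thesis using t_pos by simp
qed

lemma shrinkage_bounds: "0 \<le> v x / (1 + v x)" "v x / (1 + v x) \<le> 1"
  using v_nonneg[of x] by (auto simp: divide_le_eq)

lemma shrinkage_integrable: "integrable M (\<lambda>x. v x / (1 + v x))"
proof (rule integrable_const_bound[where B = 1])
  have "norm (v x / (1 + v x)) \<le> 1" for x
    unfolding real_norm_def abs_of_nonneg[OF shrinkage_bounds(1)] by (rule shrinkage_bounds)
  then show "AE x in M. norm (v x / (1 + v x)) \<le> 1" by simp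
qed measurable

lemma shrinkage_le: "expectation (\<lambda>x. v x / (1 + v x)) \<le> min 1 (a * t)"
proof -
  have "expectation (\<lambda>x. v x / (1 + v x)) \<le> expectation (\<lambda>x. 1)"
    by (intro integral_mono shrinkage_integrable) (use shrinkage_bounds in auto)
  moreover have "expectation (\<lambda>x. v x / (1 + v x)) \<le> expectation v"
  proof (intro integral_mono shrinkage_integrable)
    fix x show "v x / (1 + v x) \<le> v x"
      using divide_left_mono[of 1 "1 + v x" "v x"] v_nonneg[of x] by simp
  qed (use S_int in auto)
  ultimately show ?thesis by (simp add: S_mean prob_space)
qed

lemma shrinkage_ge:
  assumes "8 * D \<le> 1"
  shows "min 1 (a * t) / 6 \<le> expectation (\<lambda>x. v x / (1 + v x))"
proof -
  define \<theta> where "\<theta> = a * t"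
  have \<theta>: "0 < \<theta>" using a_pos t_pos by (simp add: \<theta>_def)
  let ?A = "{x \<in> space M. S x < t / 2}"
  have "min 1 \<theta> / 3 * (1 / 2) \<le> min 1 \<theta> / 3 * (1 - prob ?A)"
    using \<theta> prob_small assms by (intro mult_left_mono) auto
  also have "\<dots> = min 1 \<theta> / 3 * prob {x \<in> space M. \<not> S x < t / 2}"
    by (subst prob_neg) auto
  also have "\<dots> = expectation (\<lambda>x. min 1 \<theta> / 3 * indicator {x \<in> space M. \<not> S x < t / 2} x)"
    by simp
  also have "\<dots> \<le> expectation (\<lambda>x. v x / (1 + v x))"
  proof (intro integral_mono shrinkage_integrable)
    fix x
    show "min 1 \<theta> / 3 * indicator {x \<in> space M. \<not> S x < t / 2} x \<le> v x / (1 + v x)"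
    proof (cases "S x < t / 2")
      case True
      then show ?thesis using v_nonneg[of x] by (auto split: split_indicator)
    next
      case False
      then have v: "\<theta> / 2 \<le> v x" using a_pos by (simp add: \<theta>_def)
      have "min 1 \<theta> / 3 \<le> (\<theta> / 2) / (1 + \<theta> / 2)" using \<theta> by (simp add: min_def field_simps)
      also have "\<dots> \<le> v x / (1 + v x)" using v \<theta> by (simp add: field_simps)
      finally show ?thesis using v_nonneg[of x] by (auto split: split_indicator)
    qed
  qed (auto simp: less_top[symmetric])
  finally show ?thesis by (simp add: \<theta>_def)
qed

text \<open>
  Up to the factor \<open>\<gamma>\<^sup>2 / N\<close>, the integrand is the conditional mean, given the design, of \<open>|t - S|\<close>
  times the squared noise in the posterior mean. If \<open>S \<ge> t / 2\<close>, it is at most three times the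
  shrinkage factor. Otherwise it exceeds the shrinkage factor by at most \<open>a t\<close>, and this happens with probability at most \<open>4 D\<close>.
\<close>

lemma residual_integrable: "integrable M (\<lambda>x. \<bar>a * t - v x\<bar> * v x / (1 + v x)\<^sup>2)"
  and residual_le: "expectation (\<lambda>x. \<bar>a * t - v x\<bar> * v x / (1 + v x)\<^sup>2) \<le> 3 * min 1 (a * t) + 4 * D * (a * t)"
proof -
  define \<theta> where "\<theta> = a * t"
  have \<theta>: "0 < \<theta>" using a_pos t_pos by (simp add: \<theta>_def)
  let ?A = "{x \<in> space M. S x < t / 2}"
  have le: "\<bar>\<theta> - v x\<bar> * v x / (1 + v x)\<^sup>2 \<le> 3 * (v x / (1 + v x)) + \<theta> * indicator ?A x" if "x \<in> space M" for x
  proof -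
    have v: "0 \<le> v x" by (rule v_nonneg)
    have q: "v x / (1 + v x) \<le> 1" "0 \<le> v x / (1 + v x)" using v by (auto simp: divide_le_eq)
    have "\<bar>\<theta> - v x\<bar> * v x / (1 + v x)\<^sup>2 \<le> (\<theta> + v x) * v x / (1 + v x)\<^sup>2"
      using v \<theta> by (intro divide_right_mono mult_right_mono) auto
    also have "\<dots> = \<theta> / (1 + v x) * (v x / (1 + v x)) + v x / (1 + v x) * (v x / (1 + v x))"
      by (simp add: power2_eq_square add_divide_distrib distrib_right)
    also have "v x / (1 + v x) * (v x / (1 + v x)) \<le> 1 * (v x / (1 + v x))"
      using q by (intro mult_right_mono) auto
    also have "\<theta> / (1 + v x) * (v x / (1 + v x)) \<le> 2 * (v x / (1 + v x)) + \<theta> * indicator ?A x"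
    proof (cases "S x < t / 2")
      case True
      have "\<theta> / (1 + v x) * (v x / (1 + v x)) \<le> \<theta> * 1"
        using v \<theta> q by (intro mult_mono) (auto simp: divide_le_eq algebra_simps)
      then show ?thesis using True that q by simp
    next
      case False
      then have "\<theta> \<le> 2 * v x" using a_pos by (simp add: \<theta>_def)
      then have "\<theta> / (1 + v x) \<le> 2" using v by (simp add: divide_le_eq)
      then have "\<theta> / (1 + v x) * (v x / (1 + v x)) \<le> 2 * (v x / (1 + v x))"
        using q by (intro mult_right_mono) auto
      then show ?thesis using False by simp
    qed
    finally show ?thesis by simp
  qed
  have int: "integrable M (\<lambda>x. 3 * (v x / (1 + v x)) + \<theta> * indicator ?A x)"
    by (intro Bochner_Integration.integrable_add integrable_mult_right shrinkage_integrable)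
      (auto simp: less_top[symmetric])
  have "integrable M (\<lambda>x. \<bar>\<theta> - v x\<bar> * v x / (1 + v x)\<^sup>2)"
  proof (rule Bochner_Integration.integrable_bound[OF int])
    show "AE x in M. norm (\<bar>\<theta> - v x\<bar> * v x / (1 + v x)\<^sup>2) \<le> norm (3 * (v x / (1 + v x)) + \<theta> * indicator ?A x)"
    proof (intro AE_I2)
      fix x assume "x \<in> space M"
      moreover have "0 \<le> \<bar>\<theta> - v x\<bar> * v x / (1 + v x)\<^sup>2" using v_nonneg by simp
      ultimately show "norm (\<bar>\<theta> - v x\<bar> * v x / (1 + v x)\<^sup>2) \<le> norm (3 * (v x / (1 + v x)) + \<theta> * indicator ?A x)"
        using le[of x] unfolding real_norm_def by linarith
    qed
  qed measurable
  then show "integrable M (\<lambda>x. \<bar>a * t - v x\<bar> * v x / (1 + v x)\<^sup>2)" by (simp add: \<theta>_def)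
  have "expectation (\<lambda>x. \<bar>\<theta> - v x\<bar> * v x / (1 + v x)\<^sup>2)
     \<le> expectation (\<lambda>x. 3 * (v x / (1 + v x)) + \<theta> * indicator ?A x)"
    by (rule integral_mono) (use le int \<open>integrable M (\<lambda>x. \<bar>\<theta> - v x\<bar> * v x / (1 + v x)\<^sup>2)\<close> in auto)
  also have "\<dots> = 3 * expectation (\<lambda>x. v x / (1 + v x)) + \<theta> * prob ?A"
    by (subst Bochner_Integration.integral_add[OF integrable_mult_right[OF shrinkage_integrable]],
        auto simp: less_top[symmetric] simp del: times_divide_eq_right
          intro!: integral_mult_right_zero)
  also have "\<dots> \<le> 3 * min 1 \<theta> + \<theta> * (4 * D)"
    using shrinkage_le prob_small \<theta> by (intro add_mono mult_left_mono) (auto simp: \<theta>_def)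
  finally show "expectation (\<lambda>x. \<bar>a * t - v x\<bar> * v x / (1 + v x)\<^sup>2) \<le> 3 * min 1 (a * t) + 4 * D * (a * t)"
    by (simp add: \<theta>_def mult_ac)
qed

text \<open>
  Chebyshev's association inequality for the two decreasing functions \<open>t - S\<close> and \<open>1 / (1 + a S)\<^sup>2\<close> of
  \<open>S\<close>: replacing the second by its value at \<open>S = t\<close> can only decrease the integrand, and then \<open>t - S\<close>
  integrates to zero.
\<close>

lemma bias_covariance:
  shows "integrable M (\<lambda>x. (t - S x) / (1 + v x)\<^sup>2)"
    and "0 \<le> expectation (\<lambda>x. (t - S x) / (1 + v x)\<^sup>2)"
proof -
  have one: "1 \<le> 1 + v x" for x using v_nonneg by simp
  show int: "integrable M (\<lambda>x. (t - S x) / (1 + v x)\<^sup>2)"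
  proof (rule Bochner_Integration.integrable_bound)
    show "integrable M (\<lambda>x. t - S x)" using S_int by auto
    have "\<bar>t - S x\<bar> / (1 + v x)\<^sup>2 \<le> \<bar>t - S x\<bar> / 1" for x
      using one[of x] one_le_power[OF one[of x], of 2] by (intro divide_left_mono) auto
    then show "AE x in M. norm ((t - S x) / (1 + v x)\<^sup>2) \<le> norm (t - S x)" by (simp add: abs_div)
  qed measurable
  have "0 = expectation (\<lambda>x. (t - S x) / (1 + a * t)\<^sup>2)"
    using S_int by (simp add: S_mean prob_space)
  also have "\<dots> \<le> expectation (\<lambda>x. (t - S x) / (1 + v x)\<^sup>2)"
  proof (intro integral_mono int)
    fix x
    have at: "0 < 1 + a * t" using a_pos t_pos by (simp add: add_pos_pos)
    show "(t - S x) / (1 + a * t)\<^sup>2 \<le> (t - S x) / (1 + v x)\<^sup>2"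
    proof (cases "S x \<le> t")
      case True
      then have "(1 + v x)\<^sup>2 \<le> (1 + a * t)\<^sup>2" using one[of x] a_pos by (intro power_mono) auto
      then show ?thesis using True one[of x] at by (intro divide_left_mono) auto
    next
      case False
      then have "(1 + a * t)\<^sup>2 \<le> (1 + v x)\<^sup>2" using at a_pos by (intro power_mono) auto
      then show ?thesis using False one[of x] at by (intro divide_left_mono_neg) auto
    qed
  qed (use S_int in auto)
  finally show "0 \<le> expectation (\<lambda>x. (t - S x) / (1 + v x)\<^sup>2)" .
qed

end

section \<open>Regression of a sequence in white noise\<close>

lemma (in pair_sigma_finite)
  fixes f :: "'a \<Rightarrow> real" and h :: "'b \<Rightarrow> real"
  assumes f: "integrable M1 f" and h: "integrable M2 h"
  shows integrable_product: "integrable (M1 \<Otimes>\<^sub>M M2) (\<lambda>z. f (fst z) * h (snd z))"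
    and integral_product: "(\<integral>z. f (fst z) * h (snd z) \<partial>(M1 \<Otimes>\<^sub>M M2)) = (\<integral>x. f x \<partial>M1) * (\<integral>y. h y \<partial>M2)"
proof -
  have [measurable]: "f \<in> borel_measurable M1" "h \<in> borel_measurable M2" using f h by auto
  show int: "integrable (M1 \<Otimes>\<^sub>M M2) (\<lambda>z. f (fst z) * h (snd z))"
    using f h by (intro Fubini_integrable) (auto simp: abs_mult)
  show "(\<integral>z. f (fst z) * h (snd z) \<partial>(M1 \<Otimes>\<^sub>M M2)) = (\<integral>x. f x \<partial>M1) * (\<integral>y. h y \<partial>M2)"
    using integral_fst'[OF int] by simp
qed

text \<open>
  The sample and the noise, reduced to what the estimates depend on. The design values \<open>g j n\<close> live on
  \<open>MX\<close>, with arbitrary dependence between different coordinates \<open>j\<close>. The noise variables \<open>\<xi> j n\<close> live on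
  an independent space \<open>MQ\<close> and are orthonormal and centered.
\<close>

locale sequence_regression = pair_prob_space MX MQ for MX :: "'x measure" and MQ :: "'q measure" +
  fixes g :: "nat \<Rightarrow> nat \<Rightarrow> 'x \<Rightarrow> real" and \<xi> :: "nat \<Rightarrow> nat \<Rightarrow> 'q \<Rightarrow> real"
    and N :: nat and K \<gamma> :: real and t a l :: "nat \<Rightarrow> real"
  assumes N_pos: "0 < N" and K_nonneg: "0 \<le> K" and \<gamma>_pos: "0 < \<gamma>" 
    and t_pos: "\<And>j. 0 < t j" and a_pos: "\<And>j. 0 < a j"
    and g_meas: "\<And>j n. n < N \<Longrightarrow> g j n \<in> borel_measurable MX"
    and g_sq_int: "\<And>j n. n < N \<Longrightarrow> integrable MX (\<lambda>x. (g j n x)\<^sup>2)"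
    and g_sq: "\<And>j n. n < N \<Longrightarrow> (\<integral>x. (g j n x)\<^sup>2 \<partial>MX) = t j"
    and S_var_int: "\<And>j. integrable MX (\<lambda>x. (1 / real N * (\<Sum>n<N. (g j n x)\<^sup>2) - t j)\<^sup>2)"
    and S_var: "\<And>j. (\<integral>x. (1 / real N * (\<Sum>n<N. (g j n x)\<^sup>2) - t j)\<^sup>2 \<partial>MX) \<le> K / real N * (t j)\<^sup>2"
    and \<xi>_meas: "\<And>j n. n < N \<Longrightarrow> \<xi> j n \<in> borel_measurable MQ"
    and \<xi>_sq_int: "\<And>j n. n < N \<Longrightarrow> integrable MQ (\<lambda>y. (\<xi> j n y)\<^sup>2)"
    and \<xi>_mean: "\<And>j n. n < N \<Longrightarrow> (\<integral>y. \<xi> j n y \<partial>MQ) = 0"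
    and \<xi>_cov: "\<And>i j n m. n < N \<Longrightarrow> m < N \<Longrightarrow>
      (\<integral>y. \<xi> i n y * \<xi> j m y \<partial>MQ) = (if i = j \<and> n = m then 1 else 0)"
    and sum_at: "summable (\<lambda>j. a j * t j)" and sum_lt: "summable (\<lambda>j. (l j)\<^sup>2 * t j)"
begin

abbreviation P where "P \<equiv> MX \<Otimes>\<^sub>M MQ"

definition S where "S j x = 1 / real N * (\<Sum>n<N. (g j n x)\<^sup>2)"

definition W where "W j z = 1 / real N * (\<Sum>n<N. g j n (fst z) * \<xi> j n (snd z))"

definition L where "L j z = a j * (S j (fst z) * l j + \<gamma> * W j z) / (1 + a j * S j (fst z))"

definition gap_term where
  "gap_term j z = 1 / 2 * (t j - S j (fst z)) * (L j z)\<^sup>2 - (t j - S j (fst z)) * (l j * L j z) + \<gamma> * (L j z * W j z)"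

lemma S_meas[measurable]: "S j \<in> borel_measurable MX"
  unfolding S_def[abs_def] using g_meas by measurable

lemma W_meas[measurable]: "W j \<in> borel_measurable P"
proof -
  have [measurable]: "(\<lambda>z. g j n (fst z)) \<in> borel_measurable P" "(\<lambda>z. \<xi> j n (snd z)) \<in> borel_measurable P" if "n < N" for n
    using measurable_compose[OF measurable_fst g_meas[OF that]] measurable_compose[OF measurable_snd \<xi>_meas[OF that]]
    by auto
  show ?thesis unfolding W_def[abs_def] by measurable
qed

lemma L_meas[measurable]: "L j \<in> borel_measurable P"
  unfolding L_def[abs_def] by measurable

lemma S_nonneg: "0 \<le> S j x" by (simp add: S_def sum_nonneg)

lemma S_integrable: "integrable MX (S j)" and S_mean: "(\<integral>x. S j x \<partial>MX) = t j"
proof -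
  show "integrable MX (S j)" unfolding S_def[abs_def]
    by (intro integrable_mult_right Bochner_Integration.integrable_sum g_sq_int) auto
  have "(\<integral>x. S j x \<partial>MX) = 1 / real N * (\<Sum>n<N. \<integral>x. (g j n x)\<^sup>2 \<partial>MX)"
    unfolding S_def[abs_def] integral_mult_right_zero
    by (subst Bochner_Integration.integral_sum) (auto simp: g_sq_int)
  then show "(\<integral>x. S j x \<partial>MX) = t j" using N_pos by (simp add: g_sq)
qed

lemma concentrated: "concentrated_second_moment MX (S j) (t j) (K / real N) (a j)"
  by unfold_locales
    (rule S_meas S_nonneg t_pos S_integrable S_mean a_pos S_var_int[folded S_def] S_var[folded S_def])+

lemmas shrinkage_bounds = concentrated_second_moment.shrinkage_bounds[OF concentrated]
lemmas shrinkage_integrable = concentrated_second_moment.shrinkage_integrable[OF concentrated]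
lemmas shrinkage_le = concentrated_second_moment.shrinkage_le[OF concentrated]
lemmas shrinkage_ge = concentrated_second_moment.shrinkage_ge[OF concentrated]
lemmas residual_integrable = concentrated_second_moment.residual_integrable[OF concentrated]
lemmas residual_le = concentrated_second_moment.residual_le[OF concentrated]
lemmas bias_covariance = concentrated_second_moment.bias_covariance[OF concentrated]
lemmas v_nonneg = concentrated_second_moment.v_nonneg[OF concentrated]
lemmas expectation_deviation = concentrated_second_moment.expectation_deviation[OF concentrated]

lemma one_v_pos: "0 < 1 + a j * S j x" "1 \<le> 1 + a j * S j x"
  using v_nonneg[of j x] by auto

lemma integral_fst_only:
  fixes f :: "'x \<Rightarrow> real"
  assumes "integrable MX f"
  shows "integrable P (\<lambda>z. f (fst z))" "(\<integral>z. f (fst z) \<partial>P) = (\<integral>x. f x \<partial>MX)"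
  using integrable_product[OF assms, of "\<lambda>_. 1"] integral_product[OF assms, of "\<lambda>_. 1"]
  by (auto simp: M2.prob_space)

lemma g_integrable: "n < N \<Longrightarrow> integrable MX (g j n)"
  by (rule M1.expectation_abs_le_sqrt(1)) (auto simp: g_meas g_sq_int)

lemma \<xi>_integrable: "n < N \<Longrightarrow> integrable MQ (\<xi> j n)"
  by (rule M2.expectation_abs_le_sqrt(1)) (auto simp: \<xi>_meas \<xi>_sq_int)

lemma bounded_mult_integrable:
  fixes F f :: "'x \<Rightarrow> real"
  assumes "F \<in> borel_measurable MX" "\<And>x. \<bar>F x\<bar> \<le> B" "integrable MX f"
  shows "integrable MX (\<lambda>x. F x * f x)"
proof (rule Bochner_Integration.integrable_bound)
  show "integrable MX (\<lambda>x. B * f x)" using assms by auto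
  have "\<bar>F x\<bar> * \<bar>f x\<bar> \<le> \<bar>B\<bar> * \<bar>f x\<bar>" for x
    using assms(2)[of x] by (intro mult_right_mono) auto
  then show "AE x in MX. norm (F x * f x) \<le> norm (B * f x)" by (simp add: abs_mult)
qed (use assms in auto)

text \<open>
  The noise is independent of the design and centered, so a weight that depends on the design alone
  does not change the mean zero. Together with \<open>noise_average_covariance\<close> this replaces conditional
  expectation given the design.
\<close>

lemma noise_average_mean:
  fixes F :: "'x \<Rightarrow> real"
  assumes F: "F \<in> borel_measurable MX" "\<And>x. \<bar>F x\<bar> \<le> B"
  shows "integrable P (\<lambda>z. F (fst z) * W j z)" "(\<integral>z. F (fst z) * W j z \<partial>P) = 0"
proof -
  have eq: "F (fst z) * W j z = 1 / real N * (\<Sum>n<N. (F (fst z) * g j n (fst z)) * \<xi> j n (snd z))" for z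
    by (simp add: W_def sum_distrib_left mult_ac)
  have int: "integrable MX (\<lambda>x. F x * g j n x)" if "n < N" for n
    using that by (intro bounded_mult_integrable[OF F] g_integrable)
  note * = integrable_product[OF int \<xi>_integrable] integral_product[OF int \<xi>_integrable]
  show "integrable P (\<lambda>z. F (fst z) * W j z)" unfolding eq
    by (intro integrable_mult_right Bochner_Integration.integrable_sum *(1)) auto
  show "(\<integral>z. F (fst z) * W j z \<partial>P) = 0" unfolding eq integral_mult_right_zero
    by (subst Bochner_Integration.integral_sum) (auto simp: * \<xi>_mean)
qed

text \<open>
  Given the design, the averages \<open>W i\<close> of different coordinates are uncorrelated and \<open>W j\<close> has variance
  \<open>S j / N\<close>.
\<close>

lemma noise_average_covariance:
  fixes F :: "'x \<Rightarrow> real"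
  assumes F: "F \<in> borel_measurable MX" "\<And>x. \<bar>F x\<bar> \<le> B"
  shows "integrable P (\<lambda>z. F (fst z) * (W i z * W j z))"
    and "(\<integral>z. F (fst z) * (W i z * W j z) \<partial>P) = (if i = j then (\<integral>x. F x * S j x \<partial>MX) / real N else 0)"
proof -
  have eq: "F (fst z) * (W i z * W j z) = 1 / (real N)\<^sup>2 *
     (\<Sum>n<N. \<Sum>m<N. (F (fst z) * (g i n (fst z) * g j m (fst z))) * (\<xi> i n (snd z) * \<xi> j m (snd z)))" for z
  proof -
    have "F (fst z) * (W i z * W j z) = 1 / (real N)\<^sup>2 * (F (fst z) *
      ((\<Sum>n<N. g i n (fst z) * \<xi> i n (snd z)) * (\<Sum>m<N. g j m (fst z) * \<xi> j m (snd z))))"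
      by (simp add: W_def power2_eq_square)
    also have "F (fst z) *
      ((\<Sum>n<N. g i n (fst z) * \<xi> i n (snd z)) * (\<Sum>m<N. g j m (fst z) * \<xi> j m (snd z)))
      = (\<Sum>n<N. \<Sum>m<N. (F (fst z) * (g i n (fst z) * g j m (fst z))) * (\<xi> i n (snd z) * \<xi> j m (snd z)))"
      unfolding sum_product by (simp only: sum_distrib_left mult_ac)
    finally show ?thesis .
  qed
  have gg: "integrable MX (\<lambda>x. g i n x * g j m x)" if "n < N" "m < N" for n m
    using that by (intro integrable_mult_of_squares g_meas g_sq_int)
  have xx: "integrable MQ (\<lambda>x. \<xi> i n x * \<xi> j m x)" if "n < N" "m < N" for n m
    using that by (intro integrable_mult_of_squares \<xi>_meas \<xi>_sq_int)
  have int: "integrable MX (\<lambda>x. F x * (g i n x * g j m x))" if "n < N" "m < N" for n m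
    using that by (intro bounded_mult_integrable[OF F] gg)
  note * = integrable_product[OF int xx] integral_product[OF int xx]
  show "integrable P (\<lambda>z. F (fst z) * (W i z * W j z))" unfolding eq
    by (intro integrable_mult_right Bochner_Integration.integrable_sum *(1)) auto
  have "(\<integral>z. (\<Sum>n<N. \<Sum>m<N. (F (fst z) * (g i n (fst z) * g j m (fst z))) * (\<xi> i n (snd z) * \<xi> j m (snd z))) \<partial>P)
      = (\<Sum>n<N. \<integral>z. (\<Sum>m<N. (F (fst z) * (g i n (fst z) * g j m (fst z))) * (\<xi> i n (snd z) * \<xi> j m (snd z))) \<partial>P)"
    by (intro Bochner_Integration.integral_sum Bochner_Integration.integrable_sum *(1)) auto
  also have "\<dots> = (\<Sum>n<N. \<Sum>m<N. \<integral>z. (F (fst z) * (g i n (fst z) * g j m (fst z))) * (\<xi> i n (snd z) * \<xi> j m (snd z)) \<partial>P)"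
    by (intro sum.cong refl Bochner_Integration.integral_sum *(1)) auto
  also have "\<dots> = (\<Sum>n<N. \<Sum>m<N. (\<integral>x. F x * (g i n x * g j m x) \<partial>MX) * (if i = j \<and> n = m then 1 else 0))"
    by (intro sum.cong refl) (simp only: *(2) \<xi>_cov lessThan_iff)
  finally have "(\<integral>z. F (fst z) * (W i z * W j z) \<partial>P) = 1 / (real N)\<^sup>2 *
      (\<Sum>n<N. \<Sum>m<N. (\<integral>x. F x * (g i n x * g j m x) \<partial>MX) * (if i = j \<and> n = m then 1 else 0))"
    unfolding eq integral_mult_right_zero by (simp only:)
  also have "\<dots> = (if i = j then (\<integral>x. F x * S j x \<partial>MX) / real N else 0)"
  proof (cases "i = j")
    case True
    have "F x * S j x = 1 / real N * (\<Sum>n<N. F x * (g j n x * g j n x))" for x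
      unfolding S_def power2_eq_square sum_distrib_left[symmetric] by (rule mult.left_commute)
    then have "(\<integral>x. F x * S j x \<partial>MX) = (\<integral>x. 1 / real N * (\<Sum>n<N. F x * (g j n x * g j n x)) \<partial>MX)"
      by (simp only:)
    also have "\<dots> = 1 / real N * (\<Sum>n<N. \<integral>x. F x * (g j n x * g j n x) \<partial>MX)"
      unfolding integral_mult_right_zero using int True
      by (subst Bochner_Integration.integral_sum) auto
    finally have FS: "(\<integral>x. F x * S j x \<partial>MX) = 1 / real N * (\<Sum>n<N. \<integral>x. F x * (g j n x * g j n x) \<partial>MX)" .
    have "1 / (real N)\<^sup>2 * (\<Sum>n<N. \<Sum>m<N. (\<integral>x. F x * (g i n x * g j m x) \<partial>MX) * (if i = j \<and> n = m then 1 else 0))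
       = 1 / (real N)\<^sup>2 * (\<Sum>n<N. \<integral>x. F x * (g j n x * g j n x) \<partial>MX)"
      using True by (simp add: if_distrib[of "\<lambda>z. _ * z"] sum.delta cong: if_cong)
    then show ?thesis using True unfolding FS by (simp add: power2_eq_square)
  qed simp
  finally show "(\<integral>z. F (fst z) * (W i z * W j z) \<partial>P)
      = (if i = j then (\<integral>x. F x * S j x \<partial>MX) / real N else 0)" .
qed

lemma W_sq: "integrable P (\<lambda>z. (W j z)\<^sup>2)" "(\<integral>z. (W j z)\<^sup>2 \<partial>P) = t j / real N"
proof -
  have one: "(\<lambda>_. 1) \<in> borel_measurable MX" "\<And>x. \<bar>1\<bar> \<le> (1::real)" by auto
  note * = noise_average_covariance[OF one, of j j]
  show "integrable P (\<lambda>z. (W j z)\<^sup>2)" using *(1) unfolding power2_eq_square mult_1 .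
  show "(\<integral>z. (W j z)\<^sup>2 \<partial>P) = t j / real N"
    using *(2) unfolding power2_eq_square mult_1 S_mean by simp
qed

text \<open>
  The dominating function behind all convergence statements. If \<open>y\<^sup>2\<close> has mean \<open>t j\<close>, the right-hand
  side has a mean bounded by a multiple of \<open>(l j)\<^sup>2 t j + a j t j\<close>, which is summable.
\<close>

lemma L_mult_le:
  "\<bar>L j z * y\<bar> \<le> 1 / 2 * ((l j)\<^sup>2 * y\<^sup>2 + a j * S j (fst z)) + \<gamma> / 2 * (a j * (W j z)\<^sup>2 + a j * y\<^sup>2)"
proof -
  let ?v = "a j * S j (fst z)"
  have r: "0 \<le> ?v / (1 + ?v)" "?v / (1 + ?v) \<le> 1" "?v / (1 + ?v) \<le> ?v"
    using shrinkage_bounds[of j "fst z"] divide_left_mono[of 1 "1 + ?v" ?v] v_nonneg[of j "fst z"] by auto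
  have rsq: "(?v / (1 + ?v))\<^sup>2 \<le> ?v"
    using mult_left_mono[OF r(2,1)] r(3) unfolding power2_eq_square by linarith
  have eq: "L j z * y = (?v / (1 + ?v)) * (l j * y) + (\<gamma> / (1 + ?v)) * (a j * (W j z * y))"
    by (simp add: L_def add_divide_distrib algebra_simps)
  have "\<bar>(?v / (1 + ?v)) * (l j * y)\<bar> \<le> 1 / 2 * ((?v / (1 + ?v))\<^sup>2 + (l j * y)\<^sup>2)" by (rule abs_mult_le_squares)
  also have "\<dots> \<le> 1 / 2 * ((l j)\<^sup>2 * y\<^sup>2 + ?v)" using rsq by (simp add: power_mult_distrib)
  finally have 1: "\<bar>(?v / (1 + ?v)) * (l j * y)\<bar> \<le> 1 / 2 * ((l j)\<^sup>2 * y\<^sup>2 + ?v)" .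
  have "\<bar>(\<gamma> / (1 + ?v)) * (a j * (W j z * y))\<bar> = (\<gamma> / (1 + ?v)) * (a j * \<bar>W j z * y\<bar>)"
    using \<gamma>_pos a_pos[of j] one_v_pos[of j "fst z"] by (simp add: abs_mult)
  also have "\<dots> \<le> \<gamma> * (a j * (1 / 2 * ((W j z)\<^sup>2 + y\<^sup>2)))"
    using \<gamma>_pos a_pos[of j] one_v_pos[of j "fst z"] abs_mult_le_squares[of "W j z" y] v_nonneg[of j "fst z"]
    by (intro mult_mono) (auto simp: divide_le_eq)
  also have "\<dots> = \<gamma> / 2 * (a j * (W j z)\<^sup>2 + a j * y\<^sup>2)" by (simp add: distrib_left)
  finally have 2: "\<bar>(\<gamma> / (1 + ?v)) * (a j * (W j z * y))\<bar> \<le> \<gamma> / 2 * (a j * (W j z)\<^sup>2 + a j * y\<^sup>2)" .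
  show ?thesis unfolding eq by (rule order_trans[OF abs_triangle_ineq add_mono[OF 1 2]])
qed

text \<open>
  This is applied with \<open>Y j\<close> equal to \<open>sqrt (t j)\<close>, to the design value and to the design value times
  its noise: the three factors that occur next to the posterior mean in the risks.
\<close>

lemma AE_summable_L_mult:
  fixes Y :: "nat \<Rightarrow> 'x \<times> 'q \<Rightarrow> real"
  assumes Y: "\<And>j. integrable P (\<lambda>z. (Y j z)\<^sup>2)" "\<And>j. (\<integral>z. (Y j z)\<^sup>2 \<partial>P) = t j"
  shows "AE z in P. summable (\<lambda>j. \<bar>L j z * Y j z\<bar>)"
proof -
  let ?h = "\<lambda>j z. 1 / 2 * ((l j)\<^sup>2 * (Y j z)\<^sup>2 + a j * S j (fst z)) + \<gamma> / 2 * (a j * (W j z)\<^sup>2 + a j * (Y j z)\<^sup>2)"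
  have SP: "integrable P (\<lambda>z. S j (fst z))" "(\<integral>z. S j (fst z) \<partial>P) = t j" for j
    unfolding integral_fst_only(2)[OF S_integrable] by (rule integral_fst_only(1)[OF S_integrable] S_mean)+
  have int: "integrable P (?h j)" for j
    by (intro Bochner_Integration.integrable_add integrable_mult_right Y SP W_sq)
  have eq: "(\<integral>z. ?h j z \<partial>P) = 1 / 2 * ((l j)\<^sup>2 * t j + a j * t j) + \<gamma> / 2 * (a j * t j / real N + a j * t j)" for j
    using Y[of j] SP[of j] W_sq[of j] by simp
  have "summable (\<lambda>j. 1 / 2 * ((l j)\<^sup>2 * t j + a j * t j) + \<gamma> / 2 * (a j * t j / real N + a j * t j))"
    by (intro summable_add summable_mult summable_divide sum_at sum_lt)
  then have "summable (\<lambda>j. \<integral>z. ?h j z \<partial>P)"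
    by (simp only: eq)
  then show ?thesis
    by (intro AE_summable_of_summable_integrals[where h = ?h] int L_mult_le)
qed

lemma AE_summable_L_sqrt: "AE z in P. summable (\<lambda>j. \<bar>L j z * sqrt (t j)\<bar>)"
  by (rule AE_summable_L_mult) (use t_pos in \<open>auto simp: less_imp_le prob_space\<close>)

lemma AE_summable_L_g:
  assumes "n < N" shows "AE z in P. summable (\<lambda>j. \<bar>L j z * g j n (fst z)\<bar>)"
  using integral_fst_only[OF g_sq_int[OF assms]] g_sq[OF assms] by (intro AE_summable_L_mult) auto

lemma AE_summable_L_g_noise:
  assumes "n < N" shows "AE z in P. summable (\<lambda>j. \<bar>L j z * (g j n (fst z) * \<xi> j n (snd z))\<bar>)"
  using integrable_product[OF g_sq_int[OF assms] \<xi>_sq_int[OF assms]]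
    integral_product[OF g_sq_int[OF assms] \<xi>_sq_int[OF assms]] g_sq[OF assms] \<xi>_cov[OF assms assms]
  by (intro AE_summable_L_mult) (auto simp: power_mult_distrib power2_eq_square[of "\<xi> _ _ _"])

lemma AE_summable_truth_g:
  assumes "n < N" shows "AE z in P. summable (\<lambda>j. (l j * g j n (fst z))\<^sup>2)"
proof -
  note * = integral_fst_only[OF g_sq_int[OF assms]] g_sq[OF assms]
  have "AE z in P. summable (\<lambda>j. \<bar>(l j * g j n (fst z))\<^sup>2\<bar>)"
    by (rule AE_summable_of_summable_integrals[where h = "\<lambda>j z. (l j)\<^sup>2 * (g j n (fst z))\<^sup>2"])
      (use * sum_lt in \<open>auto simp: power_mult_distrib\<close>)
  then show ?thesis by simp
qed

end

section \<open>The terms of the generalization gap\<close>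

context sequence_regression
begin

text \<open>
  The part of \<open>\<gamma> L W\<close> that is linear in the noise. It is separated from the rest because the size of
  its sum over \<open>j\<close> comes from orthogonality between coordinates, not from bounds on the absolute values
  of single terms.
\<close>

definition noise_cross where
  "noise_cross j z = \<gamma> * (a j * S j (fst z) / (1 + a j * S j (fst z))) * l j * W j z"

definition gap_rest where
  "gap_rest j z = 1 / 2 * (t j - S j (fst z)) * ((L j z - l j)\<^sup>2 - (l j)\<^sup>2)
     + \<gamma>\<^sup>2 * a j / (1 + a j * S j (fst z)) * (W j z)\<^sup>2"

lemma L_split:
  "L j z = a j * S j (fst z) / (1 + a j * S j (fst z)) * l j + \<gamma> * a j / (1 + a j * S j (fst z)) * W j z"
  by (simp add: L_def add_divide_distrib algebra_simps)

lemma L_error: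
  "L j z - l j = \<gamma> * a j / (1 + a j * S j (fst z)) * W j z - l j / (1 + a j * S j (fst z))"
proof -
  have "a j * S j (fst z) / (1 + a j * S j (fst z)) = 1 - 1 / (1 + a j * S j (fst z))"
    using one_v_pos[of j "fst z"] by (simp add: field_simps)
  then show ?thesis unfolding L_split by (simp add: left_diff_distrib)
qed

lemma gap_term_split: "gap_term j z = gap_rest j z + noise_cross j z"
proof -
  have "gap_term j z = 1 / 2 * (t j - S j (fst z)) * ((L j z - l j)\<^sup>2 - (l j)\<^sup>2) + \<gamma> * (L j z * W j z)"
    by (simp add: gap_term_def power2_eq_square algebra_simps)
  also have "\<gamma> * (L j z * W j z) = \<gamma>\<^sup>2 * a j / (1 + a j * S j (fst z)) * (W j z)\<^sup>2 + noise_cross j z"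
    unfolding L_split noise_cross_def by (simp add: power2_eq_square algebra_simps)
  finally show ?thesis by (simp add: gap_rest_def)
qed

text \<open>
  The coefficient of the noise average \<open>W\<close> in the posterior mean.
\<close>

definition gain where "gain j x = \<gamma> * a j / (1 + a j * S j x)"

lemma gain_bounds: "0 \<le> gain j x" "gain j x \<le> \<gamma> * a j" "\<gamma> * a j * gain j x * S j x \<le> \<gamma>\<^sup>2 * a j"
proof -
  have ga: "0 \<le> \<gamma> * a j" using \<gamma>_pos a_pos[of j] by simp
  show "0 \<le> gain j x" using ga one_v_pos[of j x] by (simp add: gain_def)
  show "gain j x \<le> \<gamma> * a j"
    using divide_left_mono[OF one_v_pos(2), of "\<gamma> * a j" j x] ga one_v_pos[of j x] by (simp add: gain_def)
  have "\<gamma> * a j * gain j x * S j x = (\<gamma>\<^sup>2 * a j) * (a j * S j x / (1 + a j * S j x))"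
    by (simp add: gain_def power2_eq_square)
  also have "\<dots> \<le> (\<gamma>\<^sup>2 * a j) * 1"
    using shrinkage_bounds(2)[of j x] a_pos[of j] by (intro mult_left_mono) auto
  finally show "\<gamma> * a j * gain j x * S j x \<le> \<gamma>\<^sup>2 * a j" by simp
qed

lemma gain_meas[measurable]: "gain j \<in> borel_measurable MX"
  unfolding gain_def[abs_def] by measurable

lemma deviation_gain_bound: "\<bar>t j - S j x\<bar> * (gain j x)\<^sup>2 \<le> t j * (\<gamma> * a j)\<^sup>2 + \<gamma>\<^sup>2 * a j"
proof -
  note g = gain_bounds[of j x]
  have "\<bar>t j - S j x\<bar> * (gain j x)\<^sup>2 \<le> (t j + S j x) * (gain j x)\<^sup>2"
    using t_pos[of j] S_nonneg[of j x] by (intro mult_right_mono) auto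
  also have "\<dots> = t j * (gain j x)\<^sup>2 + gain j x * gain j x * S j x"
    by (simp add: power2_eq_square algebra_simps)
  also have "t j * (gain j x)\<^sup>2 \<le> t j * (\<gamma> * a j)\<^sup>2"
    using g t_pos[of j] by (intro mult_left_mono power_mono) auto
  also have "gain j x * gain j x * S j x \<le> \<gamma> * a j * gain j x * S j x"
    using g S_nonneg[of j x] by (intro mult_right_mono) auto
  also have "\<dots> \<le> \<gamma>\<^sup>2 * a j" by (rule g(3))
  finally show ?thesis by simp
qed

text \<open>
  The coefficient of \<open>W\<^sup>2\<close> in the bound for \<open>gap_rest\<close>.
\<close>

definition rest_weight where
  "rest_weight j x = \<bar>t j - S j x\<bar> * (gain j x)\<^sup>2 + \<gamma> * gain j x"

lemma gap_rest_le:
  "\<bar>gap_rest j z\<bar> \<le> 3 / 2 * ((l j)\<^sup>2 * \<bar>S j (fst z) - t j\<bar>) + rest_weight j (fst z) * (W j z * W j z)"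
proof -
  let ?S = "S j (fst z)" and ?g = "gain j (fst z)"
  have sq: "(L j z - l j)\<^sup>2 \<le> 2 * (?g * W j z)\<^sup>2 + 2 * (l j)\<^sup>2"
  proof -
    have "(u - w)\<^sup>2 \<le> 2 * u\<^sup>2 + 2 * w\<^sup>2" for u w :: real
      using zero_le_power2[of "u + w"] by (simp add: power2_eq_square algebra_simps)
    then have "(L j z - l j)\<^sup>2 \<le> 2 * (?g * W j z)\<^sup>2 + 2 * (l j / (1 + a j * ?S))\<^sup>2"
      unfolding L_error gain_def .
    also have "(l j / (1 + a j * ?S))\<^sup>2 \<le> (l j)\<^sup>2"
    proof -
      have "\<bar>l j / (1 + a j * ?S)\<bar> \<le> \<bar>l j\<bar>"
        using divide_left_mono[OF one_v_pos(2), of "\<bar>l j\<bar>" j "fst z"] one_v_pos[of j "fst z"] by simp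
      then show ?thesis by (simp only: abs_le_square_iff)
    qed
    finally show ?thesis by simp
  qed
  have "\<bar>(L j z - l j)\<^sup>2 - (l j)\<^sup>2\<bar> \<le> 2 * (?g * W j z)\<^sup>2 + 3 * (l j)\<^sup>2"
    using sq zero_le_power2[of "L j z - l j"] zero_le_power2[of "?g * W j z"] zero_le_power2[of "l j"] by linarith
  then have "1 / 2 * \<bar>t j - ?S\<bar> * \<bar>(L j z - l j)\<^sup>2 - (l j)\<^sup>2\<bar>
     \<le> 1 / 2 * \<bar>t j - ?S\<bar> * (2 * (?g * W j z)\<^sup>2 + 3 * (l j)\<^sup>2)"
    by (intro mult_left_mono) auto
  also have "\<dots> = 3 / 2 * ((l j)\<^sup>2 * \<bar>t j - ?S\<bar>) + (\<bar>t j - ?S\<bar> * ?g\<^sup>2) * (W j z * W j z)"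
    by (simp add: power2_eq_square algebra_simps)
  finally have 1: "\<bar>1 / 2 * (t j - ?S) * ((L j z - l j)\<^sup>2 - (l j)\<^sup>2)\<bar>
     \<le> 3 / 2 * ((l j)\<^sup>2 * \<bar>t j - ?S\<bar>) + (\<bar>t j - ?S\<bar> * ?g\<^sup>2) * (W j z * W j z)"
    by (simp add: abs_mult)
  have "\<gamma>\<^sup>2 * a j / (1 + a j * ?S) * (W j z)\<^sup>2 = (\<gamma> * ?g) * (W j z * W j z)"
    by (simp add: gain_def power2_eq_square)
  moreover have "0 \<le> (\<gamma> * ?g) * (W j z * W j z)" using gain_bounds(1) \<gamma>_pos by simp
  ultimately have 2: "\<bar>\<gamma>\<^sup>2 * a j / (1 + a j * ?S) * (W j z)\<^sup>2\<bar> = (\<gamma> * ?g) * (W j z * W j z)" by simp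
  have "\<bar>gap_rest j z\<bar> \<le> \<bar>1 / 2 * (t j - ?S) * ((L j z - l j)\<^sup>2 - (l j)\<^sup>2)\<bar> + \<bar>\<gamma>\<^sup>2 * a j / (1 + a j * ?S) * (W j z)\<^sup>2\<bar>"
    unfolding gap_rest_def by (rule abs_triangle_ineq)
  also have "\<dots> \<le> 3 / 2 * ((l j)\<^sup>2 * \<bar>t j - ?S\<bar>) + (\<bar>t j - ?S\<bar> * ?g\<^sup>2) * (W j z * W j z) + (\<gamma> * ?g) * (W j z * W j z)"
    using 1 2 by simp
  also have "\<dots> = 3 / 2 * ((l j)\<^sup>2 * \<bar>?S - t j\<bar>) + rest_weight j (fst z) * (W j z * W j z)"
    by (simp add: rest_weight_def algebra_simps abs_minus_commute)
  finally show ?thesis .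
qed

text \<open>
  After integrating out the noise, \<open>rest_weight\<close> turns into the sum of the two quantities bounded by
  \<open>residual_le\<close> and \<open>shrinkage_le\<close>.
\<close>

lemma gap_rest_expectation:
  "integrable P (gap_rest j)"
  "(\<integral>z. \<bar>gap_rest j z\<bar> \<partial>P) \<le> 3 / 2 * ((l j)\<^sup>2 * (t j * sqrt (K / real N)))
     + \<gamma>\<^sup>2 / real N * (4 * min 1 (a j * t j) + 4 * (K / real N) * (a j * t j))"
proof -
  let ?dev = "\<lambda>x. \<bar>S j x - t j\<bar>"
  let ?H = "\<lambda>z. 3 / 2 * ((l j)\<^sup>2 * ?dev (fst z)) + rest_weight j (fst z) * (W j z * W j z)"
  have meas: "rest_weight j \<in> borel_measurable MX" unfolding rest_weight_def[abs_def] by measurable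
  have "0 \<le> rest_weight j x" "rest_weight j x \<le> (t j * (\<gamma> * a j)\<^sup>2 + \<gamma>\<^sup>2 * a j) + \<gamma> * (\<gamma> * a j)" for x
    unfolding rest_weight_def using gain_bounds[of j x] \<gamma>_pos deviation_gain_bound[of j x]
    by (auto intro!: add_mono mult_left_mono add_nonneg_nonneg)
  then have bd: "\<bar>rest_weight j x\<bar> \<le> (t j * (\<gamma> * a j)\<^sup>2 + \<gamma>\<^sup>2 * a j) + \<gamma> * (\<gamma> * a j)" for x by simp
  note WW = noise_average_covariance[OF meas bd, of j j]
  have devint: "integrable MX ?dev" using S_integrable[of j] by auto
  note dev = integral_fst_only[OF devint]
  have Hint: "integrable P ?H"
    by (intro Bochner_Integration.integrable_add integrable_mult_right dev(1) WW(1))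
  have [measurable]: "gap_rest j \<in> borel_measurable P"
    unfolding gap_rest_def[abs_def] by measurable
  have le: "norm (gap_rest j z) \<le> norm (?H z)" for z
    using gap_rest_le[of j z] unfolding real_norm_def by linarith
  show int: "integrable P (gap_rest j)"
    by (rule Bochner_Integration.integrable_bound[OF Hint]) (use le in auto)
  have weight_S: "rest_weight j x * S j x =
      \<gamma>\<^sup>2 * (\<bar>a j * t j - a j * S j x\<bar> * (a j * S j x) / (1 + a j * S j x)\<^sup>2 + a j * S j x / (1 + a j * S j x))" for x
  proof -
    have "\<bar>a j * t j - a j * S j x\<bar> = a j * \<bar>t j - S j x\<bar>"
      using a_pos[of j] by (simp add: right_diff_distrib[symmetric] abs_mult)
    then show ?thesis
      by (simp add: rest_weight_def gain_def power2_eq_square algebra_simps)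
  qed
  have "(\<integral>z. \<bar>gap_rest j z\<bar> \<partial>P) \<le> (\<integral>z. ?H z \<partial>P)"
    using int Hint gap_rest_le[of j] by (intro integral_mono) auto
  also have "\<dots> = (\<integral>z. 3 / 2 * ((l j)\<^sup>2 * ?dev (fst z)) \<partial>P) + (\<integral>z. rest_weight j (fst z) * (W j z * W j z) \<partial>P)"
    by (intro Bochner_Integration.integral_add integrable_mult_right dev(1) WW(1))
  also have "(\<integral>z. 3 / 2 * ((l j)\<^sup>2 * ?dev (fst z)) \<partial>P) = 3 / 2 * ((l j)\<^sup>2 * (\<integral>x. ?dev x \<partial>MX))"
    unfolding integral_mult_right_zero dev(2) ..
  also have "\<dots> \<le> 3 / 2 * ((l j)\<^sup>2 * (t j * sqrt (K / real N)))"
    by (intro mult_left_mono expectation_deviation) auto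
  also have "(\<integral>z. rest_weight j (fst z) * (W j z * W j z) \<partial>P) = (\<integral>x. rest_weight j x * S j x \<partial>MX) / real N"
    using WW(2) by simp
  also have "(\<integral>x. rest_weight j x * S j x \<partial>MX) = \<gamma>\<^sup>2 *
     ((\<integral>x. \<bar>a j * t j - a j * S j x\<bar> * (a j * S j x) / (1 + a j * S j x)\<^sup>2 \<partial>MX) + (\<integral>x. a j * S j x / (1 + a j * S j x) \<partial>MX))"
    unfolding weight_S integral_mult_right_zero
    by (subst Bochner_Integration.integral_add[OF residual_integrable shrinkage_integrable]) simp
  also have "\<dots> / real N \<le> \<gamma>\<^sup>2 * ((3 * min 1 (a j * t j) + 4 * (K / real N) * (a j * t j)) + min 1 (a j * t j)) / real N"
    by (intro divide_right_mono mult_left_mono add_mono residual_le shrinkage_le) auto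
  also have "\<dots> = \<gamma>\<^sup>2 / real N * (4 * min 1 (a j * t j) + 4 * (K / real N) * (a j * t j))"
    by (simp add: algebra_simps add_divide_distrib)
  finally show "(\<integral>z. \<bar>gap_rest j z\<bar> \<partial>P) \<le> 3 / 2 * ((l j)\<^sup>2 * (t j * sqrt (K / real N)))
     + \<gamma>\<^sup>2 / real N * (4 * min 1 (a j * t j) + 4 * (K / real N) * (a j * t j))" by simp
qed

text \<open>
  A bound with summable mean at fixed \<open>N\<close>, which justifies exchanging sum and expectation. It does not
  decay with \<open>N\<close>; the rate comes from \<open>noise_cross_partial_sum\<close>.
\<close>

lemma noise_cross_le: "\<bar>noise_cross j z\<bar> \<le> \<gamma> / 2 * ((l j)\<^sup>2 * S j (fst z) + a j * (W j z)\<^sup>2)"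
proof -
  let ?S = "S j (fst z)"
  define q where "q = a j / (1 + a j * ?S)"
  have q: "0 \<le> q" "q \<le> a j" "q * ?S \<le> 1"
    using a_pos[of j] one_v_pos[of j "fst z"] shrinkage_bounds(2)[of j "fst z"]
      divide_left_mono[OF one_v_pos(2), of "a j" j "fst z"] by (auto simp: q_def)
  have "q * \<bar>(?S * l j) * W j z\<bar> \<le> q * (1 / 2 * ((?S * l j)\<^sup>2 + (W j z)\<^sup>2))"
    by (rule mult_left_mono[OF abs_mult_le_squares q(1)])
  also have "\<dots> = 1 / 2 * ((q * ?S) * ((l j)\<^sup>2 * ?S) + q * (W j z)\<^sup>2)"
    by (simp add: power2_eq_square algebra_simps)
  also have "\<dots> \<le> 1 / 2 * (1 * ((l j)\<^sup>2 * ?S) + a j * (W j z)\<^sup>2)"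
    using q S_nonneg[of j "fst z"] by (intro mult_left_mono add_mono mult_right_mono) auto
  finally have "\<gamma> * (q * \<bar>(?S * l j) * W j z\<bar>) \<le> \<gamma> * (1 / 2 * (1 * ((l j)\<^sup>2 * ?S) + a j * (W j z)\<^sup>2))"
    using \<gamma>_pos by (intro mult_left_mono) auto
  moreover have "\<bar>noise_cross j z\<bar> = \<gamma> * (q * \<bar>(?S * l j) * W j z\<bar>)"
  proof -
    have "noise_cross j z = \<gamma> * (q * ((?S * l j) * W j z))" by (simp add: noise_cross_def q_def)
    then show ?thesis using \<gamma>_pos q by (simp add: abs_mult)
  qed
  ultimately show ?thesis by simp
qed

lemma noise_cross_integrable: "integrable P (noise_cross j)"
  and noise_cross_mean: "(\<integral>z. noise_cross j z \<partial>P) = 0"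
  and noise_cross_abs: "(\<integral>z. \<bar>noise_cross j z\<bar> \<partial>P) \<le> \<gamma> / 2 * ((l j)\<^sup>2 * t j + a j * (t j / real N))"
proof -
  let ?F = "\<lambda>x. \<gamma> * (a j * S j x / (1 + a j * S j x)) * l j"
  have eq: "noise_cross j = (\<lambda>z. ?F (fst z) * W j z)" by (simp add: noise_cross_def fun_eq_iff)
  have bd: "\<bar>?F x\<bar> \<le> \<gamma> * 1 * \<bar>l j\<bar>" for x
  proof -
    have "\<bar>?F x\<bar> = \<gamma> * (a j * S j x / (1 + a j * S j x)) * \<bar>l j\<bar>"
      using \<gamma>_pos shrinkage_bounds(1)[of j x] by (simp only: abs_mult abs_of_pos abs_of_nonneg)
    also have "\<dots> \<le> \<gamma> * 1 * \<bar>l j\<bar>"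
      using \<gamma>_pos shrinkage_bounds(2)[of j x] by (intro mult_right_mono mult_left_mono) auto
    finally show ?thesis .
  qed
  have meas: "?F \<in> borel_measurable MX" by measurable
  show int: "integrable P (noise_cross j)" and "(\<integral>z. noise_cross j z \<partial>P) = 0"
    unfolding eq by (rule noise_average_mean[OF meas bd])+
  note SP = integral_fst_only[OF S_integrable[of j]]
  have "(\<integral>z. \<bar>noise_cross j z\<bar> \<partial>P) \<le> (\<integral>z. \<gamma> / 2 * ((l j)\<^sup>2 * S j (fst z) + a j * (W j z)\<^sup>2) \<partial>P)"
    by (intro integral_mono noise_cross_le integrable_mult_right Bochner_Integration.integrable_add
        SP(1) W_sq(1) integrable_abs int)
  also have "\<dots> = \<gamma> / 2 * ((\<integral>z. (l j)\<^sup>2 * S j (fst z) \<partial>P) + (\<integral>z. a j * (W j z)\<^sup>2 \<partial>P))"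
    unfolding integral_mult_right_zero[of _ "\<gamma> / 2"]
    by (subst Bochner_Integration.integral_add) (intro integrable_mult_right SP(1) W_sq(1) refl)+
  also have "\<dots> = \<gamma> / 2 * ((l j)\<^sup>2 * t j + a j * (t j / real N))"
    unfolding integral_mult_right_zero SP(2) W_sq(2) S_mean ..
  finally show "(\<integral>z. \<bar>noise_cross j z\<bar> \<partial>P) \<le> \<gamma> / 2 * ((l j)\<^sup>2 * t j + a j * (t j / real N))" .
qed

lemma noise_cross_orthogonal:
  "integrable P (\<lambda>z. noise_cross i z * noise_cross j z)"
  "i \<noteq> j \<Longrightarrow> (\<integral>z. noise_cross i z * noise_cross j z \<partial>P) = 0"
  "(\<integral>z. noise_cross j z * noise_cross j z \<partial>P) \<le> \<gamma>\<^sup>2 / real N * ((l j)\<^sup>2 * t j)"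
proof -
  define r where "r i x = a i * S i x / (1 + a i * S i x)" for i x
  define F where "F i j x = (\<gamma>\<^sup>2 * (l i * l j)) * (r i x * r j x)" for i j x
  have r: "0 \<le> r i x" "r i x \<le> 1" for i x unfolding r_def by (rule shrinkage_bounds)+
  have rr: "0 \<le> r i x * r j x" "r i x * r j x \<le> 1" for i j x
    using r[of i x] r[of j x] by (auto intro: mult_le_one)
  have meas: "F i j \<in> borel_measurable MX" for i j unfolding F_def[abs_def] r_def[abs_def] by measurable
  have bd: "\<bar>F i j x\<bar> \<le> \<bar>\<gamma>\<^sup>2 * (l i * l j)\<bar> * 1" for i j x
    unfolding F_def abs_mult[of "\<gamma>\<^sup>2 * (l i * l j)"] abs_of_nonneg[OF rr(1)]
    by (intro mult_left_mono rr) auto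
  have eq: "noise_cross i z * noise_cross j z = F i j (fst z) * (W i z * W j z)" for i j z
    by (simp add: noise_cross_def F_def r_def power2_eq_square mult_ac)
  note WW = noise_average_covariance[OF meas bd]
  show "integrable P (\<lambda>z. noise_cross i z * noise_cross j z)" unfolding eq by (rule WW(1))
  show "(\<integral>z. noise_cross i z * noise_cross j z \<partial>P) = 0" if "i \<noteq> j"
    unfolding eq using WW(2)[of i j i j] that by simp
  have FS: "F j j x * S j x \<le> \<gamma>\<^sup>2 * (l j)\<^sup>2 * S j x" for x
  proof -
    have "F j j x \<le> \<gamma>\<^sup>2 * (l j)\<^sup>2 * 1"
      unfolding F_def power2_eq_square[of "l j"] by (intro mult_left_mono rr) auto
    then show ?thesis using S_nonneg[of j x] by (intro mult_right_mono) auto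
  qed
  have "(\<integral>z. noise_cross j z * noise_cross j z \<partial>P) = (\<integral>x. F j j x * S j x \<partial>MX) / real N"
    unfolding eq using WW(2)[of j j j j] by simp
  also have "\<dots> \<le> (\<integral>x. \<gamma>\<^sup>2 * (l j)\<^sup>2 * S j x \<partial>MX) / real N"
    by (intro divide_right_mono integral_mono FS bounded_mult_integrable[OF meas bd] integrable_mult_right S_integrable) auto
  also have "\<dots> = \<gamma>\<^sup>2 / real N * ((l j)\<^sup>2 * t j)"
    unfolding integral_mult_right_zero S_mean by simp
  finally show "(\<integral>z. noise_cross j z * noise_cross j z \<partial>P) \<le> \<gamma>\<^sup>2 / real N * ((l j)\<^sup>2 * t j)" .
qed

text \<open>
  By orthogonality the second moments add up, and they are at most \<open>\<gamma>\<^sup>2 / N\<close> times \<open>(l j)\<^sup>2 t j\<close>, as the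
  shrinkage factor is at most \<open>1\<close>.
\<close>

lemma noise_cross_partial_sum:
  "(\<integral>z. \<bar>\<Sum>j<J. noise_cross j z\<bar> \<partial>P) \<le> \<gamma> / sqrt (real N) * sqrt (\<Sum>j. (l j)\<^sup>2 * t j)"
proof -
  have [measurable]: "noise_cross j \<in> borel_measurable P" for j using noise_cross_integrable by auto
  have sq: "(\<Sum>j<J. noise_cross j z)\<^sup>2 = (\<Sum>i<J. \<Sum>j<J. noise_cross i z * noise_cross j z)" for z
    by (simp add: power2_eq_square sum_product)
  have int: "integrable P (\<lambda>z. (\<Sum>j<J. noise_cross j z)\<^sup>2)"
    unfolding sq by (intro Bochner_Integration.integrable_sum noise_cross_orthogonal(1))
  have "(\<integral>z. (\<Sum>j<J. noise_cross j z)\<^sup>2 \<partial>P) = (\<Sum>i<J. \<Sum>j<J. \<integral>z. noise_cross i z * noise_cross j z \<partial>P)"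
    unfolding sq by (simp add: Bochner_Integration.integral_sum noise_cross_orthogonal(1))
  also have "\<dots> = (\<Sum>i<J. \<Sum>j<J. if j = i then \<integral>z. noise_cross i z * noise_cross i z \<partial>P else 0)"
    by (intro sum.cong refl) (auto simp: noise_cross_orthogonal(2))
  also have "\<dots> = (\<Sum>i<J. \<integral>z. noise_cross i z * noise_cross i z \<partial>P)"
    by simp
  also have "\<dots> \<le> (\<Sum>i<J. \<gamma>\<^sup>2 / real N * ((l i)\<^sup>2 * t i))"
    by (intro sum_mono noise_cross_orthogonal(3))
  also have "\<dots> = \<gamma>\<^sup>2 / real N * (\<Sum>i<J. (l i)\<^sup>2 * t i)" by (simp add: sum_distrib_left)
  also have "\<dots> \<le> \<gamma>\<^sup>2 / real N * (\<Sum>j. (l j)\<^sup>2 * t j)"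
    using t_pos by (intro mult_left_mono sum_le_suminf[OF sum_lt]) (auto simp: less_imp_le)
  finally have le: "(\<integral>z. (\<Sum>j<J. noise_cross j z)\<^sup>2 \<partial>P) \<le> \<gamma>\<^sup>2 / real N * (\<Sum>j. (l j)\<^sup>2 * t j)" .
  have "(\<integral>z. \<bar>\<Sum>j<J. noise_cross j z\<bar> \<partial>P) \<le> sqrt (\<integral>z. (\<Sum>j<J. noise_cross j z)\<^sup>2 \<partial>P)"
    by (rule expectation_abs_le_sqrt(2)[OF _ int]) measurable
  also have "\<dots> \<le> sqrt (\<gamma>\<^sup>2 / real N * (\<Sum>j. (l j)\<^sup>2 * t j))" using le by simp
  also have "\<dots> = \<gamma> / sqrt (real N) * sqrt (\<Sum>j. (l j)\<^sup>2 * t j)"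
    using \<gamma>_pos by (simp add: real_sqrt_mult real_sqrt_divide)
  finally show ?thesis .
qed

lemma noise_cross_sum:
  "integrable P (\<lambda>z. \<Sum>j. noise_cross j z)" "AE z in P. summable (\<lambda>j. noise_cross j z)"
  "(\<integral>z. \<bar>\<Sum>j. noise_cross j z\<bar> \<partial>P) \<le> \<gamma> / sqrt (real N) * sqrt (\<Sum>j. (l j)\<^sup>2 * t j)"
  "summable (\<lambda>j. \<integral>z. \<bar>noise_cross j z\<bar> \<partial>P)"
proof -
  have [measurable]: "noise_cross j \<in> borel_measurable P" for j using noise_cross_integrable by auto
  have "summable (\<lambda>j. \<gamma> / 2 * ((l j)\<^sup>2 * t j + a j * t j / real N))"
    by (intro summable_mult summable_add summable_divide sum_at sum_lt)
  then show sum: "summable (\<lambda>j. \<integral>z. \<bar>noise_cross j z\<bar> \<partial>P)"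
    by (rule summable_comparison_test') (use noise_cross_abs in auto)
  show int: "integrable P (\<lambda>z. \<Sum>j. noise_cross j z)"
    by (rule integral_suminf_of_summable_abs[OF noise_cross_integrable sum])
  have "AE z in P. summable (\<lambda>j. \<bar>noise_cross j z\<bar>)"
    by (rule AE_summable_of_summable_integrals[OF integrable_abs[OF noise_cross_integrable] sum]) simp
  then show ae: "AE z in P. summable (\<lambda>j. noise_cross j z)"
    by eventually_elim (rule summable_rabs_cancel)
  have lim: "AE z in P. (\<lambda>J. \<bar>\<Sum>j<J. noise_cross j z\<bar>) \<longlonglongrightarrow> \<bar>\<Sum>j. noise_cross j z\<bar>"
    using ae by eventually_elim (intro tendsto_rabs summable_LIMSEQ)
  have meas: "(\<lambda>z. \<bar>\<Sum>j<J. noise_cross j z\<bar>) \<in> borel_measurable P" "(\<lambda>z. \<bar>\<Sum>j. noise_cross j z\<bar>) \<in> borel_measurable P" for J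
    by measurable
  have intJ: "integrable P (\<lambda>z. \<bar>\<Sum>j<J. noise_cross j z\<bar>)" for J
    by (intro integrable_abs Bochner_Integration.integrable_sum noise_cross_integrable)
  show "(\<integral>z. \<bar>\<Sum>j. noise_cross j z\<bar> \<partial>P) \<le> \<gamma> / sqrt (real N) * sqrt (\<Sum>j. (l j)\<^sup>2 * t j)"
    by (rule Fatou_integral_bound(2)[OF meas _ _ lim intJ noise_cross_partial_sum]) auto
qed

text \<open>
  Writing the term as \<open>F0 + F1 W + F2 W\<^sup>2\<close> with coefficients that depend on the design alone, \<open>F0\<close> has
  nonnegative mean by \<open>bias_covariance\<close>, the linear part has mean zero, and \<open>F2 S\<close> is at least half of
  what it would be without the factor \<open>t - S\<close>.
\<close>

lemma gap_term_expectation: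
  "integrable P (gap_term j)"
  "\<gamma>\<^sup>2 / (2 * real N) * (\<integral>x. a j * S j x / (1 + a j * S j x) \<partial>MX) \<le> (\<integral>z. gap_term j z \<partial>P)"
proof -
  define F0 where "F0 x = (l j)\<^sup>2 / 2 * ((t j - S j x) / (1 + a j * S j x)\<^sup>2) - (l j)\<^sup>2 / 2 * (t j - S j x)" for x
  define F1 where "F1 x = - ((t j - S j x) * gain j x * (l j / (1 + a j * S j x)))" for x
  define F2 where "F2 x = 1 / 2 * (t j - S j x) * (gain j x)\<^sup>2 + \<gamma> * gain j x" for x
  have rest: "gap_rest j z = F0 (fst z) + F1 (fst z) * W j z + F2 (fst z) * (W j z * W j z)" for z
  proof -
    define u where "u = l j / (1 + a j * S j (fst z))"
    define q where "q = gain j (fst z)"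
    have "gap_rest j z = 1 / 2 * (t j - S j (fst z)) * ((q * W j z - u)\<^sup>2 - (l j)\<^sup>2) + \<gamma> * q * (W j z)\<^sup>2"
      unfolding gap_rest_def L_error by (simp add: q_def u_def gain_def power2_eq_square)
    moreover have "F0 (fst z) = 1 / 2 * (t j - S j (fst z)) * (u\<^sup>2 - (l j)\<^sup>2)"
    proof -
      have "c / 2 * (d / w) - c / 2 * d = 1 / 2 * d * (c / w - c)" for c d w :: real
        by (simp add: right_diff_distrib mult.commute)
      then show ?thesis unfolding F0_def u_def power_divide .
    qed
    moreover have "F1 (fst z) = - ((t j - S j (fst z)) * q * u)" by (simp add: F1_def q_def u_def)
    moreover have "F2 (fst z) = 1 / 2 * (t j - S j (fst z)) * q\<^sup>2 + \<gamma> * q" by (simp add: F2_def q_def)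
    moreover have "1 / 2 * d * ((q * w - u)\<^sup>2 - c) + \<gamma> * q * w\<^sup>2
        = 1 / 2 * d * (u\<^sup>2 - c) + - (d * q * u) * w + (1 / 2 * d * q\<^sup>2 + \<gamma> * q) * (w * w)" for c d w :: real
      by (simp add: power2_eq_square field_simps)
    ultimately show ?thesis by (simp only:)
  qed
  have [measurable]: "F1 \<in> borel_measurable MX" "F2 \<in> borel_measurable MX"
    unfolding F1_def[abs_def] F2_def[abs_def] by measurable
  have F1: "\<bar>F1 x\<bar> \<le> (t j * (\<gamma> * a j) + \<gamma>) * \<bar>l j\<bar>" for x
  proof -
    have "\<bar>t j - S j x\<bar> * gain j x \<le> (t j + S j x) * gain j x"
      using t_pos[of j] S_nonneg[of j x] gain_bounds(1) by (intro mult_right_mono) auto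
    also have "\<dots> = t j * gain j x + \<gamma> * (a j * S j x / (1 + a j * S j x))"
      by (simp add: gain_def algebra_simps add_divide_distrib)
    also have "\<dots> \<le> t j * (\<gamma> * a j) + \<gamma> * 1"
      using t_pos[of j] \<gamma>_pos gain_bounds(2) shrinkage_bounds(2) by (intro add_mono mult_left_mono) auto
    finally have 1: "\<bar>t j - S j x\<bar> * gain j x \<le> t j * (\<gamma> * a j) + \<gamma>" by simp
    have 2: "\<bar>l j\<bar> / (1 + a j * S j x) \<le> \<bar>l j\<bar>"
      using divide_left_mono[OF one_v_pos(2), of "\<bar>l j\<bar>" j x] one_v_pos[of j x] by simp
    have "\<bar>F1 x\<bar> = (\<bar>t j - S j x\<bar> * gain j x) * (\<bar>l j\<bar> / (1 + a j * S j x))"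
      using gain_bounds(1)[of j x] one_v_pos(1)[of j x] by (simp add: F1_def abs_mult)
    also have "\<dots> \<le> (t j * (\<gamma> * a j) + \<gamma>) * \<bar>l j\<bar>"
      using t_pos[of j] \<gamma>_pos a_pos[of j] one_v_pos(1)[of j x] by (intro mult_mono 1 2) auto
    finally show ?thesis .
  qed
  have F2: "\<bar>F2 x\<bar> \<le> (t j * (\<gamma> * a j)\<^sup>2 + \<gamma>\<^sup>2 * a j) + \<gamma> * (\<gamma> * a j)" for x
  proof -
    have "\<bar>F2 x\<bar> \<le> \<bar>1 / 2 * (t j - S j x) * (gain j x)\<^sup>2\<bar> + \<bar>\<gamma> * gain j x\<bar>"
      unfolding F2_def by (rule abs_triangle_ineq)
    also have "\<bar>1 / 2 * (t j - S j x) * (gain j x)\<^sup>2\<bar> \<le> \<bar>t j - S j x\<bar> * (gain j x)\<^sup>2"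
      by (simp add: abs_mult)
    also have "\<dots> \<le> t j * (\<gamma> * a j)\<^sup>2 + \<gamma>\<^sup>2 * a j" by (rule deviation_gain_bound)
    also have "\<bar>\<gamma> * gain j x\<bar> \<le> \<gamma> * (\<gamma> * a j)"
      using gain_bounds(1,2)[of j x] \<gamma>_pos by (simp add: abs_mult)
    finally show ?thesis by simp
  qed
  note W1 = noise_average_mean[of F1, OF _ F1, of j]
  note W2 = noise_average_covariance[of F2, OF _ F2, of j j]
  have dev: "integrable MX (\<lambda>x. t j - S j x)" using S_integrable by auto
  have F0int: "integrable MX F0"
    unfolding F0_def[abs_def]
    by (intro Bochner_Integration.integrable_diff integrable_mult_right bias_covariance(1) dev)
  note F0P = integral_fst_only[OF F0int]
  have "gap_term j = (\<lambda>z. gap_rest j z + noise_cross j z)" using gap_term_split by (simp add: fun_eq_iff)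
  then show "integrable P (gap_term j)" by (simp add: gap_rest_expectation(1) noise_cross_integrable)
  have "0 \<le> (l j)\<^sup>2 / 2 * (\<integral>x. (t j - S j x) / (1 + a j * S j x)\<^sup>2 \<partial>MX)"
    using bias_covariance(2)[of j] by simp
  also have "\<dots> = (\<integral>x. F0 x \<partial>MX)"
  proof -
    have dev0: "(\<integral>x. (t j - S j x) \<partial>MX) = 0" using S_integrable[of j] S_mean[of j] by (simp add: M1.prob_space)
    have "(\<integral>x. F0 x \<partial>MX) = (\<integral>x. (l j)\<^sup>2 / 2 * ((t j - S j x) / (1 + a j * S j x)\<^sup>2) \<partial>MX)
        - (\<integral>x. (l j)\<^sup>2 / 2 * (t j - S j x) \<partial>MX)"
      unfolding F0_def[abs_def]
      by (intro Bochner_Integration.integral_diff integrable_mult_right bias_covariance(1) dev)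
    then show ?thesis unfolding integral_mult_right_zero dev0 by simp
  qed
  finally have F0nn: "0 \<le> (\<integral>x. F0 x \<partial>MX)" .
  have F2S: "\<gamma>\<^sup>2 / 2 * (a j * S j x / (1 + a j * S j x)) \<le> F2 x * S j x" for x
  proof -
    define r where "r = a j * S j x / (1 + a j * S j x)"
    have r: "0 \<le> r" "r \<le> 1" unfolding r_def by (rule shrinkage_bounds)+
    have gS: "gain j x * S j x = \<gamma> * r" by (simp add: gain_def r_def)
    \<comment> \<open>Only the negative part of \<open>t - S\<close> does harm: it costs \<open>r\<^sup>2 / 2 \<le> r / 2\<close> out of \<open>r\<close>.\<close>
    have "- (r * r) \<le> (a j * t j / (1 + a j * S j x)) * r - r * r"
      using r t_pos[of j] a_pos[of j] one_v_pos(1)[of j x] by simp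
    also have "\<dots> = (t j - S j x) * (a j / (1 + a j * S j x)) * r"
      by (simp add: r_def diff_divide_distrib algebra_simps)
    finally have "- r \<le> (t j - S j x) * (a j / (1 + a j * S j x)) * r"
      using mult_left_mono[OF r(2,1)] by linarith
    then have "1 / 2 * r \<le> 1 / 2 * ((t j - S j x) * (a j / (1 + a j * S j x)) * r) + r" by linarith
    then have "\<gamma>\<^sup>2 * (1 / 2 * r) \<le> \<gamma>\<^sup>2 * (1 / 2 * ((t j - S j x) * (a j / (1 + a j * S j x)) * r) + r)"
      by (rule mult_left_mono) simp
    also have "\<dots> = 1 / 2 * (t j - S j x) * gain j x * (\<gamma> * r) + \<gamma> * (\<gamma> * r)"
    proof -
      have "\<gamma>\<^sup>2 * (1 / 2 * (d * q * r) + r) = 1 / 2 * d * (\<gamma> * q) * (\<gamma> * r) + \<gamma> * (\<gamma> * r)" for d q :: real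
        by (simp add: power2_eq_square distrib_left mult_ac)
      then show ?thesis unfolding gain_def times_divide_eq_right[symmetric, of \<gamma>] .
    qed
    also have "\<dots> = F2 x * S j x"
      unfolding gS[symmetric] by (simp add: F2_def power2_eq_square algebra_simps)
    finally show ?thesis unfolding r_def by simp
  qed
  have "(\<integral>z. gap_term j z \<partial>P) = (\<integral>z. gap_rest j z \<partial>P)"
    unfolding gap_term_split
    by (subst Bochner_Integration.integral_add) (simp_all add: gap_rest_expectation(1) noise_cross_integrable noise_cross_mean)
  also have "\<dots> = (\<integral>z. F0 (fst z) + F1 (fst z) * W j z \<partial>P) + (\<integral>z. F2 (fst z) * (W j z * W j z) \<partial>P)"
    unfolding rest by (intro Bochner_Integration.integral_add Bochner_Integration.integrable_add F0P(1) W1(1) W2(1)) measurable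
  also have "(\<integral>z. F0 (fst z) + F1 (fst z) * W j z \<partial>P) = (\<integral>z. F0 (fst z) \<partial>P) + (\<integral>z. F1 (fst z) * W j z \<partial>P)"
    by (intro Bochner_Integration.integral_add F0P(1) W1(1)) measurable
  also have "\<dots> = (\<integral>x. F0 x \<partial>MX)" using F0P(2) W1(2) by simp
  also have "(\<integral>z. F2 (fst z) * (W j z * W j z) \<partial>P) = (\<integral>x. F2 x * S j x \<partial>MX) / real N"
    using W2(2) by simp
  finally have E: "(\<integral>z. gap_term j z \<partial>P) = (\<integral>x. F0 x \<partial>MX) + (\<integral>x. F2 x * S j x \<partial>MX) / real N" .
  have "(\<integral>x. \<gamma>\<^sup>2 / 2 * (a j * S j x / (1 + a j * S j x)) \<partial>MX) \<le> (\<integral>x. F2 x * S j x \<partial>MX)"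
    by (intro integral_mono F2S integrable_mult_right shrinkage_integrable bounded_mult_integrable[OF _ F2] S_integrable) measurable
  then have "\<gamma>\<^sup>2 / 2 * (\<integral>x. a j * S j x / (1 + a j * S j x) \<partial>MX) / real N \<le> (\<integral>x. F2 x * S j x \<partial>MX) / real N"
    unfolding integral_mult_right_zero by (intro divide_right_mono) auto
  then show "\<gamma>\<^sup>2 / (2 * real N) * (\<integral>x. a j * S j x / (1 + a j * S j x) \<partial>MX) \<le> (\<integral>z. gap_term j z \<partial>P)"
    using E F0nn by simp
qed

lemma summable_min: "summable (\<lambda>j. min 1 (a j * t j))"
  by (rule summable_comparison_test'[OF sum_at, of 0]) (use a_pos t_pos in \<open>auto simp: less_imp_le\<close>)

text \<open>
  Both bounds are explicit in \<open>N\<close>. The lower bound needs a sample large enough for \<open>S \<ge> t / 2\<close> to have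
  probability at least one half.
\<close>

theorem gap_series:
  shows gap_series_integrable: "integrable P (\<lambda>z. \<Sum>j. gap_term j z)"
    and gap_series_upper: "(\<integral>z. \<bar>\<Sum>j. gap_term j z\<bar> \<partial>P) \<le>
      (3 / 2 * sqrt K * (\<Sum>j. (l j)\<^sup>2 * t j) + \<gamma> * sqrt (\<Sum>j. (l j)\<^sup>2 * t j)) / sqrt (real N)
      + 4 * \<gamma>\<^sup>2 / real N * ((\<Sum>j. min 1 (a j * t j)) + K / real N * (\<Sum>j. a j * t j))"
    and gap_series_lower: "8 * K \<le> real N \<Longrightarrow>
      \<gamma>\<^sup>2 / (12 * real N) * (\<Sum>j<n. min 1 (a j * t j)) \<le> (\<integral>z. (\<Sum>j. gap_term j z) \<partial>P)"
proof -
  let ?A = "\<Sum>j. (l j)\<^sup>2 * t j"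
  let ?b = "\<lambda>j. 3 / 2 * ((l j)\<^sup>2 * t j * sqrt (K / real N))
     + \<gamma>\<^sup>2 / real N * (4 * min 1 (a j * t j) + 4 * (K / real N) * (a j * t j))"
  have bsums: "?b sums (3 / 2 * (?A * sqrt (K / real N))
     + \<gamma>\<^sup>2 / real N * (4 * (\<Sum>j. min 1 (a j * t j)) + 4 * (K / real N) * (\<Sum>j. a j * t j)))"
    by (intro sums_add sums_mult sums_mult2 summable_sums sum_lt sum_at summable_min)
  have rest_le: "(\<integral>z. \<bar>gap_rest j z\<bar> \<partial>P) \<le> ?b j" for j
    using gap_rest_expectation(2)[of j] by (simp add: mult.assoc)
  have rest_sum: "summable (\<lambda>j. \<integral>z. \<bar>gap_rest j z\<bar> \<partial>P)"
    by (rule summable_comparison_test'[OF sums_summable[OF bsums], of 0]) (use rest_le in auto)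
  have rest_ae: "AE z in P. summable (\<lambda>j. \<bar>gap_rest j z\<bar>)"
    by (rule AE_summable_of_summable_integrals[OF integrable_abs[OF gap_rest_expectation(1)] rest_sum]) simp
  have term_sum: "summable (\<lambda>j. \<integral>z. \<bar>gap_term j z\<bar> \<partial>P)"
  proof (rule summable_comparison_test'[OF summable_add[OF rest_sum noise_cross_sum(4)], of 0])
    fix j
    have "(\<integral>z. \<bar>gap_term j z\<bar> \<partial>P) \<le> (\<integral>z. \<bar>gap_rest j z\<bar> + \<bar>noise_cross j z\<bar> \<partial>P)"
      by (intro integral_mono integrable_abs Bochner_Integration.integrable_add gap_term_expectation(1)
          gap_rest_expectation(1) noise_cross_integrable) (simp add: gap_term_split)
    also have "\<dots> = (\<integral>z. \<bar>gap_rest j z\<bar> \<partial>P) + (\<integral>z. \<bar>noise_cross j z\<bar> \<partial>P)"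
      by (intro Bochner_Integration.integral_add integrable_abs gap_rest_expectation(1) noise_cross_integrable)
    finally show "norm (\<integral>z. \<bar>gap_term j z\<bar> \<partial>P) \<le> (\<integral>z. \<bar>gap_rest j z\<bar> \<partial>P) + (\<integral>z. \<bar>noise_cross j z\<bar> \<partial>P)"
      by simp
  qed
  note series = integral_suminf_of_summable_abs[OF gap_term_expectation(1) term_sum]
  show int: "integrable P (\<lambda>z. \<Sum>j. gap_term j z)" by (rule series(1))
  have rest_abs: "integrable P (\<lambda>z. \<bar>gap_rest j z\<bar>)" for j by (intro integrable_abs gap_rest_expectation(1))
  have rest_sum': "summable (\<lambda>j. \<integral>z. \<bar>\<bar>gap_rest j z\<bar>\<bar> \<partial>P)"
    unfolding abs_idempotent by (rule rest_sum)
  note rest_series = integral_suminf_of_summable_abs[where f = "\<lambda>j z. \<bar>gap_rest j z\<bar>", OF rest_abs rest_sum']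
  have "(\<integral>z. \<bar>\<Sum>j. gap_term j z\<bar> \<partial>P) \<le> (\<integral>z. (\<Sum>j. \<bar>gap_rest j z\<bar>) + \<bar>\<Sum>j. noise_cross j z\<bar> \<partial>P)"
  proof (rule integral_mono_AE)
    show "integrable P (\<lambda>z. \<bar>\<Sum>j. gap_term j z\<bar>)" by (rule integrable_abs[OF int])
    show "integrable P (\<lambda>z. (\<Sum>j. \<bar>gap_rest j z\<bar>) + \<bar>\<Sum>j. noise_cross j z\<bar>)"
      by (rule Bochner_Integration.integrable_add[OF rest_series(1) integrable_abs[OF noise_cross_sum(1)]])
    show "AE z in P. \<bar>\<Sum>j. gap_term j z\<bar> \<le> (\<Sum>j. \<bar>gap_rest j z\<bar>) + \<bar>\<Sum>j. noise_cross j z\<bar>"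
      using rest_ae noise_cross_sum(2)
    proof eventually_elim
      case (elim z)
      have "(\<Sum>j. gap_term j z) = (\<Sum>j. gap_rest j z) + (\<Sum>j. noise_cross j z)"
        unfolding gap_term_split by (rule suminf_add[OF summable_rabs_cancel[OF elim(1)] elim(2), symmetric])
      moreover note summable_rabs[OF elim(1)] abs_triangle_ineq[of "\<Sum>j. gap_rest j z" "\<Sum>j. noise_cross j z"]
      ultimately show ?case by linarith
    qed
  qed
  also have "\<dots> = (\<integral>z. (\<Sum>j. \<bar>gap_rest j z\<bar>) \<partial>P) + (\<integral>z. \<bar>\<Sum>j. noise_cross j z\<bar> \<partial>P)"
    by (rule Bochner_Integration.integral_add[OF rest_series(1) integrable_abs[OF noise_cross_sum(1)]])
  also have "(\<integral>z. (\<Sum>j. \<bar>gap_rest j z\<bar>) \<partial>P) = (\<Sum>j. \<integral>z. \<bar>gap_rest j z\<bar> \<partial>P)" by (rule rest_series(2))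
  also have "\<dots> \<le> (\<Sum>j. ?b j)"
    by (intro suminf_le rest_le rest_sum sums_summable[OF bsums])
  also have "\<dots> = 3 / 2 * (?A * sqrt (K / real N))
     + \<gamma>\<^sup>2 / real N * (4 * (\<Sum>j. min 1 (a j * t j)) + 4 * (K / real N) * (\<Sum>j. a j * t j))"
    using bsums by (rule sums_unique[symmetric])
  finally have "(\<integral>z. \<bar>\<Sum>j. gap_term j z\<bar> \<partial>P) \<le> 3 / 2 * (?A * sqrt (K / real N))
     + \<gamma>\<^sup>2 / real N * (4 * (\<Sum>j. min 1 (a j * t j)) + 4 * (K / real N) * (\<Sum>j. a j * t j))
     + \<gamma> / sqrt (real N) * sqrt ?A"
    using noise_cross_sum(3) by simp
  also have "\<dots> = (3 / 2 * sqrt K * ?A + \<gamma> * sqrt ?A) / sqrt (real N)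
      + 4 * \<gamma>\<^sup>2 / real N * ((\<Sum>j. min 1 (a j * t j)) + K / real N * (\<Sum>j. a j * t j))"
    by (simp add: real_sqrt_divide add_divide_distrib distrib_left mult_ac)
  finally show "(\<integral>z. \<bar>\<Sum>j. gap_term j z\<bar> \<partial>P) \<le> (3 / 2 * sqrt K * ?A + \<gamma> * sqrt ?A) / sqrt (real N)
      + 4 * \<gamma>\<^sup>2 / real N * ((\<Sum>j. min 1 (a j * t j)) + K / real N * (\<Sum>j. a j * t j))" .
  show "\<gamma>\<^sup>2 / (12 * real N) * (\<Sum>j<n. min 1 (a j * t j)) \<le> (\<integral>z. (\<Sum>j. gap_term j z) \<partial>P)"
    if "8 * K \<le> real N"
  proof -
    have ge: "\<gamma>\<^sup>2 / (12 * real N) * min 1 (a j * t j) \<le> (\<integral>z. gap_term j z \<partial>P)" for j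
    proof -
      have "\<gamma>\<^sup>2 / (2 * real N) * (min 1 (a j * t j) / 6) \<le> \<gamma>\<^sup>2 / (2 * real N) * (\<integral>x. a j * S j x / (1 + a j * S j x) \<partial>MX)"
        using that N_pos by (intro mult_left_mono shrinkage_ge) auto
      also note gap_term_expectation(2)
      finally show ?thesis by simp
    qed
    have nn: "0 \<le> (\<integral>z. gap_term j z \<partial>P)" for j
      by (rule order_trans[OF _ ge]) (use a_pos[of j] t_pos[of j] in \<open>simp add: less_imp_le\<close>)
    have "\<gamma>\<^sup>2 / (12 * real N) * (\<Sum>j<n. min 1 (a j * t j)) \<le> (\<Sum>j<n. \<integral>z. gap_term j z \<partial>P)"
      unfolding sum_distrib_left by (intro sum_mono ge)
    also have "\<dots> \<le> (\<Sum>j. \<integral>z. gap_term j z \<partial>P)"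
      by (intro sum_le_suminf series(3) nn) auto
    finally show ?thesis unfolding series(2) .
  qed
qed

end

section \<open>Samples and white noise as product measures\<close>

context prob_space
begin

lemma integral_PiM_coordinate:
  fixes f :: "'a \<Rightarrow> real"
  assumes i: "i \<in> I" and f: "integrable M f"
  shows "integrable (\<Pi>\<^sub>M i\<in>I. M) (\<lambda>\<omega>. f (\<omega> i))" "(\<integral>\<omega>. f (\<omega> i) \<partial>(\<Pi>\<^sub>M i\<in>I. M)) = expectation f"
proof -
  have D: "distr (\<Pi>\<^sub>M i\<in>I. M) M (\<lambda>\<omega>. \<omega> i) = M"
    by (rule distr_PiM_component[OF _ i]) (rule prob_space_axioms)
  have m: "(\<lambda>\<omega>. \<omega> i) \<in> measurable (\<Pi>\<^sub>M i\<in>I. M) M" using i by simp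
  have fm: "f \<in> borel_measurable M" using f by auto
  show "integrable (\<Pi>\<^sub>M i\<in>I. M) (\<lambda>\<omega>. f (\<omega> i))"
    using f unfolding integrable_distr_eq[OF m fm, symmetric] D .
  show "(\<integral>\<omega>. f (\<omega> i) \<partial>(\<Pi>\<^sub>M i\<in>I. M)) = expectation f"
    unfolding integral_distr[OF m fm, symmetric] D ..
qed

text \<open>
  The index set may be infinite, as it is for the noise, so the independence of coordinates is derived
  from the characterization of independence by the joint law.
\<close>

lemma integral_PiM_coordinate_product:
  fixes f h :: "'a \<Rightarrow> real"
  assumes ij: "i \<in> I" "j \<in> I" "i \<noteq> j" and f: "integrable M f" and h: "integrable M h"
  shows "integrable (\<Pi>\<^sub>M i\<in>I. M) (\<lambda>\<omega>. f (\<omega> i) * h (\<omega> j))"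
    "(\<integral>\<omega>. f (\<omega> i) * h (\<omega> j) \<partial>(\<Pi>\<^sub>M i\<in>I. M)) = expectation f * expectation h"
proof -
  let ?P = "\<Pi>\<^sub>M i\<in>I. M"
  interpret P: prob_space ?P by (rule prob_space_PiM) (rule prob_space_axioms)
  have fm: "f \<in> borel_measurable M" "h \<in> borel_measurable M" using f h by auto
  have comp: "distr ?P M (\<lambda>\<omega>. \<omega> i) = M" if "i \<in> I" for i
    by (rule distr_PiM_component[OF _ that]) (rule prob_space_axioms)
  have "distr ?P ?P (\<lambda>\<omega>. \<lambda>i\<in>I. \<omega> i) = distr ?P ?P (\<lambda>\<omega>. \<omega>)"
    by (rule distr_cong) (auto simp: space_PiM PiE_def extensional_restrict)
  also have "\<dots> = ?P" by (rule distr_id)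
  also have "\<dots> = (\<Pi>\<^sub>M i\<in>I. distr ?P M (\<lambda>\<omega>. \<omega> i))"
    by (intro PiM_cong refl) (simp add: comp)
  finally have "P.indep_vars (\<lambda>_. M) (\<lambda>i \<omega>. \<omega> i) I"
    using ij by (subst P.indep_vars_iff_distr_eq_PiM') auto
  then have "P.indep_vars (\<lambda>_. M) (\<lambda>i \<omega>. \<omega> i) {i, j}"
    by (rule P.indep_vars_subset) (use ij in auto)
  then have ind: "P.indep_vars (\<lambda>_. borel) (\<lambda>k \<omega>. (if k = i then f else h) (\<omega> k)) {i, j}"
    by (rule P.indep_vars_compose2) (use fm in auto)
  have fij: "integrable ?P (\<lambda>\<omega>. f (\<omega> i))" "(\<integral>\<omega>. f (\<omega> i) \<partial>?P) = expectation f"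
     "integrable ?P (\<lambda>\<omega>. h (\<omega> j))" "(\<integral>\<omega>. h (\<omega> j) \<partial>?P) = expectation h"
    by (rule integral_PiM_coordinate[OF ij(1) f] integral_PiM_coordinate[OF ij(2) h])+
  have int: "integrable ?P ((\<lambda>k \<omega>. (if k = i then f else h) (\<omega> k)) k)" if "k \<in> {i, j}" for k
    using that ij fij by auto
  have "integrable ?P (\<lambda>\<omega>. \<Prod>k\<in>{i, j}. (if k = i then f else h) (\<omega> k))"
    by (rule P.indep_vars_integrable[OF _ ind]) (use int in auto)
  then show "integrable ?P (\<lambda>\<omega>. f (\<omega> i) * h (\<omega> j))" using ij by simp
  have "(\<integral>\<omega>. (\<Prod>k\<in>{i, j}. (if k = i then f else h) (\<omega> k)) \<partial>?P) = (\<Prod>k\<in>{i, j}. \<integral>\<omega>. (if k = i then f else h) (\<omega> k) \<partial>?P)"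
    by (rule P.indep_vars_lebesgue_integral[OF _ ind]) (use int in auto)
  then show "(\<integral>\<omega>. f (\<omega> i) * h (\<omega> j) \<partial>?P) = expectation f * expectation h"
    using ij fij by simp
qed

lemma variance_sample_mean:
  fixes f :: "'a \<Rightarrow> real"
  assumes fm: "f \<in> borel_measurable M" and sq: "integrable M (\<lambda>x. (f x)\<^sup>2)" and mean: "expectation f = 0"
    and N: "0 < N"
  shows "integrable (\<Pi>\<^sub>M n\<in>{..<N}. M) (\<lambda>X. (1 / real N * (\<Sum>n<N. f (X n)))\<^sup>2)"
    and "(\<integral>X. (1 / real N * (\<Sum>n<N. f (X n)))\<^sup>2 \<partial>(\<Pi>\<^sub>M n\<in>{..<N}. M)) = expectation (\<lambda>x. (f x)\<^sup>2) / real N"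
proof -
  let ?P = "\<Pi>\<^sub>M n\<in>{..<N}. M"
  have f: "integrable M f" by (rule expectation_abs_le_sqrt(1)[OF fm sq])
  have eq: "(1 / real N * (\<Sum>n<N. f (X n)))\<^sup>2 = 1 / (real N)\<^sup>2 * (\<Sum>n<N. \<Sum>m<N. f (X n) * f (X m))" for X
    by (simp add: power_mult_distrib power_divide power2_eq_square sum_product)
  have nm: "integrable ?P (\<lambda>X. f (X n) * f (X m))"
    "(\<integral>X. f (X n) * f (X m) \<partial>?P) = (if n = m then expectation (\<lambda>x. (f x)\<^sup>2) else 0)" if "n < N" "m < N" for n m
    using integral_PiM_coordinate[of n "{..<N}", OF _ sq] integral_PiM_coordinate_product[of n "{..<N}" m, OF _ _ _ f f] that mean
    by (cases "n = m"; simp add: power2_eq_square)+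
  show "integrable ?P (\<lambda>X. (1 / real N * (\<Sum>n<N. f (X n)))\<^sup>2)"
    unfolding eq by (intro integrable_mult_right Bochner_Integration.integrable_sum nm) auto
  have "(\<integral>X. (\<Sum>n<N. \<Sum>m<N. f (X n) * f (X m)) \<partial>?P) = (\<Sum>n<N. \<integral>X. (\<Sum>m<N. f (X n) * f (X m)) \<partial>?P)"
    by (intro Bochner_Integration.integral_sum Bochner_Integration.integrable_sum nm(1)) auto
  also have "\<dots> = (\<Sum>n<N. \<Sum>m<N. \<integral>X. f (X n) * f (X m) \<partial>?P)"
    by (intro sum.cong refl Bochner_Integration.integral_sum nm(1)) auto
  also have "\<dots> = (\<Sum>n<N. \<Sum>m<N. if n = m then expectation (\<lambda>x. (f x)\<^sup>2) else 0)"
    by (intro sum.cong refl nm(2)) auto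
  also have "\<dots> = real N * expectation (\<lambda>x. (f x)\<^sup>2)" by simp
  finally show "(\<integral>X. (1 / real N * (\<Sum>n<N. f (X n)))\<^sup>2 \<partial>?P) = expectation (\<lambda>x. (f x)\<^sup>2) / real N"
    unfolding eq integral_mult_right_zero using N by (simp add: power2_eq_square)
qed

end

lemma std_gaussian_moments:
  shows prob_space_std_gaussian: "prob_space std_gaussian"
    and sets_std_gaussian: "sets std_gaussian = sets borel"
    and std_gaussian_integrable: "integrable std_gaussian (\<lambda>x. x)" "integrable std_gaussian (\<lambda>x. x\<^sup>2)"
    and std_gaussian_mean: "(\<integral>x. x \<partial>std_gaussian) = 0"
    and std_gaussian_variance: "(\<integral>x. x\<^sup>2 \<partial>std_gaussian) = 1"
proof -
  have "real_distribution std_gaussian" using real_dist_normal_dist by (simp add: std_gaussian_def)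
  then show "prob_space std_gaussian" "sets std_gaussian = sets borel"
    by (auto simp: real_distribution_def real_distribution_axioms_def)
  show "integrable std_gaussian (\<lambda>x. x)" "integrable std_gaussian (\<lambda>x. x\<^sup>2)"
    using integrable_std_normal_distribution_moment[of 1] integrable_std_normal_distribution_moment[of 2]
    by (simp_all add: std_gaussian_def)
  show "(\<integral>x. x \<partial>std_gaussian) = 0" "(\<integral>x. x\<^sup>2 \<partial>std_gaussian) = 1"
    using integral_std_normal_distribution_moment_odd[of 1] std_normal_distribution_even_moments(1)[of 1]
    by (simp_all add: std_gaussian_def fact_numeral)
qed

lemma gaussian_white_noise:
  fixes I :: "'i set"
  defines "Q \<equiv> \<Pi>\<^sub>M i\<in>I. std_gaussian"
  assumes i: "i \<in> I"
  shows "(\<lambda>y. y i) \<in> borel_measurable Q" "integrable Q (\<lambda>y. (y i)\<^sup>2)" "integrable Q (\<lambda>y. y i)"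
    "(\<integral>y. y i \<partial>Q) = 0" "j \<in> I \<Longrightarrow> (\<integral>y. y i * y j \<partial>Q) = (if i = j then 1 else 0)"
proof -
  interpret G: prob_space std_gaussian by (rule prob_space_std_gaussian)
  have [measurable_cong]: "sets std_gaussian = sets borel" by (rule sets_std_gaussian)
  note s = G.integral_PiM_coordinate[OF i std_gaussian_integrable(1)] G.integral_PiM_coordinate[OF i std_gaussian_integrable(2)]
  show "(\<lambda>y. y i) \<in> borel_measurable Q" unfolding Q_def using i by measurable
  show "integrable Q (\<lambda>y. (y i)\<^sup>2)" "integrable Q (\<lambda>y. y i)" "(\<integral>y. y i \<partial>Q) = 0"
    unfolding Q_def using s(3) s(1) s(2)[unfolded std_gaussian_mean] by (simp_all only:)
  show "(\<integral>y. y i * y j \<partial>Q) = (if i = j then 1 else 0)" if "j \<in> I"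
  proof (cases "i = j")
    case True
    then show ?thesis using s(4) unfolding Q_def std_gaussian_variance by (simp add: power2_eq_square)
  next
    case False
    then show ?thesis
      using G.integral_PiM_coordinate_product(2)[OF i that False std_gaussian_integrable(1) std_gaussian_integrable(1)]
      unfolding Q_def std_gaussian_mean by simp
  qed
qed

section \<open>The loss as an absolutely convergent series\<close>

text \<open>
  Absolute summability of the coefficients makes the vector series converge in norm, so that the norm
  of the sum is the limit of the norms of the orthonormal partial sums.
\<close>

lemma norm_diag_op_sums:
  fixes \<phi> :: "nat \<Rightarrow> 'a::{real_inner, banach}"
  assumes on: "\<And>i j. \<phi> i \<bullet> \<phi> j = (if i = j then 1 else 0)"
    and sum: "summable (\<lambda>j. \<bar>l j * (\<phi> j \<bullet> x)\<bar>)"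
  shows "(\<lambda>j. (l j * (\<phi> j \<bullet> x))\<^sup>2) sums (norm (diag_op \<phi> l x))\<^sup>2"
proof -
  let ?c = "\<lambda>j. l j * (\<phi> j \<bullet> x)"
  have "norm (\<phi> j) = 1" for j using on[of j j] by (simp add: norm_eq_sqrt_inner)
  then have "summable (\<lambda>j. norm (?c j *\<^sub>R \<phi> j))" using sum by simp
  then have "summable (\<lambda>j. ?c j *\<^sub>R \<phi> j)" by (rule summable_norm_cancel)
  then have "(\<lambda>n. \<Sum>j<n. ?c j *\<^sub>R \<phi> j) \<longlonglongrightarrow> diag_op \<phi> l x"
    unfolding diag_op_def by (rule summable_LIMSEQ)
  then have "(\<lambda>n. (norm (\<Sum>j<n. ?c j *\<^sub>R \<phi> j))\<^sup>2) \<longlonglongrightarrow> (norm (diag_op \<phi> l x))\<^sup>2"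
    by (intro tendsto_power tendsto_norm)
  moreover have "(norm (\<Sum>j<n. ?c j *\<^sub>R \<phi> j))\<^sup>2 = (\<Sum>j<n. (?c j)\<^sup>2)" for n
    unfolding power2_norm_eq_inner inner_sum_left inner_sum_right inner_scaleR_left inner_scaleR_right on
    by (simp add: power2_eq_square if_distrib[of "\<lambda>z. _ * z"] cong: if_cong)
  ultimately show ?thesis by (simp add: sums_def)
qed

text \<open>
  The data are substituted as truth plus noise. The noise part of the pairing has its own hypothesis:
  for white noise \<open>e\<close> it does not follow from the other two by the Cauchy-Schwarz inequality.
\<close>

lemma loss_sums:
  fixes \<phi> :: "nat \<Rightarrow> 'a::{real_inner, banach}"
  assumes on: "\<And>i j. \<phi> i \<bullet> \<phi> j = (if i = j then 1 else 0)"
    and s1: "summable (\<lambda>j. \<bar>l j * (\<phi> j \<bullet> x)\<bar>)"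
    and s2: "summable (\<lambda>j. (k j * (\<phi> j \<bullet> x))\<^sup>2)"
    and s3: "summable (\<lambda>j. \<bar>l j * ((\<phi> j \<bullet> x) * e j)\<bar>)"
  shows "(\<lambda>j. 1 / 2 * (l j * (\<phi> j \<bullet> x))\<^sup>2 - ((l j * (\<phi> j \<bullet> x)) * (k j * (\<phi> j \<bullet> x)) + \<gamma> * (l j * ((\<phi> j \<bullet> x) * e j))))
    sums loss \<phi> l x (\<lambda>j. (\<phi> j \<bullet> x) * k j + \<gamma> * e j)"
proof -
  note sq = norm_diag_op_sums[OF on s1]
  have "summable (\<lambda>j. 1 / 2 * ((l j * (\<phi> j \<bullet> x))\<^sup>2 + (k j * (\<phi> j \<bullet> x))\<^sup>2))"
    by (intro summable_mult summable_add sums_summable[OF sq] s2)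
  then have "summable (\<lambda>j. (l j * (\<phi> j \<bullet> x)) * (k j * (\<phi> j \<bullet> x)))"
    by (rule summable_comparison_test'[of _ 0]) (simp only: real_norm_def abs_mult_le_squares)
  then have "summable (\<lambda>j. (l j * (\<phi> j \<bullet> x)) * (k j * (\<phi> j \<bullet> x)) + \<gamma> * (l j * ((\<phi> j \<bullet> x) * e j)))"
    by (rule summable_add[OF _ summable_mult[OF summable_rabs_cancel[OF s3]]])
  then have "(\<lambda>j. (l j * (\<phi> j \<bullet> x)) * (k j * (\<phi> j \<bullet> x)) + \<gamma> * (l j * ((\<phi> j \<bullet> x) * e j)))
      sums (\<Sum>j. l j * ((\<phi> j \<bullet> x) * k j + \<gamma> * e j) * (\<phi> j \<bullet> x))"
    by (simp add: summable_sums algebra_simps)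
  then show ?thesis unfolding loss_def by (intro sums_diff sums_mult sq)
qed

lemma measurable_loss:
  fixes \<phi> :: "nat \<Rightarrow> 'a::{real_inner, banach, second_countable_topology}"
  assumes [measurable]: "\<And>j. (\<lambda>w. l w j) \<in> borel_measurable M" "x \<in> borel_measurable M"
    "\<And>j. (\<lambda>w. y w j) \<in> borel_measurable M"
  shows "(\<lambda>w. loss \<phi> (l w) (x w) (y w)) \<in> borel_measurable M"
  unfolding loss_def diag_op_def by measurable

section \<open>Learning a diagonal operator from finitely many samples\<close>

text \<open>
  The learning problem at a fixed sample size, with the assumptions on exponents and on the
  Karhunen-Loeve expansion replaced by their consequences: a fourth moment bound that is uniform over the
  coordinates, and two summability conditions.
\<close>

locale operator_regression =
  fixes \<phi> :: "nat \<Rightarrow> 'a::{real_inner, banach, second_countable_topology}"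
    and \<nu> :: "'a measure" and \<gamma> K :: real and ldag \<sigma> :: "nat \<Rightarrow> real" and N :: nat
  assumes orthonormal: "\<And>i j. \<phi> i \<bullet> \<phi> j = (if i = j then 1 else 0)"
    and train: "training_distribution \<phi> \<nu>"
    and N_pos: "0 < N" and K_nonneg: "0 \<le> K" and noise_pos: "0 < \<gamma>"
    and prior_pos: "\<And>j. 0 < (\<sigma> j)\<^sup>2"
    and variance_pos: "\<And>j. 0 < \<phi> j \<bullet> covariance \<nu> (\<phi> j)"
    and fourth_int: "\<And>j. integrable \<nu> (\<lambda>x. (\<phi> j \<bullet> x) ^ 4)"
    and fourth_le: "\<And>j. (\<integral>x. (\<phi> j \<bullet> x) ^ 4 \<partial>\<nu>) \<le> K * (\<phi> j \<bullet> covariance \<nu> (\<phi> j))\<^sup>2"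
    and truth_sum: "summable (\<lambda>j. (ldag j)\<^sup>2 * (\<phi> j \<bullet> covariance \<nu> (\<phi> j)))"
    and prior_sum: "summable (\<lambda>j. (\<sigma> j)\<^sup>2 * (\<phi> j \<bullet> covariance \<nu> (\<phi> j)))"
begin

abbreviation t where "t j \<equiv> \<phi> j \<bullet> covariance \<nu> (\<phi> j)"

abbreviation a where "a j \<equiv> real N * inverse (\<gamma>\<^sup>2) * (\<sigma> j)\<^sup>2"

abbreviation MX where "MX \<equiv> \<Pi>\<^sub>M n\<in>{..<N}. \<nu>"

abbreviation MQ where "MQ \<equiv> \<Pi>\<^sub>M i\<in>UNIV \<times> {..<N}. std_gaussian"

lemma prob_nu: "prob_space \<nu>" using train by (simp add: training_distribution_def)

lemma sets_nu[measurable_cong]: "sets \<nu> = sets borel" using train by (simp add: training_distribution_def)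

lemma second_moment: "integrable \<nu> (\<lambda>x. (\<phi> j \<bullet> x)\<^sup>2)" "(\<integral>x. (\<phi> j \<bullet> x)\<^sup>2 \<partial>\<nu>) = t j"
  using covariance_inner[OF train, of "\<phi> j" "\<phi> j"] by (simp_all add: power2_eq_square)

lemma sq_deviation:
  "integrable \<nu> (\<lambda>x. ((\<phi> j \<bullet> x)\<^sup>2 - t j)\<^sup>2)" "(\<integral>x. ((\<phi> j \<bullet> x)\<^sup>2 - t j)\<^sup>2 \<partial>\<nu>) \<le> K * (t j)\<^sup>2"
proof -
  interpret prob_space \<nu> by (rule prob_nu)
  have eq: "((\<phi> j \<bullet> x)\<^sup>2 - t j)\<^sup>2 = (\<phi> j \<bullet> x) ^ 4 - 2 * t j * (\<phi> j \<bullet> x)\<^sup>2 + (t j)\<^sup>2" for x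
    by (simp add: power2_eq_square eval_nat_numeral algebra_simps)
  show "integrable \<nu> (\<lambda>x. ((\<phi> j \<bullet> x)\<^sup>2 - t j)\<^sup>2)"
    unfolding eq
    by (intro Bochner_Integration.integrable_add Bochner_Integration.integrable_diff fourth_int
        integrable_mult_right second_moment(1) integrable_const)
  have "(\<integral>x. ((\<phi> j \<bullet> x)\<^sup>2 - t j)\<^sup>2 \<partial>\<nu>) = (\<integral>x. (\<phi> j \<bullet> x) ^ 4 \<partial>\<nu>) - 2 * t j * t j + (t j)\<^sup>2"
    unfolding eq using fourth_int[of j] second_moment[of j] by (simp add: prob_space)
  also have "\<dots> = (\<integral>x. (\<phi> j \<bullet> x) ^ 4 \<partial>\<nu>) - (t j)\<^sup>2" by (simp add: power2_eq_square)
  also have "\<dots> \<le> K * (t j)\<^sup>2"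
    using fourth_le[of j] zero_le_power2[of "t j"] by linarith
  finally show "(\<integral>x. ((\<phi> j \<bullet> x)\<^sup>2 - t j)\<^sup>2 \<partial>\<nu>) \<le> K * (t j)\<^sup>2" .
qed

sublocale R: sequence_regression MX MQ "\<lambda>j n X. \<phi> j \<bullet> X n" "\<lambda>j n \<Xi>. \<Xi> (j, n)" N K \<gamma> t a ldag
proof -
  interpret nu: prob_space \<nu> by (rule prob_nu)
  interpret G: prob_space std_gaussian by (rule prob_space_std_gaussian)
  interpret X: prob_space MX by (rule prob_space_PiM) (rule prob_nu)
  interpret Q: prob_space MQ by (rule prob_space_PiM) (rule prob_space_std_gaussian)
  interpret XQ: pair_prob_space MX MQ ..
  have S_eq: "1 / real N * (\<Sum>n<N. (\<phi> j \<bullet> X n)\<^sup>2) - t j = 1 / real N * (\<Sum>n<N. (\<phi> j \<bullet> X n)\<^sup>2 - t j)" for j X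
    using N_pos by (simp add: sum_subtractf field_simps)
  have mean: "nu.expectation (\<lambda>x. (\<phi> j \<bullet> x)\<^sup>2 - t j) = 0" for j
    using second_moment[of j] by (simp add: nu.prob_space)
  have meas: "(\<lambda>x. (\<phi> j \<bullet> x)\<^sup>2 - t j) \<in> borel_measurable \<nu>" for j by measurable
  note var = nu.variance_sample_mean[OF meas sq_deviation(1) mean N_pos]
  have at: "summable (\<lambda>j. a j * t j)"
    using summable_mult[OF prior_sum, of "real N * inverse (\<gamma>\<^sup>2)"] by (simp add: mult_ac)
  have mem: "(j, n) \<in> UNIV \<times> {..<N}" if "n < N" for j n using that by simp
  have gm: "(\<lambda>X. \<phi> j \<bullet> X n) \<in> borel_measurable MX" if "n < N" for j n
  proof (rule measurable_compose[where N = \<nu>])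
    show "(\<lambda>X. X n) \<in> measurable MX \<nu>" using that by (intro measurable_component_singleton) simp
  qed measurable
  have g2: "integrable MX (\<lambda>x. (\<phi> j \<bullet> x n)\<^sup>2)" "X.expectation (\<lambda>x. (\<phi> j \<bullet> x n)\<^sup>2) = t j" if "n < N" for j n
    using nu.integral_PiM_coordinate[OF _ second_moment(1), of n "{..<N}" j] that unfolding second_moment(2) by simp_all
  have v2: "X.expectation (\<lambda>x. (1 / real N * (\<Sum>n<N. (\<phi> j \<bullet> x n)\<^sup>2) - t j)\<^sup>2) \<le> K / real N * (t j)\<^sup>2" for j
    unfolding S_eq var(2) using divide_right_mono[OF sq_deviation(2), of "real N" j] by simp
  have a_pos: "0 < a j" for j using N_pos noise_pos prior_pos[of j] by simp
  show "sequence_regression MX MQ (\<lambda>j n X. \<phi> j \<bullet> X n) (\<lambda>j n \<Xi>. \<Xi> (j, n)) N K \<gamma> t a ldag"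
  proof (unfold_locales, goal_cases)
    case (9 j) show ?case unfolding S_eq by (rule var(1))
  next
    case (11 j n) then show ?case by (intro gaussian_white_noise(1) mem)
  next
    case (12 j n) then show ?case by (intro gaussian_white_noise(2) mem)
  next
    case (13 j n) then show ?case by (intro gaussian_white_noise(4) mem)
  next
    case (14 i j n m)
    then have "(i, n) \<in> UNIV \<times> {..<N}" "(j, m) \<in> UNIV \<times> {..<N}" by auto
    from gaussian_white_noise(5)[OF this] show ?case by simp
  qed (use N_pos K_nonneg noise_pos variance_pos a_pos gm g2 v2 at truth_sum in auto)
qed

section \<open>The expected risk as a series\<close>

lemma observe_pair_measurable:
  "(\<lambda>(x, \<xi>). (x, \<lambda>j. (\<phi> j \<bullet> x) * ldag j + \<gamma> * \<xi> j))
    \<in> measurable (\<nu> \<Otimes>\<^sub>M (\<Pi>\<^sub>M j\<in>UNIV. std_gaussian)) (borel \<Otimes>\<^sub>M (\<Pi>\<^sub>M j\<in>UNIV. borel))"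
proof -
  have [measurable_cong]: "sets std_gaussian = sets borel" by (rule sets_std_gaussian)
  let ?P = "\<nu> \<Otimes>\<^sub>M (\<Pi>\<^sub>M j\<in>UNIV. std_gaussian)"
  have Y: "(\<lambda>z j. (\<phi> j \<bullet> fst z) * ldag j + \<gamma> * snd z j) \<in> measurable ?P (\<Pi>\<^sub>M j\<in>UNIV. borel)"
  proof (rule measurable_PiM_single')
    show "(\<lambda>z. (\<phi> j \<bullet> fst z) * ldag j + \<gamma> * snd z j) \<in> borel_measurable ?P" for j :: nat
      by measurable
  qed simp
  have X: "fst \<in> measurable ?P borel" by measurable
  show ?thesis unfolding case_prod_beta' by (rule measurable_Pair[OF X Y])
qed

text \<open>
  The assumption makes the series that defines the loss of a fresh pair \<open>(x, y)\<close> absolutely convergent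
  almost surely: the noise term \<open>l j * (\<phi> j \<bullet> x) * \<xi> j\<close> has first absolute moment at most
  \<open>|l j| * sqrt (t j)\<close>. It also implies that \<open>\<Sum> (l j)\<^sup>2 t j\<close> converges, since the terms are eventually
  below \<open>1\<close>. The noise term has mean zero and disappears.
\<close>

lemma expected_risk_sums:
  assumes l: "summable (\<lambda>j. \<bar>l j * sqrt (t j)\<bar>)"
  shows "(\<lambda>j. 1 / 2 * t j * (l j)\<^sup>2 - t j * (ldag j * l j)) sums expected_risk \<phi> \<nu> \<gamma> ldag l"
proof -
  let ?Q = "\<Pi>\<^sub>M j\<in>(UNIV :: nat set). std_gaussian"
  interpret nu: prob_space \<nu> by (rule prob_nu)
  interpret G: prob_space std_gaussian by (rule prob_space_std_gaussian)
  interpret Q: prob_space ?Q by (rule prob_space_PiM) (rule prob_space_std_gaussian)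
  interpret XQ: pair_prob_space \<nu> ?Q ..
  let ?P = "\<nu> \<Otimes>\<^sub>M ?Q"
  have [measurable_cong]: "sets std_gaussian = sets borel" by (rule sets_std_gaussian)
  note noise = gaussian_white_noise[where I = UNIV, OF UNIV_I]
  have g1: "integrable \<nu> (\<lambda>x. \<phi> j \<bullet> x)" "nu.expectation (\<lambda>x. \<bar>\<phi> j \<bullet> x\<bar>) \<le> sqrt (t j)" for j
    using nu.expectation_abs_le_sqrt[of "\<lambda>x. \<phi> j \<bullet> x", OF _ second_moment(1)] unfolding second_moment(2) by simp_all
  have e1: "Q.expectation (\<lambda>\<xi>. \<bar>\<xi> j\<bar>) \<le> 1" for j
    using Q.expectation_abs_le_sqrt(2)[OF noise(1,2), of j] noise(5)[of j j] by (simp add: power2_eq_square)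
  have gP: "integrable ?P (\<lambda>z. h (fst z))" "XQ.expectation (\<lambda>z. h (fst z)) = nu.expectation h"
    if "integrable \<nu> h" for h :: "'a \<Rightarrow> real"
    using XQ.integrable_product[OF that, of "\<lambda>_. 1"] XQ.integral_product[OF that, of "\<lambda>_. 1"]
    by (auto simp: Q.prob_space)
  note sqP = gP[OF second_moment(1), unfolded second_moment(2)]
  note absP = gP[OF integrable_abs[OF g1(1)]]
  note geP = XQ.integrable_product[OF g1(1) noise(3)] XQ.integral_product[OF g1(1) noise(3)]
  note geabsP = XQ.integrable_product[OF integrable_abs[OF g1(1)] integrable_abs[OF noise(3)]]
    XQ.integral_product[OF integrable_abs[OF g1(1)] integrable_abs[OF noise(3)]]
  define f where "f j z = 1 / 2 * (l j * (\<phi> j \<bullet> fst z))\<^sup>2 - ((l j * (\<phi> j \<bullet> fst z)) * (ldag j * (\<phi> j \<bullet> fst z))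
    + \<gamma> * (l j * ((\<phi> j \<bullet> fst z) * snd z j)))" for j and z :: "'a \<times> (nat \<Rightarrow> real)"
  have f_eq: "f j z = (1 / 2 * (l j)\<^sup>2 - l j * ldag j) * (\<phi> j \<bullet> fst z)\<^sup>2 - \<gamma> * l j * ((\<phi> j \<bullet> fst z) * snd z j)" for j z
    by (simp add: f_def power2_eq_square algebra_simps)
  have f_int: "integrable ?P (f j)" for j
    unfolding f_eq[abs_def] by (intro Bochner_Integration.integrable_diff integrable_mult_right sqP(1) geP(1))
  have f_mean: "XQ.expectation (f j) = 1 / 2 * t j * (l j)\<^sup>2 - t j * (ldag j * l j)" for j
  proof -
    have "XQ.expectation (f j) = XQ.expectation (\<lambda>z. (1 / 2 * (l j)\<^sup>2 - l j * ldag j) * (\<phi> j \<bullet> fst z)\<^sup>2)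
      - XQ.expectation (\<lambda>z. \<gamma> * l j * ((\<phi> j \<bullet> fst z) * snd z j))"
      unfolding f_eq[abs_def] by (intro Bochner_Integration.integral_diff integrable_mult_right sqP(1) geP(1))
    also have "\<dots> = (1 / 2 * (l j)\<^sup>2 - l j * ldag j) * t j - \<gamma> * l j * 0"
      unfolding integral_mult_right_zero sqP(2) geP(2) noise(4) by simp
    finally show ?thesis by (simp add: algebra_simps)
  qed
  have ge_le: "XQ.expectation (\<lambda>z. \<bar>\<phi> j \<bullet> fst z\<bar> * \<bar>snd z j\<bar>) \<le> sqrt (t j)" for j
  proof -
    have "nu.expectation (\<lambda>x. \<bar>\<phi> j \<bullet> x\<bar>) * Q.expectation (\<lambda>\<xi>. \<bar>\<xi> j\<bar>) \<le> sqrt (t j) * 1"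
      using variance_pos[of j] by (intro mult_mono g1 e1) (auto simp: less_imp_le)
    then show ?thesis unfolding geabsP(2) by simp
  qed
  have lt: "summable (\<lambda>j. (l j)\<^sup>2 * t j)"
  proof -
    have "eventually (\<lambda>j. \<bar>l j * sqrt (t j)\<bar> < 1) sequentially"
      using order_tendstoD(2)[OF summable_LIMSEQ_zero[OF l], of 1] by simp
    then obtain n where n: "\<And>j. j \<ge> n \<Longrightarrow> \<bar>l j * sqrt (t j)\<bar> < 1" unfolding eventually_sequentially by blast
    have "norm ((l j)\<^sup>2 * t j) \<le> \<bar>l j * sqrt (t j)\<bar>" if "j \<ge> n" for j
    proof -
      have "(l j)\<^sup>2 * t j = \<bar>l j * sqrt (t j)\<bar> * \<bar>l j * sqrt (t j)\<bar>"
        using variance_pos[of j] by (simp add: abs_mult power2_eq_square mult_ac)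
      also have "\<dots> \<le> \<bar>l j * sqrt (t j)\<bar> * 1"
        using n[OF that] by (intro mult_left_mono) auto
      finally show ?thesis using variance_pos[of j] by simp
    qed
    then show ?thesis by (rule summable_comparison_test'[OF l])
  qed
  have f_sum: "summable (\<lambda>j. XQ.expectation (\<lambda>z. \<bar>f j z\<bar>))"
  proof (rule summable_comparison_test'[of "\<lambda>j. 2 * ((l j)\<^sup>2 * t j) + (ldag j)\<^sup>2 * t j + \<gamma> * \<bar>l j * sqrt (t j)\<bar>" 0])
    show "summable (\<lambda>j. 2 * ((l j)\<^sup>2 * t j) + (ldag j)\<^sup>2 * t j + \<gamma> * \<bar>l j * sqrt (t j)\<bar>)"
      by (intro summable_add summable_mult lt truth_sum l)
    fix j
    let ?c = "2 * (l j)\<^sup>2 + (ldag j)\<^sup>2"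
    have c: "\<bar>1 / 2 * (l j)\<^sup>2 - l j * ldag j\<bar> \<le> ?c"
    proof -
      have "l j * ldag j \<le> ((l j)\<^sup>2 + (ldag j)\<^sup>2) / 2" "- (l j * ldag j) \<le> ((l j)\<^sup>2 + (ldag j)\<^sup>2) / 2"
        using sum_squares_bound[of "l j" "ldag j"] sum_squares_bound[of "l j" "- ldag j"] by simp_all
      moreover have "\<bar>1 / 2 * p - x\<bar> \<le> 2 * p + q" if "x \<le> (p + q) / 2" "- x \<le> (p + q) / 2" "0 \<le> p" "0 \<le> q"
        for x p q :: real
        using that unfolding abs_le_iff by (simp add: field_simps)
      ultimately show ?thesis by simp
    qed
    have hint: "integrable ?P (\<lambda>z. ?c * (\<phi> j \<bullet> fst z)\<^sup>2 + \<gamma> * \<bar>l j\<bar> * (\<bar>\<phi> j \<bullet> fst z\<bar> * \<bar>snd z j\<bar>))"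
      by (intro Bochner_Integration.integrable_add integrable_mult_right sqP(1) geabsP(1))
    have "XQ.expectation (\<lambda>z. \<bar>f j z\<bar>) \<le> XQ.expectation (\<lambda>z. ?c * (\<phi> j \<bullet> fst z)\<^sup>2 + \<gamma> * \<bar>l j\<bar> * (\<bar>\<phi> j \<bullet> fst z\<bar> * \<bar>snd z j\<bar>))"
    proof (rule integral_mono[OF integrable_abs[OF f_int] hint])
      fix z
      have "\<bar>f j z\<bar> \<le> \<bar>(1 / 2 * (l j)\<^sup>2 - l j * ldag j) * (\<phi> j \<bullet> fst z)\<^sup>2\<bar> + \<bar>\<gamma> * l j * ((\<phi> j \<bullet> fst z) * snd z j)\<bar>"
        unfolding f_eq by (rule abs_triangle_ineq4)
      moreover have "\<bar>(1 / 2 * (l j)\<^sup>2 - l j * ldag j) * (\<phi> j \<bullet> fst z)\<^sup>2\<bar> \<le> ?c * (\<phi> j \<bullet> fst z)\<^sup>2"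
        using mult_right_mono[OF c, of "(\<phi> j \<bullet> fst z)\<^sup>2"] by (simp add: abs_mult)
      moreover have "\<bar>\<gamma> * l j * ((\<phi> j \<bullet> fst z) * snd z j)\<bar> = \<gamma> * \<bar>l j\<bar> * (\<bar>\<phi> j \<bullet> fst z\<bar> * \<bar>snd z j\<bar>)"
        using noise_pos by (simp add: abs_mult)
      ultimately show "\<bar>f j z\<bar> \<le> ?c * (\<phi> j \<bullet> fst z)\<^sup>2 + \<gamma> * \<bar>l j\<bar> * (\<bar>\<phi> j \<bullet> fst z\<bar> * \<bar>snd z j\<bar>)" by linarith
    qed
    also have "\<dots> = ?c * t j + \<gamma> * \<bar>l j\<bar> * XQ.expectation (\<lambda>z. \<bar>\<phi> j \<bullet> fst z\<bar> * \<bar>snd z j\<bar>)"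
    proof -
      have "XQ.expectation (\<lambda>z. ?c * (\<phi> j \<bullet> fst z)\<^sup>2 + \<gamma> * \<bar>l j\<bar> * (\<bar>\<phi> j \<bullet> fst z\<bar> * \<bar>snd z j\<bar>))
        = XQ.expectation (\<lambda>z. ?c * (\<phi> j \<bullet> fst z)\<^sup>2) + XQ.expectation (\<lambda>z. \<gamma> * \<bar>l j\<bar> * (\<bar>\<phi> j \<bullet> fst z\<bar> * \<bar>snd z j\<bar>))"
        by (intro Bochner_Integration.integral_add integrable_mult_right sqP(1) geabsP(1))
      then show ?thesis unfolding integral_mult_right_zero sqP(2) .
    qed
    also have "\<dots> \<le> ?c * t j + \<gamma> * \<bar>l j\<bar> * sqrt (t j)"
      using noise_pos by (intro add_left_mono mult_left_mono ge_le) auto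
    also have "\<dots> = 2 * ((l j)\<^sup>2 * t j) + (ldag j)\<^sup>2 * t j + \<gamma> * \<bar>l j * sqrt (t j)\<bar>"
      using variance_pos[of j] by (simp add: abs_mult distrib_right)
    finally show "norm (XQ.expectation (\<lambda>z. \<bar>f j z\<bar>)) \<le> 2 * ((l j)\<^sup>2 * t j) + (ldag j)\<^sup>2 * t j + \<gamma> * \<bar>l j * sqrt (t j)\<bar>"
      by simp
  qed
  have ae1: "AE z in ?P. summable (\<lambda>j. \<bar>l j * (\<phi> j \<bullet> fst z)\<bar>)"
  proof (rule AE_summable_of_summable_integrals[where h = "\<lambda>j z. \<bar>l j\<bar> * \<bar>\<phi> j \<bullet> fst z\<bar>"])
    show "integrable ?P (\<lambda>z. \<bar>l j\<bar> * \<bar>\<phi> j \<bullet> fst z\<bar>)" for j by (intro integrable_mult_right absP(1))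
    have "XQ.expectation (\<lambda>z. \<bar>l j\<bar> * \<bar>\<phi> j \<bullet> fst z\<bar>) \<le> \<bar>l j * sqrt (t j)\<bar>" for j
      unfolding integral_mult_right_zero absP(2) abs_mult[of "l j"]
      using variance_pos[of j] g1(2)[of j] by (intro mult_left_mono) auto
    then show "summable (\<lambda>j. XQ.expectation (\<lambda>z. \<bar>l j\<bar> * \<bar>\<phi> j \<bullet> fst z\<bar>))"
      by (intro summable_comparison_test'[OF l, of 0]) simp
  qed (simp add: abs_mult)
  have ae2: "AE z in ?P. summable (\<lambda>j. \<bar>(ldag j * (\<phi> j \<bullet> fst z))\<^sup>2\<bar>)"
  proof (rule AE_summable_of_summable_integrals[where h = "\<lambda>j z. (ldag j)\<^sup>2 * (\<phi> j \<bullet> fst z)\<^sup>2"])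
    show "integrable ?P (\<lambda>z. (ldag j)\<^sup>2 * (\<phi> j \<bullet> fst z)\<^sup>2)" for j by (intro integrable_mult_right sqP(1))
    show "summable (\<lambda>j. XQ.expectation (\<lambda>z. (ldag j)\<^sup>2 * (\<phi> j \<bullet> fst z)\<^sup>2))"
      unfolding integral_mult_right_zero sqP(2) by (rule truth_sum)
  qed (simp add: power_mult_distrib)
  have ae3: "AE z in ?P. summable (\<lambda>j. \<bar>l j * ((\<phi> j \<bullet> fst z) * snd z j)\<bar>)"
  proof (rule AE_summable_of_summable_integrals[where h = "\<lambda>j z. \<bar>l j\<bar> * (\<bar>\<phi> j \<bullet> fst z\<bar> * \<bar>snd z j\<bar>)"])
    show "integrable ?P (\<lambda>z. \<bar>l j\<bar> * (\<bar>\<phi> j \<bullet> fst z\<bar> * \<bar>snd z j\<bar>))" for j by (intro integrable_mult_right geabsP(1))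
    have nn: "0 \<le> XQ.expectation (\<lambda>z. \<bar>\<phi> j \<bullet> fst z\<bar> * \<bar>snd z j\<bar>)" for j by (intro integral_nonneg_AE) simp
    have "norm (XQ.expectation (\<lambda>z. \<bar>l j\<bar> * (\<bar>\<phi> j \<bullet> fst z\<bar> * \<bar>snd z j\<bar>))) \<le> \<bar>l j * sqrt (t j)\<bar>" for j
      unfolding integral_mult_right_zero abs_mult real_norm_def abs_idempotent abs_of_nonneg[OF nn]
      using variance_pos[of j] ge_le[of j] by (intro mult_left_mono) auto
    then show "summable (\<lambda>j. XQ.expectation (\<lambda>z. \<bar>l j\<bar> * (\<bar>\<phi> j \<bullet> fst z\<bar> * \<bar>snd z j\<bar>)))"
      by (intro summable_comparison_test'[OF l, of 0])
  qed (simp add: abs_mult)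
  have ae: "AE z in ?P. loss \<phi> l (fst z) (\<lambda>j. (\<phi> j \<bullet> fst z) * ldag j + \<gamma> * snd z j) = (\<Sum>j. f j z)"
    using ae1 ae2 ae3
  proof eventually_elim
    case (elim z)
    have "(\<lambda>j. f j z) sums loss \<phi> l (fst z) (\<lambda>j. (\<phi> j \<bullet> fst z) * ldag j + \<gamma> * snd z j)"
      unfolding f_def using elim by (intro loss_sums orthonormal) simp_all
    then show ?case by (rule sums_unique)
  qed
  let ?T = "\<lambda>(x, \<xi>). (x, \<lambda>j. (\<phi> j \<bullet> x) * ldag j + \<gamma> * \<xi> j)"
  have loss_meas: "(\<lambda>(x, y). loss \<phi> l x y) \<in> borel_measurable (borel \<Otimes>\<^sub>M (\<Pi>\<^sub>M j\<in>UNIV. borel))"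
    unfolding case_prod_beta' by (intro measurable_loss) measurable
  note T = observe_pair_measurable
  have "expected_risk \<phi> \<nu> \<gamma> ldag l = (\<integral>z. (\<lambda>(x, y). loss \<phi> l x y) (?T z) \<partial>?P)"
    unfolding expected_risk_def pair_law_def by (rule integral_distr[OF T loss_meas])
  also have "\<dots> = (\<integral>z. loss \<phi> l (fst z) (\<lambda>j. (\<phi> j \<bullet> fst z) * ldag j + \<gamma> * snd z j) \<partial>?P)"
    by (simp add: case_prod_beta')
  also have "\<dots> = (\<integral>z. (\<Sum>j. f j z) \<partial>?P)"
  proof (rule integral_cong_AE[OF _ _ ae])
    have [measurable]: "f j \<in> borel_measurable ?P" for j using f_int by auto
    show "(\<lambda>z. \<Sum>j. f j z) \<in> borel_measurable ?P" by measurable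
    show "(\<lambda>z. loss \<phi> l (fst z) (\<lambda>j. (\<phi> j \<bullet> fst z) * ldag j + \<gamma> * snd z j)) \<in> borel_measurable ?P"
      using measurable_compose[OF T loss_meas] by (simp add: case_prod_beta')
  qed
  also have "\<dots> = (\<Sum>j. XQ.expectation (f j))" by (rule integral_suminf_of_summable_abs(2)[OF f_int f_sum])
  finally show ?thesis
    using summable_sums[OF integral_suminf_of_summable_abs(3)[OF f_int f_sum]] unfolding f_mean by simp
qed

section \<open>The generalization gap as a series\<close>

definition observe :: "(nat \<Rightarrow> 'a) \<times> (nat \<times> nat \<Rightarrow> real) \<Rightarrow> 'a dataset" where
  "observe = (\<lambda>(X, \<Xi>). (X, \<lambda>(j, n)\<in>UNIV \<times> {..<N}. (\<phi> j \<bullet> X n) * ldag j + \<gamma> * \<Xi> (j, n)))"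

abbreviation data_space where
  "data_space \<equiv> (\<Pi>\<^sub>M n\<in>{..<N}. (borel :: 'a measure)) \<Otimes>\<^sub>M (\<Pi>\<^sub>M i\<in>(UNIV :: nat set) \<times> {..<N}. (borel :: real measure))"

lemma data_law_eq: "data_law \<phi> \<nu> \<gamma> ldag N = distr R.P data_space observe"
  by (simp add: data_law_def observe_def)

lemma observe_measurable: "observe \<in> measurable R.P data_space"
proof -
  have [measurable_cong]: "sets std_gaussian = sets borel" by (rule sets_std_gaussian)
  have X: "fst \<in> measurable R.P (\<Pi>\<^sub>M n\<in>{..<N}. borel)"
  proof -
    have "sets (\<Pi>\<^sub>M n\<in>{..<N}. (borel :: 'a measure)) = sets MX"
      by (intro sets_PiM_cong refl) (simp add: sets_nu)
    then show ?thesis by (subst measurable_cong_sets[OF refl]) auto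
  qed
  have Y: "(\<lambda>z. \<lambda>i\<in>UNIV \<times> {..<N}. case i of (j, n) \<Rightarrow> (\<phi> j \<bullet> fst z n) * ldag j + \<gamma> * snd z (j, n))
      \<in> measurable R.P (\<Pi>\<^sub>M i\<in>UNIV \<times> {..<N}. borel)"
  proof (rule measurable_restrict)
    fix i :: "nat \<times> nat" assume "i \<in> UNIV \<times> {..<N}"
    then obtain j n where i: "i = (j, n)" "n < N" by auto
    have [measurable]: "(\<lambda>z. \<phi> j \<bullet> fst z n) \<in> borel_measurable R.P" "(\<lambda>z. snd z (j, n)) \<in> borel_measurable R.P"
      using measurable_compose[OF measurable_fst R.g_meas[OF i(2)]] measurable_compose[OF measurable_snd R.\<xi>_meas[OF i(2)]]
      by auto
    show "(\<lambda>z. case i of (j, n) \<Rightarrow> (\<phi> j \<bullet> fst z n) * ldag j + \<gamma> * snd z (j, n)) \<in> borel_measurable R.P"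
      unfolding i(1) prod.case by measurable
  qed
  have "(\<lambda>z. (fst z, \<lambda>i\<in>UNIV \<times> {..<N}. case i of (j, n) \<Rightarrow> (\<phi> j \<bullet> fst z n) * ldag j + \<gamma> * snd z (j, n)))
      \<in> measurable R.P data_space"
    by (rule measurable_Pair[OF X Y])
  then show ?thesis unfolding observe_def case_prod_beta' .
qed

lemma data_coordinates_measurable:
  assumes "n < N"
  shows "(\<lambda>D. fst D n) \<in> measurable data_space borel" "(\<lambda>D. snd D (j, n)) \<in> measurable data_space borel"
proof -
  show "(\<lambda>D. fst D n) \<in> measurable data_space borel"
    using assms by (intro measurable_compose[OF measurable_fst measurable_component_singleton]) simp
  show "(\<lambda>D. snd D (j, n)) \<in> measurable data_space borel"
    using assms by (intro measurable_compose[OF measurable_snd measurable_component_singleton]) simp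
qed

lemma posterior_mean_measurable: "(\<lambda>D. posterior_mean \<phi> \<gamma> \<sigma> N D j) \<in> borel_measurable data_space"
proof -
  note [measurable] = data_coordinates_measurable
  show ?thesis unfolding posterior_mean_def case_prod_beta' by measurable
qed

text \<open>
  The expected risk is measurable in the data as an integral that depends on a parameter, and the
  risks as functions of the data are measurable because limits of measurable series are.
\<close>

lemma gap_measurable: "generalization_gap \<phi> \<nu> \<gamma> ldag \<sigma> N \<in> borel_measurable data_space"
proof -
  note [measurable] = data_coordinates_measurable posterior_mean_measurable
  interpret nu: prob_space \<nu> by (rule prob_nu)
  interpret Q: prob_space "\<Pi>\<^sub>M j\<in>(UNIV :: nat set). std_gaussian" by (rule prob_space_PiM) (rule prob_space_std_gaussian)
  interpret XQ: pair_prob_space \<nu> "\<Pi>\<^sub>M j\<in>(UNIV :: nat set). std_gaussian" ..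
  have [measurable_cong]: "sets std_gaussian = sets borel" by (rule sets_std_gaussian)
  let ?pair = "pair_law \<phi> \<nu> \<gamma> ldag"
  have [measurable_cong]: "sets ?pair = sets (borel \<Otimes>\<^sub>M (\<Pi>\<^sub>M j\<in>UNIV. borel))" by (simp add: pair_law_def)
  interpret L: prob_space ?pair
    unfolding pair_law_def by (rule XQ.prob_space_distr[OF observe_pair_measurable])
  have x: "(\<lambda>w. fst (snd w)) \<in> borel_measurable (data_space \<Otimes>\<^sub>M ?pair)"
    "(\<lambda>w. snd (snd w) j) \<in> borel_measurable (data_space \<Otimes>\<^sub>M ?pair)" for j :: nat
    by measurable
  have "(\<lambda>w. loss \<phi> (posterior_mean \<phi> \<gamma> \<sigma> N (fst w)) (fst (snd w)) (snd (snd w))) \<in> borel_measurable (data_space \<Otimes>\<^sub>M ?pair)"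
    by (intro measurable_loss x measurable_compose[OF measurable_fst posterior_mean_measurable])
  then have "(\<lambda>D. \<integral>w. loss \<phi> (posterior_mean \<phi> \<gamma> \<sigma> N D) (fst w) (snd w) \<partial>?pair) \<in> borel_measurable data_space"
    by (intro L.borel_measurable_lebesgue_integral) (simp add: case_prod_beta')
  then have "(\<lambda>D. expected_risk \<phi> \<nu> \<gamma> ldag (posterior_mean \<phi> \<gamma> \<sigma> N D)) \<in> borel_measurable data_space"
    by (simp add: expected_risk_def case_prod_beta')
  moreover have "(\<lambda>D. empirical_risk \<phi> N D (posterior_mean \<phi> \<gamma> \<sigma> N D)) \<in> borel_measurable data_space"
  proof -
    have "(\<lambda>D. loss \<phi> (posterior_mean \<phi> \<gamma> \<sigma> N D) (fst D n) (\<lambda>j. snd D (j, n))) \<in> borel_measurable data_space" if "n < N" for n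
      using that by (intro measurable_loss) measurable
    then show ?thesis unfolding empirical_risk_def case_prod_beta'
      by (intro borel_measurable_times borel_measurable_const borel_measurable_sum) auto
  qed
  ultimately show ?thesis unfolding generalization_gap_def[abs_def] by (rule borel_measurable_diff)
qed

lemma posterior_mean_observe: "posterior_mean \<phi> \<gamma> \<sigma> N (observe z) = (\<lambda>j. R.L j z)"
proof
  fix j
  have X: "fst (observe z) = fst z" by (simp add: observe_def case_prod_beta')
  have "snd (observe z) (j, n) = (\<phi> j \<bullet> fst z n) * ldag j + \<gamma> * snd z (j, n)" if "n < N" for n
    using that by (simp add: observe_def case_prod_beta')
  then have "(\<Sum>n<N. snd (observe z) (j, n) * (\<phi> j \<bullet> fst z n))
      = (\<Sum>n<N. (\<phi> j \<bullet> fst z n)\<^sup>2) * ldag j + \<gamma> * (\<Sum>n<N. (\<phi> j \<bullet> fst z n) * snd z (j, n))"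
    unfolding sum_distrib_left sum_distrib_right sum.distrib[symmetric]
    by (intro sum.cong refl) (simp add: power2_eq_square algebra_simps)
  then have "1 / real N * (\<Sum>n<N. snd (observe z) (j, n) * (\<phi> j \<bullet> fst z n)) = R.S j (fst z) * ldag j + \<gamma> * R.W j z"
    by (simp only:) (simp add: R.S_def R.W_def add_divide_distrib)
  then show "posterior_mean \<phi> \<gamma> \<sigma> N (observe z) j = R.L j z"
    unfolding posterior_mean_def case_prod_beta' X R.L_def by (simp only: R.S_def)
qed

text \<open>
  The posterior mean satisfies the hypotheses of \<open>expected_risk_sums\<close> and, for each sample, of
  \<open>loss_sums\<close> almost surely, so both risks are convergent series and can be subtracted term by term.
\<close>

lemma AE_gap_eq: "AE z in R.P. generalization_gap \<phi> \<nu> \<gamma> ldag \<sigma> N (observe z) = (\<Sum>j. R.gap_term j z)"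
proof -
  have "AE z in R.P. \<forall>n\<in>{..<N}. summable (\<lambda>j. \<bar>R.L j z * (\<phi> j \<bullet> fst z n)\<bar>)
      \<and> summable (\<lambda>j. (ldag j * (\<phi> j \<bullet> fst z n))\<^sup>2) \<and> summable (\<lambda>j. \<bar>R.L j z * ((\<phi> j \<bullet> fst z n) * snd z (j, n))\<bar>)"
  proof (rule AE_finite_allI)
    fix n assume "n \<in> {..<N}"
    then have n: "n < N" by simp
    show "AE z in R.P. summable (\<lambda>j. \<bar>R.L j z * (\<phi> j \<bullet> fst z n)\<bar>)
      \<and> summable (\<lambda>j. (ldag j * (\<phi> j \<bullet> fst z n))\<^sup>2) \<and> summable (\<lambda>j. \<bar>R.L j z * ((\<phi> j \<bullet> fst z n) * snd z (j, n))\<bar>)"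
      using R.AE_summable_L_g[OF n] R.AE_summable_truth_g[OF n] R.AE_summable_L_g_noise[OF n]
      by eventually_elim blast
  qed simp
  then show ?thesis using R.AE_summable_L_sqrt
  proof eventually_elim
    case (elim z)
    let ?f = "\<lambda>n j. 1 / 2 * (R.L j z * (\<phi> j \<bullet> fst z n))\<^sup>2 - ((R.L j z * (\<phi> j \<bullet> fst z n)) * (ldag j * (\<phi> j \<bullet> fst z n))
        + \<gamma> * (R.L j z * ((\<phi> j \<bullet> fst z n) * snd z (j, n))))"
    have "?f n sums loss \<phi> (\<lambda>j. R.L j z) (fst z n) (\<lambda>j. (\<phi> j \<bullet> fst z n) * ldag j + \<gamma> * snd z (j, n))" if "n < N" for n
      using elim(1) that by (intro loss_sums orthonormal) auto
    then have "(\<lambda>j. 1 / real N * (\<Sum>n<N. ?f n j)) sums (1 / real N *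
        (\<Sum>n<N. loss \<phi> (\<lambda>j. R.L j z) (fst z n) (\<lambda>j. (\<phi> j \<bullet> fst z n) * ldag j + \<gamma> * snd z (j, n))))"
      by (intro sums_mult sums_sum) simp
    also have "1 / real N * (\<Sum>n<N. loss \<phi> (\<lambda>j. R.L j z) (fst z n) (\<lambda>j. (\<phi> j \<bullet> fst z n) * ldag j + \<gamma> * snd z (j, n)))
        = empirical_risk \<phi> N (observe z) (\<lambda>j. R.L j z)"
      by (simp add: empirical_risk_def observe_def case_prod_beta')
    finally have "(\<lambda>j. (1 / 2 * t j * (R.L j z)\<^sup>2 - t j * (ldag j * R.L j z)) - 1 / real N * (\<Sum>n<N. ?f n j))
        sums generalization_gap \<phi> \<nu> \<gamma> ldag \<sigma> N (observe z)"
      unfolding generalization_gap_def posterior_mean_observe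
      by (intro sums_diff expected_risk_sums elim(2))
    moreover have "(1 / 2 * t j * (R.L j z)\<^sup>2 - t j * (ldag j * R.L j z)) - 1 / real N * (\<Sum>n<N. ?f n j) = R.gap_term j z" for j
    proof -
      have "?f n j = (1 / 2 * (R.L j z)\<^sup>2 - ldag j * R.L j z) * (\<phi> j \<bullet> fst z n)\<^sup>2
          - (\<gamma> * R.L j z) * ((\<phi> j \<bullet> fst z n) * snd z (j, n))" for n
        by (simp add: power2_eq_square algebra_simps)
      then have "(\<Sum>n<N. ?f n j) = (1 / 2 * (R.L j z)\<^sup>2 - ldag j * R.L j z) * (\<Sum>n<N. (\<phi> j \<bullet> fst z n)\<^sup>2)
          - (\<gamma> * R.L j z) * (\<Sum>n<N. (\<phi> j \<bullet> fst z n) * snd z (j, n))"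
        by (simp only: sum_subtractf sum_distrib_left)
      then have "1 / real N * (\<Sum>n<N. ?f n j) = (1 / 2 * (R.L j z)\<^sup>2 - ldag j * R.L j z) * R.S j (fst z)
          - (\<gamma> * R.L j z) * R.W j z"
        by (simp add: R.S_def R.W_def diff_divide_distrib)
      then show ?thesis unfolding R.gap_term_def by (simp add: algebra_simps)
    qed
    ultimately show ?case by (simp add: sums_unique)
  qed
qed

text \<open>
  The bounds of \<open>gap_series\<close> carried over to the law of the data. For the lower bound, the mean absolute
  gap is at least the mean gap.
\<close>

theorem gap_expectation:
  shows gap_integrable: "integrable (data_law \<phi> \<nu> \<gamma> ldag N) (generalization_gap \<phi> \<nu> \<gamma> ldag \<sigma> N)"
    and gap_upper: "expected_abs_gap \<phi> \<nu> \<gamma> ldag \<sigma> N \<le>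
      (3 / 2 * sqrt K * (\<Sum>j. (ldag j)\<^sup>2 * t j) + \<gamma> * sqrt (\<Sum>j. (ldag j)\<^sup>2 * t j)) / sqrt (real N)
      + 4 * \<gamma>\<^sup>2 / real N * ((\<Sum>j. min 1 (a j * t j)) + K / real N * (\<Sum>j. a j * t j))"
    and gap_lower: "8 * K \<le> real N \<Longrightarrow>
      \<gamma>\<^sup>2 / (12 * real N) * (\<Sum>j<n. min 1 (a j * t j)) \<le> expected_abs_gap \<phi> \<nu> \<gamma> ldag \<sigma> N"
proof -
  let ?gap = "generalization_gap \<phi> \<nu> \<gamma> ldag \<sigma> N" and ?G = "\<lambda>z. \<Sum>j. R.gap_term j z"
  note obs = observe_measurable and gapm = gap_measurable
  have gapP: "(\<lambda>z. ?gap (observe z)) \<in> borel_measurable R.P" by (rule measurable_compose[OF obs gapm])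
  have GP: "?G \<in> borel_measurable R.P" using R.gap_series_integrable by auto
  have int: "integrable R.P (\<lambda>z. ?gap (observe z))"
    using R.gap_series_integrable integrable_cong_AE[OF gapP GP AE_gap_eq] by simp
  then show "integrable (data_law \<phi> \<nu> \<gamma> ldag N) ?gap"
    unfolding data_law_eq integrable_distr_eq[OF obs gapm] .
  have "expected_abs_gap \<phi> \<nu> \<gamma> ldag \<sigma> N = (\<integral>z. \<bar>?gap (observe z)\<bar> \<partial>R.P)"
    unfolding expected_abs_gap_def data_law_eq
    by (rule integral_distr[OF obs]) (intro borel_measurable_abs gapm)
  also have "\<dots> = (\<integral>z. \<bar>?G z\<bar> \<partial>R.P)"
    using AE_gap_eq by (intro integral_cong_AE borel_measurable_abs gapP GP) (auto elim!: eventually_mono)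
  finally have eq: "expected_abs_gap \<phi> \<nu> \<gamma> ldag \<sigma> N = (\<integral>z. \<bar>?G z\<bar> \<partial>R.P)" .
  show "expected_abs_gap \<phi> \<nu> \<gamma> ldag \<sigma> N \<le>
      (3 / 2 * sqrt K * (\<Sum>j. (ldag j)\<^sup>2 * t j) + \<gamma> * sqrt (\<Sum>j. (ldag j)\<^sup>2 * t j)) / sqrt (real N)
      + 4 * \<gamma>\<^sup>2 / real N * ((\<Sum>j. min 1 (a j * t j)) + K / real N * (\<Sum>j. a j * t j))"
    unfolding eq by (rule R.gap_series_upper)
  have "(\<integral>z. ?G z \<partial>R.P) \<le> (\<integral>z. \<bar>?G z\<bar> \<partial>R.P)"
    by (intro integral_mono integrable_abs R.gap_series_integrable) simp
  then show "\<gamma>\<^sup>2 / (12 * real N) * (\<Sum>j<n. min 1 (a j * t j)) \<le> expected_abs_gap \<phi> \<nu> \<gamma> ldag \<sigma> N"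
    if "8 * K \<le> real N"
    unfolding eq using R.gap_series_lower[OF that, of n] by (rule order_trans[rotated])
qed

end

section \<open>Convergence rates\<close>

lemma summable_Suc_powr:
  assumes "b > 1"
  shows "summable (\<lambda>j. real (Suc j) powr (- b))"
  using assms summable_Suc_iff[of "\<lambda>n. real n powr (- b)"] by (simp add: summable_real_powr_iff)

theorem theorem3p11:
  fixes \<phi> :: "nat \<Rightarrow> 'a::{real_inner, banach, second_countable_topology}"
    and \<nu> :: "'a measure"
    and \<gamma> s p \<alpha> :: real
    and ldag \<sigma> :: "nat \<Rightarrow> real"
  assumes basis: "orthonormal_basis \<phi>"
    and train: "training_distribution \<phi> \<nu>"
    and noise: "\<gamma> > 0"
    and prior_pos: "\<And>j. (\<sigma> j)\<^sup>2 > 0"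
    and alpha: "\<alpha> > 1 / 2"
    and alpha_s: "\<alpha> + s > 0"
    and alpha_p: "\<alpha> + (p - 1 / 2) > 0"
    and truth: "ldag \<in> sobolev_seq s"
    and prior: "(\<lambda>j. (\<sigma> j)\<^sup>2) \<in> \<Theta>(\<lambda>j. real (Suc j) powr (- 2 * p))"
    and cov: "(\<lambda>j. \<phi> j \<bullet> covariance \<nu> (\<phi> j)) \<in> \<Theta>(\<lambda>j. real (Suc j) powr (- 2 * \<alpha>))"
    and moments: "moment_assumption \<phi> \<nu>"
  shows
    "(\<forall>\<^sub>F N in sequentially.
        integrable (data_law \<phi> \<nu> \<gamma> ldag N) (generalization_gap \<phi> \<nu> \<gamma> ldag \<sigma> N)) \<and>
     expected_abs_gap \<phi> \<nu> \<gamma> ldag \<sigma> \<in>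
        O(\<lambda>N. real N powr (- min (1 / 2) ((\<alpha> + p - 1 / 2) / (\<alpha> + p)))) \<and>
     ((\<alpha> + s) / (\<alpha> + p) \<ge> 2 \<longrightarrow>
        (\<forall>\<tau> :: nat \<Rightarrow> real.
           (\<forall>n. \<tau> n > 0) \<and> \<tau> \<longlonglongrightarrow> 0 \<and>
           filterlim (\<lambda>n. real n powr (1 / 2) * \<tau> n) at_top sequentially \<longrightarrow>
           expected_abs_gap \<phi> \<nu> \<gamma> ldag \<sigma> \<in>
             \<Omega>(\<lambda>N. \<tau> N * real N powr (- ((\<alpha> + p - 1 / 2) / (\<alpha> + p)))))) \<and>
     ((\<alpha> + s) / (\<alpha> + p) < 2 \<and> p < 1 + \<alpha> + 2 * s \<longrightarrow>
        (\<forall>\<tau> :: nat \<Rightarrow> real.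
           (\<forall>n. \<tau> n > 0) \<and> \<tau> \<longlonglongrightarrow> 0 \<and>
           (\<lambda>n. max (real n powr (- 1 / 2))
                    (real n powr (- (1 + \<alpha> + 2 * s - p) / (2 * \<alpha> + 2 * p)))) \<in> o(\<tau>) \<longrightarrow>
           expected_abs_gap \<phi> \<nu> \<gamma> ldag \<sigma> \<in>
             \<Omega>(\<lambda>N. \<tau> N * real N powr (- ((\<alpha> + p - 1 / 2) / (\<alpha> + p))))))"
proof -
  define \<beta> where "\<beta> = \<alpha> + p"
  define \<rho> where "\<rho> = (\<alpha> + p - 1 / 2) / (\<alpha> + p)"
  define t where "t j = \<phi> j \<bullet> covariance \<nu> (\<phi> j)" for j
  let ?E = "expected_abs_gap \<phi> \<nu> \<gamma> ldag \<sigma>"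
  have \<beta>: "\<beta> > 1 / 2" using alpha_p by (simp add: \<beta>_def)
  have \<rho>: "\<rho> = 1 - 1 / (2 * \<beta>)" using \<beta> by (simp add: \<rho>_def \<beta>_def field_simps)
  have on: "\<phi> i \<bullet> \<phi> j = (if i = j then 1 else 0)" for i j using basis by (simp add: orthonormal_basis_def)
  have t_pos: "0 < t j" for j
  proof -
    have "\<phi> j \<noteq> 0" using on[of j j] by auto
    then show ?thesis using train by (simp add: t_def training_distribution_def)
  qed
  obtain K where K: "0 < K" and fourth: "\<And>h. integrable \<nu> (\<lambda>x. (h \<bullet> x) ^ 4)"
    "\<And>h. (\<integral>x. (h \<bullet> x) ^ 4 \<partial>\<nu>) \<le> K * (h \<bullet> covariance \<nu> h)\<^sup>2"
    using karhunen_loeve_fourth_moment[OF train] moments unfolding moment_assumption_def by blast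
  obtain c1 C1 where c1: "0 < c1" "0 < C1" and s_ge: "\<And>j. c1 * real (Suc j) powr (- 2 * p) \<le> (\<sigma> j)\<^sup>2"
    and s_le: "\<And>j. (\<sigma> j)\<^sup>2 \<le> C1 * real (Suc j) powr (- 2 * p)"
    using bigtheta_pointwise_bounds[OF prior prior_pos] by (metis of_nat_0_less_iff powr_gt_zero zero_less_Suc of_nat_Suc less_irrefl)
  obtain c2 C2 where c2: "0 < c2" "0 < C2" and t_ge: "\<And>j. c2 * real (Suc j) powr (- 2 * \<alpha>) \<le> t j"
    and t_le: "\<And>j. t j \<le> C2 * real (Suc j) powr (- 2 * \<alpha>)"
    using bigtheta_pointwise_bounds[OF cov[folded t_def] t_pos] by (metis of_nat_0_less_iff powr_gt_zero zero_less_Suc of_nat_Suc less_irrefl)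
  have powr_prod: "real (Suc j) powr (- 2 * p) * real (Suc j) powr (- 2 * \<alpha>) = real (Suc j) powr (- 2 * \<beta>)" for j
    by (simp add: powr_add[symmetric] \<beta>_def algebra_simps)
  have st_ge: "c1 * c2 * real (Suc j) powr (- 2 * \<beta>) \<le> (\<sigma> j)\<^sup>2 * t j" for j
  proof -
    have "(c1 * real (Suc j) powr (- 2 * p)) * (c2 * real (Suc j) powr (- 2 * \<alpha>)) \<le> (\<sigma> j)\<^sup>2 * t j"
      using c2 by (intro mult_mono s_ge t_ge) auto
    then show ?thesis unfolding powr_prod[symmetric] by (simp only: mult_ac)
  qed
  have st_le: "(\<sigma> j)\<^sup>2 * t j \<le> C1 * C2 * real (Suc j) powr (- 2 * \<beta>)" for j
  proof -
    have "(\<sigma> j)\<^sup>2 * t j \<le> (C1 * real (Suc j) powr (- 2 * p)) * (C2 * real (Suc j) powr (- 2 * \<alpha>))"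
      using c1 t_pos[of j] by (intro mult_mono s_le t_le) auto
    then show ?thesis unfolding powr_prod[symmetric] by (simp only: mult_ac)
  qed
  have prior_summable: "summable (\<lambda>j. (\<sigma> j)\<^sup>2 * t j)"
  proof (rule summable_comparison_test'[of "\<lambda>j. C1 * C2 * real (Suc j) powr (- (2 * \<beta>))" 0])
    show "summable (\<lambda>j. C1 * C2 * real (Suc j) powr (- (2 * \<beta>)))"
      using \<beta> by (intro summable_mult summable_Suc_powr) simp
    show "norm ((\<sigma> j)\<^sup>2 * t j) \<le> C1 * C2 * real (Suc j) powr (- (2 * \<beta>))" for j
      using st_le[of j] t_pos[of j] by simp
  qed
  have truth_summable: "summable (\<lambda>j. (ldag j)\<^sup>2 * t j)"
  proof (rule summable_comparison_test'[of "\<lambda>j. C2 * (real (Suc j) powr (2 * s) * \<bar>ldag j\<bar>\<^sup>2)" 0])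
    show "summable (\<lambda>j. C2 * (real (Suc j) powr (2 * s) * \<bar>ldag j\<bar>\<^sup>2))"
      using truth by (intro summable_mult) (simp add: sobolev_seq_def)
    fix j
    have "t j \<le> C2 * real (Suc j) powr (- 2 * \<alpha>)" by (rule t_le)
    also have "\<dots> \<le> C2 * real (Suc j) powr (2 * s)"
      using c2 alpha_s by (intro mult_left_mono powr_mono) auto
    finally have "(ldag j)\<^sup>2 * t j \<le> (ldag j)\<^sup>2 * (C2 * real (Suc j) powr (2 * s))"
      by (intro mult_left_mono) auto
    then show "norm ((ldag j)\<^sup>2 * t j) \<le> C2 * (real (Suc j) powr (2 * s) * \<bar>ldag j\<bar>\<^sup>2)"
      using t_pos[of j] by (simp add: mult_ac)
  qed
  have reg: "operator_regression \<phi> \<nu> \<gamma> K ldag \<sigma> N" if "0 < N" for N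
    by unfold_locales (use that on train K noise prior_pos t_pos fourth truth_summable prior_summable in \<open>auto simp: t_def\<close>)
  \<comment> \<open>The products \<open>a N j * t j\<close> lie between \<open>c\<close> and \<open>C\<close> times \<open>N (j + 1) powr (- 2 \<beta>)\<close>.\<close>
  define c where "c = c1 * c2 / \<gamma>\<^sup>2"
  define C where "C = C1 * C2 / \<gamma>\<^sup>2"
  define a where "a N j = real N * inverse (\<gamma>\<^sup>2) * (\<sigma> j)\<^sup>2" for N j
  have cC: "0 < c" "0 < C" using c1 c2 noise by (simp_all add: c_def C_def)
  have at_ge: "c * real N * real (Suc j) powr (- 2 * \<beta>) \<le> a N j * t j" for N j
  proof -
    have "(real N * inverse (\<gamma>\<^sup>2)) * (c1 * c2 * real (Suc j) powr (- 2 * \<beta>)) \<le> (real N * inverse (\<gamma>\<^sup>2)) * ((\<sigma> j)\<^sup>2 * t j)"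
      by (intro mult_left_mono st_ge) auto
    then show ?thesis by (simp add: a_def c_def divide_inverse mult_ac)
  qed
  have at_le: "a N j * t j \<le> C * real N * real (Suc j) powr (- 2 * \<beta>)" for N j
  proof -
    have "(real N * inverse (\<gamma>\<^sup>2)) * ((\<sigma> j)\<^sup>2 * t j) \<le> (real N * inverse (\<gamma>\<^sup>2)) * (C1 * C2 * real (Suc j) powr (- 2 * \<beta>))"
      by (intro mult_left_mono st_le) auto
    then show ?thesis by (simp add: a_def C_def divide_inverse mult_ac)
  qed
  \<comment> \<open>Dividing the effective dimension by the sample size gives the exponent \<open>- \<rho>\<close>.\<close>
  have rate: "1 / real N * real N powr (1 / (2 * \<beta>)) = real N powr (- \<rho>)" if "0 < N" for N
    using that by (simp add: \<rho> powr_diff)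
  define A where "A = 3 / 2 * sqrt K * (\<Sum>j. (ldag j)\<^sup>2 * t j) + \<gamma> * sqrt (\<Sum>j. (ldag j)\<^sup>2 * t j)"
  define B where "B = 2 + C / (2 * \<beta> - 1)"
  define D where "D = (\<Sum>j. (\<sigma> j)\<^sup>2 * t j)"
  have ABD: "0 \<le> A" "0 \<le> B" "0 \<le> D"
  proof -
    have "0 \<le> (\<Sum>j. (ldag j)\<^sup>2 * t j)" using t_pos by (intro suminf_nonneg truth_summable) (simp add: less_imp_le)
    then show "0 \<le> A" using K noise by (simp add: A_def)
    show "0 \<le> B" using cC \<beta> by (simp add: B_def)
    show "0 \<le> D" unfolding D_def using t_pos by (intro suminf_nonneg prior_summable) (simp add: less_imp_le)
  qed
  have upper: "?E N \<le> (A + 4 * \<gamma>\<^sup>2 * B + 4 * K * D) * real N powr (- min (1 / 2) \<rho>)" if N: "0 < N" for N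
  proof -
    interpret operator_regression \<phi> \<nu> \<gamma> K ldag \<sigma> N by (rule reg[OF N])
    have summin: "summable (\<lambda>j. min 1 (a N j * t j))" using R.summable_min by (simp add: a_def t_def)
    have min_le: "(\<Sum>j. min 1 (a N j * t j)) \<le> B * real N powr (1 / (2 * \<beta>))"
    proof (rule suminf_le_const[OF summin])
      fix n
      have "(\<Sum>j<n. min 1 (a N j * t j)) \<le> (\<Sum>j<n. min 1 (C * real N * real (Suc j) powr (- 2 * \<beta>)))"
        by (intro sum_mono min.mono at_le order_refl)
      also have "\<dots> \<le> B * real N powr (1 / (2 * \<beta>))"
        unfolding B_def using N by (intro sum_min_powr_le \<beta> cC) simp
      finally show "(\<Sum>j<n. min 1 (a N j * t j)) \<le> B * real N powr (1 / (2 * \<beta>))" .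
    qed
    have at_sum: "(\<Sum>j. a N j * t j) = real N * inverse (\<gamma>\<^sup>2) * D"
      unfolding a_def D_def mult.assoc[of _ "(\<sigma> _)\<^sup>2"] by (rule suminf_mult[OF prior_summable])
    have "?E N \<le> A / sqrt (real N) + 4 * \<gamma>\<^sup>2 / real N * ((\<Sum>j. min 1 (a N j * t j)) + K / real N * (\<Sum>j. a N j * t j))"
      using gap_upper by (simp only: A_def a_def t_def)
    also have "\<dots> \<le> A / sqrt (real N) + 4 * \<gamma>\<^sup>2 / real N * (B * real N powr (1 / (2 * \<beta>)) + K / real N * (real N * inverse (\<gamma>\<^sup>2) * D))"
      unfolding at_sum by (intro add_left_mono mult_left_mono add_right_mono min_le) auto
    also have "\<dots> = A * (1 / sqrt (real N)) + 4 * \<gamma>\<^sup>2 * B * (1 / real N * real N powr (1 / (2 * \<beta>))) + 4 * K * D * (1 / real N)"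
      using N noise by (simp add: field_simps)
    also have "\<dots> = A * real N powr (- (1 / 2)) + 4 * \<gamma>\<^sup>2 * B * real N powr (- \<rho>) + 4 * K * D * real N powr (- 1)"
      unfolding rate[OF N] using N by (simp add: powr_minus_divide powr_half_sqrt)
    also have "\<dots> \<le> A * real N powr (- min (1 / 2) \<rho>) + 4 * \<gamma>\<^sup>2 * B * real N powr (- min (1 / 2) \<rho>)
        + 4 * K * D * real N powr (- min (1 / 2) \<rho>)"
      using N ABD K by (intro add_mono mult_left_mono powr_mono) auto
    also have "\<dots> = (A + 4 * \<gamma>\<^sup>2 * B + 4 * K * D) * real N powr (- min (1 / 2) \<rho>)"
      by (simp add: distrib_right)
    finally show ?thesis .
  qed
  have E_nonneg: "0 \<le> ?E N" for N unfolding expected_abs_gap_def by simp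
  have bigo: "?E \<in> O(\<lambda>N. real N powr (- min (1 / 2) \<rho>))"
    by (rule bigoI[of _ "A + 4 * \<gamma>\<^sup>2 * B + 4 * K * D"], rule eventually_mono[OF eventually_gt_at_top[of 0]])
      (use upper E_nonneg in simp)
  define d where "d = \<gamma>\<^sup>2 / 12 * (min 1 c / 2)"
  have d: "0 < d" using noise cC by (simp add: d_def)
  have lower: "d * real N powr (- \<rho>) \<le> ?E N" if N: "0 < N" "8 * K \<le> real N" for N
  proof -
    interpret operator_regression \<phi> \<nu> \<gamma> K ldag \<sigma> N by (rule reg[OF N(1)])
    have N1: "1 \<le> N" using N by simp
    obtain n where n: "min 1 c / 2 * real N powr (1 / (2 * \<beta>))
        \<le> (\<Sum>j<n. min 1 (c * real N * real (Suc j) powr (- 2 * \<beta>)))"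
      by (rule sum_min_powr_ge[OF \<beta> cC(1) N1])
    also have "\<dots> \<le> (\<Sum>j<n. min 1 (a N j * t j))" by (intro sum_mono min.mono at_ge order_refl)
    finally have "\<gamma>\<^sup>2 / (12 * real N) * (min 1 c / 2 * real N powr (1 / (2 * \<beta>)))
        \<le> \<gamma>\<^sup>2 / (12 * real N) * (\<Sum>j<n. min 1 (a N j * t j))"
      by (intro mult_left_mono) auto
    also have "\<dots> \<le> ?E N" using gap_lower[OF N(2), of n] by (simp only: a_def t_def)
    also have "\<gamma>\<^sup>2 / (12 * real N) * (min 1 c / 2 * real N powr (1 / (2 * \<beta>))) = d * real N powr (- \<rho>)"
      unfolding rate[OF N(1), symmetric] by (simp add: d_def)
    finally show ?thesis .
  qed
  have omega: "?E \<in> \<Omega>(\<lambda>N. \<tau> N * real N powr (- \<rho>))" if \<tau>: "\<forall>n. \<tau> n > 0" "\<tau> \<longlonglongrightarrow> 0" for \<tau>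
  proof (rule landau_omega.bigI[OF d])
    \<comment> \<open>Once \<open>\<tau> N < 1\<close>, the claim follows from the lower bound without the factor \<open>\<tau> N\<close>.\<close>
    have "eventually (\<lambda>N. \<tau> N < 1) sequentially" using order_tendstoD(2)[OF \<tau>(2), of 1] by simp
    moreover have "eventually (\<lambda>N. 8 * K \<le> real N) sequentially"
      using filterlim_real_sequentially by (simp add: filterlim_at_top)
    ultimately show "eventually (\<lambda>N. d * norm (\<tau> N * real N powr (- \<rho>)) \<le> norm (?E N)) sequentially"
      using eventually_gt_at_top[of 0]
    proof eventually_elim
      case (elim N)
      have "d * norm (\<tau> N * real N powr (- \<rho>)) = d * (\<tau> N * real N powr (- \<rho>))"
        using \<tau>(1) by (simp add: less_imp_le)
      also have "\<dots> \<le> d * (1 * real N powr (- \<rho>))"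
        using elim d by (intro mult_left_mono mult_right_mono) auto
      also have "\<dots> \<le> norm (?E N)" using lower[OF elim(3,2)] by simp
      finally show ?case .
    qed
  qed
  have int: "\<forall>\<^sub>F N in sequentially. integrable (data_law \<phi> \<nu> \<gamma> ldag N) (generalization_gap \<phi> \<nu> \<gamma> ldag \<sigma> N)"
    by (rule eventually_mono[OF eventually_gt_at_top[of 0]]) (rule operator_regression.gap_integrable[OF reg])
  show ?thesis
    using int bigo omega unfolding \<rho>_def by blast
qed

end
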